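(* Let $\mathcal M=(M,<,\ldots)$ be a definably complete locally o-minimal structure having property (a) (the image of a nonempty definable discrete set under a coordinate projection is again discrete). Let $X\subseteq M^m$ and $Y\subseteq M^n$ be definable sets and let $\varphi:X\to Y$ be a definable surjective map whose fibers are equi-dimensional, that is, the dimension of the fiber $\varphi^{-1}(y)$ is the same for all $y\in Y$. Then $\dim X=\dim Y+\dim\varphi^{-1}(y)$ for all $y\in Y$.
   Context: "Definable" means definable in $\mathcal M$ with parameters. $M$ carries the order topology and $M^n$ the product topology ($M^0$ is a single point). An open interval is a set $(a,b)=\{x\in M\mid a<x<b\}$ with $a,b\in M$. A coordinate projection $M^n\to M^d$ is a map $(x_1,\ldots,x_n)\mapsto(x_{i_1},\ldots,x_{i_d})$ with $1\le i_1<\cdots<i_d\le n$. A set is discrete if its subspace topology is discrete. A densely linearly ordered structure without endpoints $\mathcal M=(M,<,\ldots)$ is locally o-minimal if for every definable $X\subseteq M$ and every $a\in M$ there is an open interval $I$ containing $a$ such that $X\cap I$ is a finite union of points and open intervals. It is definably complete if every definable subset of $M$ has a supremum and an infimum in $M\cup\{\pm\infty\}$. Dimension: for a nonempty definable $X\subseteq M^n$, $\dim X$ is the maximal nonnegative integer $d$ such that $\pi(X)$ has a nonempty interior for some coordinate projection $\pi:M^n\to M^d$; $\dim\emptyset=-\infty$. *)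

theory Defs
  imports "HOL-Analysis.Analysis" "HOL-Library.Lub_Glb" "HOL-Library.Extended"
begin

text \<open>
  The underlying set \<open>M\<close> of a structure is a type \<open>'a\<close>, and the symbol \<open><\<close> is always interpreted
  by the order of \<open>'a\<close>; it is an atom of the formulas below. The record collects the
  further symbols (paired with their arities, so that the language may also have none) and their
  interpretations. Interpretations only matter on argument lists of the declared length.
\<close>

record ('a, 'f, 'r) ostruct =
  fun_syms :: "('f \<times> nat) set"
  rel_syms :: "('r \<times> nat) set"
  fun_interp :: "'f \<Rightarrow> 'a list \<Rightarrow> 'a"
  rel_interp :: "'r \<Rightarrow> 'a list \<Rightarrow> bool"

datatype 'f trm = Var nat | Fun 'f "'f trm list"

datatype ('f, 'r) form =
    Eq "'f trm" "'f trm"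
  | Less "'f trm" "'f trm"
  | Rel 'r "'f trm list"
  | Neg "('f, 'r) form"
  | Conj "('f, 'r) form" "('f, 'r) form"
  | Ex nat "('f, 'r) form"

primrec wf_trm :: "('a, 'f, 'r) ostruct \<Rightarrow> 'f trm \<Rightarrow> bool" where
  "wf_trm \<M> (Var i) \<longleftrightarrow> True"
| "wf_trm \<M> (Fun f ts) \<longleftrightarrow> (f, length ts) \<in> fun_syms \<M> \<and> list_all (wf_trm \<M>) ts"

primrec wf_form :: "('a, 'f, 'r) ostruct \<Rightarrow> ('f, 'r) form \<Rightarrow> bool" where
  "wf_form \<M> (Eq s t) \<longleftrightarrow> wf_trm \<M> s \<and> wf_trm \<M> t"
| "wf_form \<M> (Less s t) \<longleftrightarrow> wf_trm \<M> s \<and> wf_trm \<M> t"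
| "wf_form \<M> (Rel r ts) \<longleftrightarrow> (r, length ts) \<in> rel_syms \<M> \<and> list_all (wf_trm \<M>) ts"
| "wf_form \<M> (Neg \<psi>) \<longleftrightarrow> wf_form \<M> \<psi>"
| "wf_form \<M> (Conj \<psi> \<theta>) \<longleftrightarrow> wf_form \<M> \<psi> \<and> wf_form \<M> \<theta>"
| "wf_form \<M> (Ex i \<psi>) \<longleftrightarrow> wf_form \<M> \<psi>"

primrec eval_trm :: "('a, 'f, 'r) ostruct \<Rightarrow> (nat \<Rightarrow> 'a) \<Rightarrow> 'f trm \<Rightarrow> 'a" where
  "eval_trm \<M> v (Var i) = v i"
| "eval_trm \<M> v (Fun f ts) = fun_interp \<M> f (map (eval_trm \<M> v) ts)"

primrec sat :: "('a::ord, 'f, 'r) ostruct \<Rightarrow> (nat \<Rightarrow> 'a) \<Rightarrow> ('f, 'r) form \<Rightarrow> bool" where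
  "sat \<M> v (Eq s t) \<longleftrightarrow> eval_trm \<M> v s = eval_trm \<M> v t"
| "sat \<M> v (Less s t) \<longleftrightarrow> eval_trm \<M> v s < eval_trm \<M> v t"
| "sat \<M> v (Rel r ts) \<longleftrightarrow> rel_interp \<M> r (map (eval_trm \<M> v) ts)"
| "sat \<M> v (Neg \<psi>) \<longleftrightarrow> \<not> sat \<M> v \<psi>"
| "sat \<M> v (Conj \<psi> \<theta>) \<longleftrightarrow> sat \<M> v \<psi> \<and> sat \<M> v \<theta>"
| "sat \<M> v (Ex i \<psi>) \<longleftrightarrow> (\<exists>a. sat \<M> (v(i := a)) \<psi>)"

text \<open>
  \<open>M\<^sup>n\<close> is the set of extensional functions on \<open>{..<n}\<close> (so coordinates are numbered from 0),
  with the product topology; \<open>euclidean\<close> is the library's name for the type class topology,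
  which is the order topology for types of class \<open>linorder_topology\<close>.
\<close>

abbreviation cart_power :: "nat \<Rightarrow> (nat \<Rightarrow> 'a) set" where
  "cart_power n \<equiv> {..<n} \<rightarrow>\<^sub>E UNIV"

abbreviation power_top :: "nat \<Rightarrow> (nat \<Rightarrow> 'a::topological_space) topology" where
  "power_top n \<equiv> product_topology (\<lambda>_. euclidean) {..<n}"

text \<open>
  Definability with parameters: in the defining formula the variables below \<open>n\<close> stand for the
  coordinates of \<open>x\<close>, and those from \<open>n\<close> on are assigned the parameters \<open>p\<close>.
\<close>

definition definable :: "('a::ord, 'f, 'r) ostruct \<Rightarrow> nat \<Rightarrow> (nat \<Rightarrow> 'a) set \<Rightarrow> bool" where
  "definable \<M> n X \<longleftrightarrow>
    (\<exists>\<psi> p. wf_form \<M> \<psi> \<and> X = {x \<in> cart_power n. sat \<M> (\<lambda>i. if i < n then x i else p i) \<psi>})"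

definition definable_subset :: "('a::ord, 'f, 'r) ostruct \<Rightarrow> 'a set \<Rightarrow> bool" where
  "definable_subset \<M> X \<longleftrightarrow> definable \<M> 1 {x \<in> cart_power 1. x 0 \<in> X}"

definition join :: "nat \<Rightarrow> nat \<Rightarrow> (nat \<Rightarrow> 'a) \<Rightarrow> (nat \<Rightarrow> 'a) \<Rightarrow> nat \<Rightarrow> 'a" where
  "join m n x y = (\<lambda>i\<in>{..<m + n}. if i < m then x i else y (i - m))"

definition definable_map ::
  "('a::ord, 'f, 'r) ostruct \<Rightarrow> nat \<Rightarrow> nat \<Rightarrow> (nat \<Rightarrow> 'a) set \<Rightarrow> (nat \<Rightarrow> 'a) set
    \<Rightarrow> ((nat \<Rightarrow> 'a) \<Rightarrow> nat \<Rightarrow> 'a) \<Rightarrow> bool" where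
  "definable_map \<M> m n X Y \<phi> \<longleftrightarrow>
    \<phi> \<in> X \<rightarrow> Y \<and> definable \<M> (m + n) ((\<lambda>x. join m n x (\<phi> x)) ` X)"

definition coord_projections :: "nat \<Rightarrow> nat \<Rightarrow> ((nat \<Rightarrow> 'a) \<Rightarrow> nat \<Rightarrow> 'a) set" where
  "coord_projections n d =
    {\<lambda>x. \<lambda>k\<in>{..<d}. x (\<iota> k) | \<iota>. \<iota> \<in> {..<d} \<rightarrow> {..<n} \<and> strict_mono_on {..<d} \<iota>}"

definition discrete_set :: "nat \<Rightarrow> (nat \<Rightarrow> 'a::topological_space) set \<Rightarrow> bool" where
  "discrete_set n X \<longleftrightarrow> subtopology (power_top n) X = discrete_topology X"

text \<open>
  Values of the dimension are of the form \<open>Minf\<close> (that is, \<open>-\<infinity>\<close>) or \<open>Fin d\<close>. For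
  nonempty \<open>X\<close> the maximum is over a set that contains 0 and is bounded by \<open>n\<close>.
\<close>

definition set_dim :: "nat \<Rightarrow> (nat \<Rightarrow> 'a::topological_space) set \<Rightarrow> nat extended" where
  "set_dim n X =
    (if X = {} then Minf
     else Fin (Max {d. \<exists>\<pi>\<in>coord_projections n d. power_top d interior_of (\<pi> ` X) \<noteq> {}}))"

definition definably_complete :: "('a::linorder, 'f, 'r) ostruct \<Rightarrow> bool" where
  "definably_complete \<M> \<longleftrightarrow>
    (\<forall>X. definable_subset \<M> X \<longrightarrow>
      (\<exists>s. isLub UNIV (Fin ` X) s) \<and> (\<exists>i. isGlb UNIV (Fin ` X) i))"

definition locally_o_minimal :: "('a::unbounded_dense_linorder, 'f, 'r) ostruct \<Rightarrow> bool" where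
  "locally_o_minimal \<M> \<longleftrightarrow>
    (\<forall>X a. definable_subset \<M> X \<longrightarrow>
      (\<exists>l u. a \<in> {l<..<u} \<and>
        (\<exists>F. finite F \<and> (\<forall>J\<in>F. (\<exists>c. J = {c}) \<or> (\<exists>c d. J = {c<..<d})) \<and>
          X \<inter> {l<..<u} = \<Union>F)))"

definition property_a :: "('a::linorder_topology, 'f, 'r) ostruct \<Rightarrow> bool" where
  "property_a \<M> \<longleftrightarrow>
    (\<forall>n d X. \<forall>\<pi>\<in>coord_projections n d.
      definable \<M> n X \<and> X \<noteq> {} \<and> discrete_set n X \<longrightarrow> discrete_set d (\<pi> ` X))"

end

theory Submission
  imports Defs
begin

text \<open>
  Everything rests on a definable Kuratowski--Ulam principle: if each fibre over a box contains an
  interval, then one interval works for all points of a smaller box. By it, a finite definable cover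
  of a box has a member with interior, and coordinates can be added to a projection one at a time.
  Over a one-dimensional base the principle follows from one-sided continuity of definable
  functions on some interval: a function without it would have a discrete graph over an interval,
  contrary to property (a). Property (a) enters once more to show that adding a coordinate in which
  the fibres have no interior does not raise the dimension. Additivity of dimension over the two
  projections of the graph of \<open>\<phi>\<close> then gives the theorem, since the graph has one-point fibres over \<open>X\<close>.
\<close>

section \<open>Definable predicates\<close>

text \<open>What remains are germs: at each point and on each side, a definable set or its
  complement fills a punctured neighbourhood. Suprema and infima of fibres serve as the definable
  functions. One-sided continuity has a price: two functions may be continuous from opposite sides
  only, and separating them by constants is the hard point of the one-dimensional case. A fibre
  attains its dimension through a coordinate projection that varies with the base point. There are
  only finitely many projections, so the covering result makes this choice uniform and gives the
  lower bound for the dimension of a total space. The upper bound splits the points by whether the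
  section in the last coordinate contains an interval: if so, that coordinate counts one in the
  fibre as well; if not, it costs nothing.\<close>

primrec ren_trm :: "(nat \<Rightarrow> nat) \<Rightarrow> 'f trm \<Rightarrow> 'f trm" where
  "ren_trm f (Var i) = Var (f i)"
| "ren_trm f (Fun g ts) = Fun g (map (ren_trm f) ts)"

lemma wf_ren_trm: "wf_trm \<M> (ren_trm f t) = wf_trm \<M> t"
  by (induction t) (auto simp: list_all_iff)

lemma eval_ren_trm: "eval_trm \<M> v (ren_trm f t) = eval_trm \<M> (\<lambda>i. v (f i)) t"
  by (induction t) (auto simp: comp_def cong: map_cong)

lemma list_uniform_bound:
  assumes "\<forall>t\<in>set ts. \<exists>N::nat. Q N t" "\<And>M N t. Q M t \<Longrightarrow> M \<le> N \<Longrightarrow> Q N t"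
  shows "\<exists>N. \<forall>t\<in>set ts. Q N t"
  using assms(1)
proof (induction ts)
  case (Cons t ts)
  then obtain A B where "Q A t" "\<forall>t\<in>set ts. Q B t" by auto
  then have "\<forall>t'\<in>set (t # ts). Q (max A B) t'"
    using assms(2) by (metis max.cobounded1 max.cobounded2 set_ConsD)
  then show ?case by blast
qed auto

lemma eval_trm_finite_support:
  "\<exists>N. \<forall>v w. (\<forall>i<N. v i = w i) \<longrightarrow> eval_trm \<M> v t = eval_trm \<M> w t"
proof (induction t)
  case (Var i)
  then show ?case by (intro exI[of _ "Suc i"]) auto
next
  case (Fun f ts)
  have "\<exists>N. \<forall>t\<in>set ts. \<forall>v w. (\<forall>i<N. v i = w i) \<longrightarrow> eval_trm \<M> v t = eval_trm \<M> w t"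
    by (rule list_uniform_bound) (use Fun in \<open>auto dest: less_le_trans\<close>)
  then obtain N where N: "\<forall>t\<in>set ts. \<forall>v w. (\<forall>i<N. v i = w i) \<longrightarrow> eval_trm \<M> v t = eval_trm \<M> w t"
    by blast
  have "eval_trm \<M> v (Fun f ts) = eval_trm \<M> w (Fun f ts)" if "\<forall>i<N. v i = w i" for v w
    using N that by (auto intro!: arg_cong[of _ _ "fun_interp \<M> f"])
  then show ?case by blast
qed

text \<open>This semantic bound stands in for a syntactic set of free variables; it makes room for a
  fresh bound variable when formulas are renamed.\<close>

lemma sat_finite_support:
  "\<exists>N. \<forall>v w. (\<forall>i<N. v i = w i) \<longrightarrow> sat \<M> v \<psi> = sat \<M> w \<psi>"
proof (induction \<psi>)
  case (Eq s t)
  obtain A where A: "\<forall>v w. (\<forall>i<A. v i = w i) \<longrightarrow> eval_trm \<M> v s = eval_trm \<M> w s"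
    using eval_trm_finite_support[of \<M> s] by (rule exE)
  obtain B where B: "\<forall>v w. (\<forall>i<B. v i = w i) \<longrightarrow> eval_trm \<M> v t = eval_trm \<M> w t"
    using eval_trm_finite_support[of \<M> t] by (rule exE)
  have "sat \<M> v (Eq s t) = sat \<M> w (Eq s t)" if h: "\<forall>i<max A B. v i = w i" for v w
  proof -
    have "eval_trm \<M> v s = eval_trm \<M> w s" by (rule A[rule_format]) (use h in simp)
    moreover have "eval_trm \<M> v t = eval_trm \<M> w t" by (rule B[rule_format]) (use h in simp)
    ultimately show ?thesis by simp
  qed
  then show ?case by blast
next
  case (Less s t)
  obtain A where A: "\<forall>v w. (\<forall>i<A. v i = w i) \<longrightarrow> eval_trm \<M> v s = eval_trm \<M> w s"
    using eval_trm_finite_support[of \<M> s] by (rule exE)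
  obtain B where B: "\<forall>v w. (\<forall>i<B. v i = w i) \<longrightarrow> eval_trm \<M> v t = eval_trm \<M> w t"
    using eval_trm_finite_support[of \<M> t] by (rule exE)
  have "sat \<M> v (Less s t) = sat \<M> w (Less s t)" if h: "\<forall>i<max A B. v i = w i" for v w
  proof -
    have "eval_trm \<M> v s = eval_trm \<M> w s" by (rule A[rule_format]) (use h in simp)
    moreover have "eval_trm \<M> v t = eval_trm \<M> w t" by (rule B[rule_format]) (use h in simp)
    ultimately show ?thesis by simp
  qed
  then show ?case by blast
next
  case (Rel r ts)
  have "\<exists>N. \<forall>t\<in>set ts. \<forall>v w. (\<forall>i<N. v i = w i) \<longrightarrow> eval_trm \<M> v t = eval_trm \<M> w t"
    by (rule list_uniform_bound) (use eval_trm_finite_support in \<open>auto dest: less_le_trans\<close>)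
  then obtain N where N: "\<forall>t\<in>set ts. \<forall>v w. (\<forall>i<N. v i = w i) \<longrightarrow> eval_trm \<M> v t = eval_trm \<M> w t"
    by blast
  have "sat \<M> v (Rel r ts) = sat \<M> w (Rel r ts)" if "\<forall>i<N. v i = w i" for v w
  proof -
    have "map (eval_trm \<M> v) ts = map (eval_trm \<M> w) ts"
      unfolding map_eq_conv using N that by blast
    then show ?thesis by (simp only: sat.simps)
  qed
  then show ?case by blast
next
  case (Neg \<psi>)
  then show ?case by simp
next
  case (Conj \<psi> \<theta>)
  obtain A where A: "\<forall>v w. (\<forall>i<A. v i = w i) \<longrightarrow> sat \<M> v \<psi> = sat \<M> w \<psi>"
    using Conj.IH(1) by (rule exE)
  obtain B where B: "\<forall>v w. (\<forall>i<B. v i = w i) \<longrightarrow> sat \<M> v \<theta> = sat \<M> w \<theta>"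
    using Conj.IH(2) by (rule exE)
  have "sat \<M> v (Conj \<psi> \<theta>) = sat \<M> w (Conj \<psi> \<theta>)" if h: "\<forall>i<max A B. v i = w i" for v w
  proof -
    have "sat \<M> v \<psi> = sat \<M> w \<psi>" by (rule A[rule_format]) (use h in simp)
    moreover have "sat \<M> v \<theta> = sat \<M> w \<theta>" by (rule B[rule_format]) (use h in simp)
    ultimately show ?thesis by simp
  qed
  then show ?case by blast
next
  case (Ex j \<psi>)
  then obtain N where N: "\<forall>v w. (\<forall>i<N. v i = w i) \<longrightarrow> sat \<M> v \<psi> = sat \<M> w \<psi>" by blast
  have "sat \<M> v (Ex j \<psi>) = sat \<M> w (Ex j \<psi>)" if "\<forall>i<N. v i = w i" for v w
  proof -
    have "sat \<M> (v(j := a)) \<psi> = sat \<M> (w(j := a)) \<psi>" for a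
      using that by (intro N[rule_format]) simp
    then show ?thesis by simp
  qed
  then show ?case by blast
qed

text \<open>An arbitrary \<open>f\<close> may send a free variable onto a bound one. Each bound
  variable is therefore moved to a fresh index on the way down, which changes \<open>f\<close> and
  forces the induction to generalise over it.\<close>

lemma rename_form:
  "\<exists>\<psi>'. (wf_form \<M> \<psi> \<longrightarrow> wf_form \<M> \<psi>') \<and> (\<forall>v. sat \<M> v \<psi>' \<longleftrightarrow> sat \<M> (\<lambda>i. v (f i)) \<psi>)"
proof (induction \<psi> arbitrary: f)
  case (Eq s t)
  show ?case
    by (intro exI[of _ "Eq (ren_trm f s) (ren_trm f t)"]) (simp add: wf_ren_trm eval_ren_trm)
next
  case (Less s t)
  show ?case
    by (intro exI[of _ "Less (ren_trm f s) (ren_trm f t)"]) (simp add: wf_ren_trm eval_ren_trm)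
next
  case (Rel r ts)
  show ?case
    by (intro exI[of _ "Rel r (map (ren_trm f) ts)"])
      (simp add: wf_ren_trm eval_ren_trm comp_def list_all_iff)
next
  case (Neg \<psi>)
  then obtain \<psi>' where "(wf_form \<M> \<psi> \<longrightarrow> wf_form \<M> \<psi>') \<and> (\<forall>v. sat \<M> v \<psi>' \<longleftrightarrow> sat \<M> (\<lambda>i. v (f i)) \<psi>)"
    by blast
  then show ?case by (intro exI[of _ "Neg \<psi>'"]) simp
next
  case (Conj \<psi> \<theta>)
  obtain \<psi>' \<theta>' where
    "(wf_form \<M> \<psi> \<longrightarrow> wf_form \<M> \<psi>') \<and> (\<forall>v. sat \<M> v \<psi>' \<longleftrightarrow> sat \<M> (\<lambda>i. v (f i)) \<psi>)"
    "(wf_form \<M> \<theta> \<longrightarrow> wf_form \<M> \<theta>') \<and> (\<forall>v. sat \<M> v \<theta>' \<longleftrightarrow> sat \<M> (\<lambda>i. v (f i)) \<theta>)"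
    using Conj.IH[of f] by (elim exE)
  then show ?case by (intro exI[of _ "Conj \<psi>' \<theta>'"]) simp
next
  case (Ex j \<psi>)
  obtain N where N: "\<forall>v w. (\<forall>i<N. v i = w i) \<longrightarrow> sat \<M> v \<psi> = sat \<M> w \<psi>"
    using sat_finite_support[of \<M> \<psi>] by (rule exE)
  obtain k where "k \<notin> f ` {..<N}"
    using ex_new_if_finite[of "f ` {..<N}"] by auto
  then have k: "f i \<noteq> k" if "i < N" for i
    using that by blast
  obtain \<psi>' where \<psi>': "wf_form \<M> \<psi> \<longrightarrow> wf_form \<M> \<psi>'"
    "\<forall>v. sat \<M> v \<psi>' \<longleftrightarrow> sat \<M> (\<lambda>i. v ((f(j := k)) i)) \<psi>"
    using Ex.IH by blast
  have "sat \<M> (v(k := a)) \<psi>' \<longleftrightarrow> sat \<M> ((\<lambda>i. v (f i))(j := a)) \<psi>" for v a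
    unfolding \<psi>'(2)[rule_format] by (rule N[rule_format]) (use k in auto)
  with \<psi>'(1) show ?case by (intro exI[of _ "Ex k \<psi>'"]) simp
qed

text \<open>Even variables are the free ones, odd variables carry the parameters; this leaves room for
  fresh parameters without any bookkeeping of the number of free variables.\<close>

definition dpred :: "('a::ord, 'f, 'r) ostruct \<Rightarrow> ((nat \<Rightarrow> 'a) \<Rightarrow> bool) \<Rightarrow> bool" where
  "dpred \<M> P \<longleftrightarrow> (\<exists>\<psi> p. wf_form \<M> \<psi> \<and>
     (\<forall>v. P v \<longleftrightarrow> sat \<M> (\<lambda>i. if even i then v (i div 2) else p (i div 2)) \<psi>))"

text \<open>Substituting such terms amounts to renaming variables, a constant becoming a fresh
  parameter. This suffices to fix, permute and shift coordinates.\<close>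

definition simple_term :: "((nat \<Rightarrow> 'a) \<Rightarrow> 'a) \<Rightarrow> bool" where
  "simple_term t \<longleftrightarrow> (\<exists>i. t = (\<lambda>v. v i)) \<or> (\<exists>c. t = (\<lambda>v. c))"

lemma simple_term_var [intro]: "simple_term (\<lambda>v. v i)"
  and simple_term_const [intro]: "simple_term (\<lambda>v. c)"
  unfolding simple_term_def by blast+

lemma simple_term_if [intro]:
  "(b \<Longrightarrow> simple_term s) \<Longrightarrow> (\<not> b \<Longrightarrow> simple_term t) \<Longrightarrow> simple_term (\<lambda>v. if b then s v else t v)"
  by (cases b) auto

lemma simple_term_case_nat [intro]:
  assumes "simple_term a" "\<And>k. simple_term (\<lambda>v. b v k)"
  shows "simple_term (\<lambda>v. case i of 0 \<Rightarrow> a v | Suc k \<Rightarrow> b v k)"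
  using assms by (cases i) auto

lemma dpred_renameI:
  assumes "wf_form \<M> \<psi>"
    and "\<And>v. P v \<longleftrightarrow> sat \<M> (\<lambda>i. if even (f i) then v (f i div 2) else p (f i div 2)) \<psi>"
  shows "dpred \<M> P"
proof -
  obtain \<psi>' where "wf_form \<M> \<psi> \<longrightarrow> wf_form \<M> \<psi>'" "\<And>v. sat \<M> v \<psi>' \<longleftrightarrow> sat \<M> (\<lambda>i. v (f i)) \<psi>"
    using rename_form[of \<M> \<psi> f] by blast
  with assms show ?thesis unfolding dpred_def by (intro exI[of _ \<psi>'] exI[of _ p]) simp
qed

lemma dpredE:
  assumes "dpred \<M> P"
  obtains \<psi> p where "wf_form \<M> \<psi>"
    "\<forall>v. P v \<longleftrightarrow> sat \<M> (\<lambda>i. if even i then v (i div 2) else p (i div 2)) \<psi>"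
  using assms unfolding dpred_def by blast

lemma dpred_subst:
  assumes "dpred \<M> P" "\<And>i. simple_term (\<lambda>v. e v i)"
  shows "dpred \<M> (\<lambda>v. P (e v))"
proof -
  obtain \<psi> p where \<psi>: "wf_form \<M> \<psi>"
    "\<forall>v. P v \<longleftrightarrow> sat \<M> (\<lambda>i. if even i then v (i div 2) else p (i div 2)) \<psi>"
    using assms(1) by (rule dpredE)
  have "\<forall>i. \<exists>s c. \<forall>v. e v i = (case s of Some j \<Rightarrow> v j | None \<Rightarrow> c)"
  proof
    fix i
    from assms(2)[of i] consider j where "(\<lambda>v. e v i) = (\<lambda>v. v j)" | c where "(\<lambda>v. e v i) = (\<lambda>v. c)"
      unfolding simple_term_def by blast
    then show "\<exists>s c. \<forall>v. e v i = (case s of Some j \<Rightarrow> v j | None \<Rightarrow> c)"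
    proof cases
      case 1
      then show ?thesis by (intro exI[of _ "Some j"]) (simp add: fun_eq_iff)
    next
      case 2
      then show ?thesis by (intro exI[of _ None] exI[of _ c]) (simp add: fun_eq_iff)
    qed
  qed
  then obtain s c where sc: "\<And>i v. e v i = (case s i of Some j \<Rightarrow> v j | None \<Rightarrow> c i)"
    unfolding choice_iff by blast
  \<comment> \<open>The old parameters go to the even places of the new list \<open>q\<close>, the
    constants of the substitution to the odd ones.\<close>
  define f where "f i = (if even i then (case s (i div 2) of Some j \<Rightarrow> 2 * j | None \<Rightarrow> 2 * (2 * (i div 2) + 1) + 1)
     else 2 * (2 * (i div 2)) + 1)" for i
  define q where "q k = (if even k then p (k div 2) else c (k div 2))" for k
  have "(if even i then e v (i div 2) else p (i div 2)) = (if even (f i) then v (f i div 2) else q (f i div 2))" for i v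
    by (cases "s (i div 2)") (auto simp: f_def q_def sc elim!: oddE)
  then have "P (e v) \<longleftrightarrow> sat \<M> (\<lambda>i. if even (f i) then v (f i div 2) else q (f i div 2)) \<psi>" for v
    unfolding \<psi>(2)[rule_format] by presburger
  then show ?thesis by (rule dpred_renameI[OF \<psi>(1)])
qed

lemma dpred_not:
  assumes "dpred \<M> P" shows "dpred \<M> (\<lambda>v. \<not> P v)"
proof -
  obtain \<psi> p where "wf_form \<M> \<psi>"
    "\<forall>v. P v \<longleftrightarrow> sat \<M> (\<lambda>i. if even i then v (i div 2) else p (i div 2)) \<psi>"
    using assms by (rule dpredE)
  then show ?thesis unfolding dpred_def by (intro exI[of _ "Neg \<psi>"] exI[of _ p]) simp
qed

lemma dpred_conj:
  assumes "dpred \<M> P" "dpred \<M> Q" shows "dpred \<M> (\<lambda>v. P v \<and> Q v)"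
proof -
  obtain \<psi> p where \<psi>: "wf_form \<M> \<psi>"
    "\<forall>v. P v \<longleftrightarrow> sat \<M> (\<lambda>i. if even i then v (i div 2) else p (i div 2)) \<psi>"
    using assms(1) by (rule dpredE)
  obtain \<theta> q where \<theta>: "wf_form \<M> \<theta>"
    "\<forall>v. Q v \<longleftrightarrow> sat \<M> (\<lambda>i. if even i then v (i div 2) else q (i div 2)) \<theta>"
    using assms(2) by (rule dpredE)
  \<comment> \<open>The two parameter lists are interleaved into \<open>r\<close>, while the free
    variables stay where they are.\<close>
  define f where "f b i = (if even i then i else 2 * (2 * (i div 2) + b) + 1)" for b i :: nat
  define r where "r k = (if even k then p (k div 2) else q (k div 2))" for k
  obtain \<psi>' where \<psi>': "wf_form \<M> \<psi> \<longrightarrow> wf_form \<M> \<psi>'" "\<And>v. sat \<M> v \<psi>' \<longleftrightarrow> sat \<M> (\<lambda>i. v (f 0 i)) \<psi>"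
    using rename_form[of \<M> \<psi>] by blast
  obtain \<theta>' where \<theta>': "wf_form \<M> \<theta> \<longrightarrow> wf_form \<M> \<theta>'" "\<And>v. sat \<M> v \<theta>' \<longleftrightarrow> sat \<M> (\<lambda>i. v (f 1 i)) \<theta>"
    using rename_form[of \<M> \<theta>] by blast
  have f0: "(\<lambda>i. if even (f 0 i) then v (f 0 i div 2) else r (f 0 i div 2)) = (\<lambda>i. if even i then v (i div 2) else p (i div 2))"
    and f1: "(\<lambda>i. if even (f 1 i) then v (f 1 i div 2) else r (f 1 i div 2)) = (\<lambda>i. if even i then v (i div 2) else q (i div 2))" for v
    by (auto simp: fun_eq_iff f_def r_def elim!: oddE)
  have "P v \<longleftrightarrow> sat \<M> (\<lambda>i. if even i then v (i div 2) else r (i div 2)) \<psi>'"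
    "Q v \<longleftrightarrow> sat \<M> (\<lambda>i. if even i then v (i div 2) else r (i div 2)) \<theta>'" for v
    unfolding \<psi>'(2) \<theta>'(2) f0 f1 using \<psi>(2) \<theta>(2) by blast+
  then show ?thesis using \<psi>(1) \<psi>'(1) \<theta>(1) \<theta>'(1) unfolding dpred_def
    by (intro exI[of _ "Conj \<psi>' \<theta>'"] exI[of _ r]) simp
qed

lemma dpred_ex_upd:
  assumes "dpred \<M> P" shows "dpred \<M> (\<lambda>v. \<exists>a. P (v(j := a)))"
proof -
  obtain \<psi> p where \<psi>: "wf_form \<M> \<psi>"
    "\<forall>v. P v \<longleftrightarrow> sat \<M> (\<lambda>i. if even i then v (i div 2) else p (i div 2)) \<psi>"
    using assms by (rule dpredE)
  have eq: "(\<lambda>i. if even i then (v(j := a)) (i div 2) else p (i div 2))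
    = (\<lambda>i. if even i then v (i div 2) else p (i div 2))(2 * j := a)" for v a
    by (auto simp: fun_eq_iff)
  have "(\<exists>a. P (v(j := a))) \<longleftrightarrow> sat \<M> (\<lambda>i. if even i then v (i div 2) else p (i div 2)) (Ex (2 * j) \<psi>)" for v
    unfolding sat.simps eq[symmetric] using \<psi>(2) by blast
  then show ?thesis unfolding dpred_def using \<psi>(1)
    by (intro exI[of _ "Ex (2 * j) \<psi>"] exI[of _ p] conjI allI) simp_all
qed

lemma dpred_less_var: "dpred \<M> (\<lambda>v. v i < v j)"
  unfolding dpred_def by (intro exI[of _ "Less (Var (2 * i)) (Var (2 * j))"] exI[of _ undefined]) simp

lemma dpred_eq_var: "dpred \<M> (\<lambda>v. v i = v j)"
  unfolding dpred_def by (intro exI[of _ "Eq (Var (2 * i)) (Var (2 * j))"] exI[of _ undefined]) simp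

lemma dpred_const: "dpred \<M> (\<lambda>v. b)"
proof -
  have "dpred \<M> (\<lambda>v. v 0 = v 0)" by (rule dpred_eq_var)
  from this dpred_not[OF this] show ?thesis by (cases b) simp_all
qed

lemma dpred_disj: "dpred \<M> P \<Longrightarrow> dpred \<M> Q \<Longrightarrow> dpred \<M> (\<lambda>v. P v \<or> Q v)"
  using dpred_not[OF dpred_conj[OF dpred_not[of \<M> P] dpred_not[of \<M> Q]]]
  by (simp only: de_Morgan_conj not_not)

lemma dpred_imp: "dpred \<M> P \<Longrightarrow> dpred \<M> Q \<Longrightarrow> dpred \<M> (\<lambda>v. P v \<longrightarrow> Q v)"
  unfolding imp_conv_disj by (intro dpred_disj dpred_not)

lemma dpred_iff: "dpred \<M> P \<Longrightarrow> dpred \<M> Q \<Longrightarrow> dpred \<M> (\<lambda>v. P v \<longleftrightarrow> Q v)"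
  unfolding iff_conv_conj_imp by (intro dpred_conj dpred_imp)

text \<open>Bound variables are handled in de Bruijn style, so that definability of a formula with
  quantifiers is derived by resolution alone.\<close>

lemma dpred_ex:
  assumes "dpred \<M> (\<lambda>v. P (\<lambda>i. v (Suc i)) (v 0))"
  shows "dpred \<M> (\<lambda>v. \<exists>a. P v a)"
proof -
  \<comment> \<open>The placeholder \<open>undefined\<close> opens slot 0, which the quantifier
    overwrites at once.\<close>
  have "dpred \<M> (\<lambda>v. \<exists>a. P (\<lambda>i. ((case_nat undefined v)(0 := a)) (Suc i)) (((case_nat undefined v)(0 := a)) 0))"
    by (rule dpred_subst[OF dpred_ex_upd[OF assms, where j = 0]]) (intro simple_term_case_nat simple_term_const simple_term_var)
  then show ?thesis by simp
qed

lemma dpred_all: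
  assumes "dpred \<M> (\<lambda>v. P (\<lambda>i. v (Suc i)) (v 0))"
  shows "dpred \<M> (\<lambda>v. \<forall>a. P v a)"
  using dpred_not[OF dpred_ex[where P = "\<lambda>v a. \<not> P v a", OF dpred_not[OF assms]]] by simp

text \<open>A block of \<open>n\<close> quantifiers at once, needed for quantifiers over points of
  \<open>M^n\<close>; each induction step frees one more variable through
  \<open>dpred_ex_upd\<close>.\<close>

lemma dpred_ex_tail:
  assumes "dpred \<M> P"
  shows "dpred \<M> (\<lambda>v. \<exists>w. (\<forall>i\<ge>n. w i = v i) \<and> P w)"
proof (induction n)
  case 0
  have "(\<exists>w. (\<forall>i\<ge>0. w i = v i) \<and> P w) \<longleftrightarrow> P v" for v
  proof
    assume "\<exists>w. (\<forall>i\<ge>0. w i = v i) \<and> P w"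
    then obtain w where w: "\<forall>i. w i = v i" "P w" by auto
    then have "w = v" by auto
    with w show "P v" by simp
  qed auto
  then show ?case using assms by simp
next
  case (Suc n)
  have "(\<exists>a w. (\<forall>i\<ge>n. w i = (v(n := a)) i) \<and> P w) \<longleftrightarrow> (\<exists>w. (\<forall>i\<ge>Suc n. w i = v i) \<and> P w)"
    (is "?l \<longleftrightarrow> ?r") for v
  proof
    assume ?r
    then obtain w where "\<forall>i\<ge>Suc n. w i = v i" "P w" by auto
    then show ?l by (intro exI[of _ "w n"] exI[of _ w]) auto
  next
    assume ?l
    then obtain a w where w: "\<forall>i\<ge>n. w i = (v(n := a)) i" "P w" by auto
    have "w i = v i" if "i \<ge> Suc n" for i
      using w(1)[rule_format, of i] that by auto
    with w(2) show ?r by blast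
  qed
  then show ?case using dpred_ex_upd[OF Suc, of n] by simp
qed

text \<open>The block analogue of \<open>dpred_ex\<close>: the bound point takes the variables below
  \<open>n\<close> and all others are shifted by \<open>n\<close>.\<close>

lemma dpred_bex_power:
  assumes "dpred \<M> (\<lambda>v. P (\<lambda>i. v (i + n)) (restrict v {..<n}))"
  shows "dpred \<M> (\<lambda>v. \<exists>x\<in>cart_power n. P v x)"
proof -
  let ?e = "\<lambda>v i. if i < n then undefined else v (i - n)"
  have "dpred \<M> (\<lambda>v. \<exists>w. (\<forall>i\<ge>n. w i = ?e v i) \<and> P (\<lambda>i. w (i + n)) (restrict w {..<n}))"
    by (rule dpred_subst[OF dpred_ex_tail[OF assms, of n]]) auto
  moreover have "(\<exists>w. (\<forall>i\<ge>n. w i = ?e v i) \<and> P (\<lambda>i. w (i + n)) (restrict w {..<n})) \<longleftrightarrow> (\<exists>x\<in>cart_power n. P v x)"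
    (is "?l \<longleftrightarrow> ?r") for v
  proof
    assume ?l
    then obtain w where w: "\<forall>i\<ge>n. w i = ?e v i" "P (\<lambda>i. w (i + n)) (restrict w {..<n})" by auto
    have "(\<lambda>i. w (i + n)) = v" using w(1) by auto
    then show ?r using w(2) by (intro bexI[of _ "restrict w {..<n}"]) auto
  next
    assume ?r
    then obtain x where x: "x \<in> cart_power n" "P v x" by auto
    have "restrict (\<lambda>i. if i < n then x i else v (i - n)) {..<n} = x"
      using x(1) by (auto simp: fun_eq_iff PiE_def extensional_def)
    then show ?l using x(2)
      by (intro exI[of _ "\<lambda>i. if i < n then x i else v (i - n)"]) simp
  qed
  ultimately show ?thesis by simp
qed

lemma dpred_ball_power:
  assumes "dpred \<M> (\<lambda>v. P (\<lambda>i. v (i + n)) (restrict v {..<n}))"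
  shows "dpred \<M> (\<lambda>v. \<forall>x\<in>cart_power n. P v x)"
  using dpred_not[OF dpred_bex_power[where P = "\<lambda>v x. \<not> P v x", OF dpred_not[OF assms]]] by simp

text \<open>A semantic notion of term: only the graph has to be definable, with the value in
  variable 0. Thus definable functions constructed later can be applied inside formulas as if they
  were function symbols.\<close>

definition dterm :: "('a::ord, 'f, 'r) ostruct \<Rightarrow> ((nat \<Rightarrow> 'a) \<Rightarrow> 'a) \<Rightarrow> bool" where
  "dterm \<M> t \<longleftrightarrow> dpred \<M> (\<lambda>v. v 0 = t (\<lambda>i. v (Suc i)))"

definition dfun :: "('a::ord, 'f, 'r) ostruct \<Rightarrow> ('a \<Rightarrow> 'a) \<Rightarrow> bool" where
  "dfun \<M> f \<longleftrightarrow> dpred \<M> (\<lambda>v. v 1 = f (v 0))"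

lemma dterm_var: "dterm \<M> (\<lambda>v. v i)"
  unfolding dterm_def by (rule dpred_eq_var)

lemma dterm_const: "dterm \<M> (\<lambda>v. c)"
proof -
  have "dpred \<M> (\<lambda>v. (case_nat (v 0) (\<lambda>_. c)) 0 = (case_nat (v 0) (\<lambda>_. c)) 1)"
    by (rule dpred_subst[OF dpred_eq_var]) (intro simple_term_case_nat simple_term_const simple_term_var)
  then show ?thesis by (simp add: dterm_def)
qed

lemma dpred_rel2:
  assumes R: "dpred \<M> (\<lambda>v. R (v 0) (v 1))" and "dterm \<M> s" "dterm \<M> t"
  shows "dpred \<M> (\<lambda>v. R (s v) (t v))"
proof -
  have 1: "dpred \<M> (\<lambda>v. v 0 = s (\<lambda>i. v (Suc (Suc i))))"
    using dpred_subst[OF assms(2)[unfolded dterm_def], of "\<lambda>v. case_nat (v 0) (\<lambda>i. v (Suc (Suc i)))",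
      OF simple_term_case_nat[OF simple_term_var simple_term_var]]
    by simp
  have 2: "dpred \<M> (\<lambda>v. v 1 = t (\<lambda>i. v (Suc (Suc i))))"
    using dpred_subst[OF assms(3)[unfolded dterm_def], of "\<lambda>v. case_nat (v 1) (\<lambda>i. v (Suc (Suc i)))",
      OF simple_term_case_nat[OF simple_term_var simple_term_var]]
    by simp
  have "dpred \<M> (\<lambda>v. \<exists>b a. a = s v \<and> b = t v \<and> R a b)"
    by (intro dpred_ex dpred_conj) (use 1 2 R in simp_all)
  then show ?thesis by simp
qed

lemma dpred_less: "dterm \<M> s \<Longrightarrow> dterm \<M> t \<Longrightarrow> dpred \<M> (\<lambda>v. s v < t v)"
  by (rule dpred_rel2[where R = "(<)", OF dpred_less_var])

lemma dpred_eq: "dterm \<M> s \<Longrightarrow> dterm \<M> t \<Longrightarrow> dpred \<M> (\<lambda>v. s v = t v)"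
  by (rule dpred_rel2[where R = "(=)", OF dpred_eq_var])

lemma dpred_le:
  fixes \<M> :: "('a::linorder, 'f, 'r) ostruct"
  shows "dterm \<M> s \<Longrightarrow> dterm \<M> t \<Longrightarrow> dpred \<M> (\<lambda>v. s v \<le> t v)"
  using dpred_not[OF dpred_less[of \<M> t s]] by (simp add: not_less)

lemma dterm_app:
  assumes "dfun \<M> f" "dterm \<M> t"
  shows "dterm \<M> (\<lambda>v. f (t v))"
proof -
  have "dterm \<M> (\<lambda>v. t (\<lambda>i. v (Suc i)))"
    unfolding dterm_def
    using dpred_subst[OF assms(2)[unfolded dterm_def], of "\<lambda>v. case_nat (v 0) (\<lambda>i. v (Suc (Suc i)))",
      OF simple_term_case_nat[OF simple_term_var simple_term_var]]
    by simp
  from dpred_rel2[where R = "\<lambda>a b. b = f a", OF assms(1)[unfolded dfun_def] this dterm_var]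
  show ?thesis unfolding dterm_def .
qed

lemmas dpred_intros = dpred_not dpred_conj dpred_disj dpred_imp dpred_iff dpred_ex dpred_all
  dpred_less dpred_le dpred_eq dterm_var dterm_const

text \<open>Restricting the valuation turns a predicate on extensional points into one on
  valuations, so that the closure rules for \<open>dpred\<close> apply to subsets of
  \<open>M^n\<close>.\<close>

definition dpow :: "('a::ord, 'f, 'r) ostruct \<Rightarrow> nat \<Rightarrow> ((nat \<Rightarrow> 'a) \<Rightarrow> bool) \<Rightarrow> bool" where
  "dpow \<M> n P \<longleftrightarrow> dpred \<M> (\<lambda>v. P (restrict v {..<n}))"

lemma cart_power_restrict: "x \<in> cart_power n \<Longrightarrow> restrict x {..<n} = x"
  by (auto simp: fun_eq_iff PiE_def extensional_def)

lemma dpred_vec: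
  assumes "dpow \<M> n P" "\<And>v. e v \<in> cart_power n" "\<And>i. i < n \<Longrightarrow> simple_term (\<lambda>v. e v i)"
  shows "dpred \<M> (\<lambda>v. P (e v))"
proof -
  have "dpred \<M> (\<lambda>v. P (restrict (\<lambda>i. if i < n then e v i else undefined) {..<n}))"
    by (rule dpred_subst[OF assms(1)[unfolded dpow_def]]) (use assms(3) in auto)
  moreover have "restrict (\<lambda>i. if i < n then e v i else undefined) {..<n} = e v" for v
    using assms(2)[of v] by (auto simp: fun_eq_iff PiE_def extensional_def)
  ultimately show ?thesis by simp
qed

lemma definable_iff_dpow:
  "definable \<M> n X \<longleftrightarrow> X \<subseteq> cart_power n \<and> dpow \<M> n (\<lambda>x. x \<in> X)"
proof (intro iffI conjI)
  assume "definable \<M> n X"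
  then obtain \<psi> p where \<psi>: "wf_form \<M> \<psi>" "X = {x \<in> cart_power n. sat \<M> (\<lambda>i. if i < n then x i else p i) \<psi>}"
    unfolding definable_def by blast
  then show "X \<subseteq> cart_power n" by auto
  define f where "f i = (if i < n then 2 * i else 2 * i + 1)" for i
  have "(\<lambda>i. if even (f i) then v (f i div 2) else p (f i div 2)) = (\<lambda>i. if i < n then restrict v {..<n} i else p i)" for v
    by (auto simp: f_def)
  then have "restrict v {..<n} \<in> X \<longleftrightarrow> sat \<M> (\<lambda>i. if even (f i) then v (f i div 2) else p (f i div 2)) \<psi>" for v
    using \<psi>(2) by auto
  then show "dpow \<M> n (\<lambda>x. x \<in> X)" unfolding dpow_def by (rule dpred_renameI[OF \<psi>(1)])
next
  assume "X \<subseteq> cart_power n \<and> dpow \<M> n (\<lambda>x. x \<in> X)"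
  then have X: "X \<subseteq> cart_power n" and "dpow \<M> n (\<lambda>x. x \<in> X)" by auto
  from this(2) obtain \<psi> p where \<psi>: "wf_form \<M> \<psi>"
    "\<forall>v. restrict v {..<n} \<in> X \<longleftrightarrow> sat \<M> (\<lambda>i. if even i then v (i div 2) else p (i div 2)) \<psi>"
    unfolding dpow_def by (rule dpredE)
  \<comment> \<open>All free variables from \<open>n\<close> on are sent to \<open>n\<close>, whose
    parameter is \<open>undefined\<close>, the value of an extensional point there; the old
    parameters are moved behind it.\<close>
  define f where "f i = (if even i then (if i div 2 < n then i div 2 else n) else n + 1 + i div 2)" for i
  define q where "q i = (if i = n then undefined else p (i - (n + 1)))" for i
  obtain \<psi>' where \<psi>': "wf_form \<M> \<psi> \<longrightarrow> wf_form \<M> \<psi>'" "\<And>v. sat \<M> v \<psi>' \<longleftrightarrow> sat \<M> (\<lambda>i. v (f i)) \<psi>"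
    using rename_form[of \<M> \<psi>] by blast
  have "x \<in> X \<longleftrightarrow> sat \<M> (\<lambda>i. if i < n then x i else q i) \<psi>'" if x: "x \<in> cart_power n" for x
  proof -
    have "(\<lambda>i. if f i < n then x (f i) else q (f i)) = (\<lambda>i. if even i then x (i div 2) else p (i div 2))"
      using x by (auto simp: f_def q_def fun_eq_iff PiE_def extensional_def)
    then show ?thesis using \<psi>(2)[rule_format, of x] \<psi>'(2) cart_power_restrict[OF x] by simp
  qed
  then show "definable \<M> n X" unfolding definable_def using \<psi>(1) \<psi>'(1) X
    by (intro exI[of _ \<psi>'] exI[of _ q]) auto
qed

section \<open>Local o-minimality in one variable\<close>

text \<open>The flag \<open>s\<close> is a direction, rightwards if true and leftwards if false, so
  that one proof covers both sides.\<close>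

definition sless :: "bool \<Rightarrow> 'a::ord \<Rightarrow> 'a \<Rightarrow> bool" where
  "sless s x y \<longleftrightarrow> (if s then x < y else y < x)"

text \<open>A germ at \<open>a\<close> on the side \<open>s\<close>. The point \<open>a\<close>
  itself does not count, so every single point is negligible.\<close>

definition onesided :: "bool \<Rightarrow> 'a::ord \<Rightarrow> ('a \<Rightarrow> bool) \<Rightarrow> bool" where
  "onesided s a P \<longleftrightarrow> (\<exists>e. sless s a e \<and> (\<forall>x. sless s a x \<and> sless s x e \<longrightarrow> P x))"

definition has_interval :: "('a::ord \<Rightarrow> bool) \<Rightarrow> bool" where
  "has_interval P \<longleftrightarrow> (\<exists>l u. l < u \<and> (\<forall>x. l < x \<and> x < u \<longrightarrow> P x))"

lemma dpred_sless:
  "dterm \<M> t \<Longrightarrow> dterm \<M> u \<Longrightarrow> dpred \<M> (\<lambda>v. sless s (t v) (u v))"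
  unfolding sless_def by (cases s) (simp_all add: dpred_less)

lemma onesided_mono: "onesided s a P \<Longrightarrow> (\<And>x. P x \<Longrightarrow> Q x) \<Longrightarrow> onesided s a Q"
  unfolding onesided_def by blast

lemma sless_cases:
  fixes x y :: "'a::linorder"
  obtains "sless s x y" | "x = y" | "sless s y x"
  unfolding sless_def by (metis neqE)

lemma sless_trans:
  fixes x y z :: "'a::linorder"
  shows "sless s x y \<Longrightarrow> sless s y z \<Longrightarrow> sless s x z"
  unfolding sless_def by (auto split: if_splits)

lemma sless_irrefl [simp]: "\<not> sless s x (x::'a::linorder)"
  unfolding sless_def by auto

lemma sless_dense:
  fixes x y :: "'a::unbounded_dense_linorder"
  shows "sless s x y \<Longrightarrow> \<exists>z. sless s x z \<and> sless s z y"
  unfolding sless_def using dense by (auto split: if_splits)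

lemma sless_unbounded: "\<exists>y::'a::unbounded_dense_linorder. sless s x y"
  unfolding sless_def using gt_ex lt_ex by auto

lemma sless_not: "sless (\<not> s) x y \<longleftrightarrow> sless s y x"
  unfolding sless_def by auto

lemma onesided_conj:
  fixes a :: "'a::linorder"
  assumes "onesided s a P" "onesided s a Q" shows "onesided s a (\<lambda>x. P x \<and> Q x)"
proof -
  obtain d e where d: "sless s a d" "\<And>x. sless s a x \<Longrightarrow> sless s x d \<Longrightarrow> P x"
    and e: "sless s a e" "\<And>x. sless s a x \<Longrightarrow> sless s x e \<Longrightarrow> Q x"
    using assms unfolding onesided_def by blast
  show ?thesis
  proof (cases "sless s d e")
    case True
    then show ?thesis unfolding onesided_def using d e sless_trans by (intro exI[of _ d]) blast
  next
    case False
    then have "d = e \<or> sless s e d" using sless_cases by blast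
    then show ?thesis unfolding onesided_def using d e sless_trans by (intro exI[of _ e]) blast
  qed
qed

lemma onesided_toward: "sless s a b \<Longrightarrow> onesided s a (\<lambda>x. sless s a x \<and> sless s x b)"
  unfolding onesided_def by blast

lemma onesided_triv:
  fixes a :: "'a::unbounded_dense_linorder"
  shows "(\<And>x. sless s a x \<Longrightarrow> P x) \<Longrightarrow> onesided s a P"
  unfolding onesided_def using sless_unbounded[of s a] by blast

lemma onesided_ex:
  fixes a :: "'a::unbounded_dense_linorder"
  assumes "onesided s a P" shows "\<exists>x. sless s a x \<and> P x"
  using assms sless_dense unfolding onesided_def by blast

lemma onesided_has_interval:
  fixes a :: "'a::unbounded_dense_linorder"
  assumes "onesided s a P" shows "has_interval P"
proof -
  obtain e where e: "sless s a e" "\<And>x. sless s a x \<Longrightarrow> sless s x e \<Longrightarrow> P x"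
    using assms unfolding onesided_def by blast
  then have "a < e \<and> (\<forall>x. a < x \<and> x < e \<longrightarrow> P x) \<or> e < a \<and> (\<forall>x. e < x \<and> x < a \<longrightarrow> P x)"
    by (cases s) (auto simp: sless_def)
  then show ?thesis unfolding has_interval_def by blast
qed

lemma onesided_between:
  fixes a :: "'a::unbounded_dense_linorder"
  assumes "l < a" "a < u" shows "onesided s a (\<lambda>x. l < x \<and> x < u)"
proof -
  have "sless s a (if s then u else l)" using assms by (simp add: sless_def)
  from onesided_toward[OF this] show ?thesis
    by (rule onesided_mono) (use assms in \<open>auto simp: sless_def split: if_splits\<close>)
qed

lemma has_interval_mono: "has_interval P \<Longrightarrow> (\<And>x. P x \<Longrightarrow> Q x) \<Longrightarrow> has_interval Q"
  unfolding has_interval_def by blast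

lemma has_interval_ex:
  fixes P :: "'a::unbounded_dense_linorder \<Rightarrow> bool"
  assumes "has_interval P" shows "\<exists>x. P x"
  using assms dense unfolding has_interval_def by blast

lemma onesided_interval:
  fixes a :: "'a::unbounded_dense_linorder"
  shows "onesided s a (\<lambda>x. c < x \<and> x < d) \<or> onesided s a (\<lambda>x. \<not> (c < x \<and> x < d))"
proof (cases "c < a \<and> a < d")
  case True
  then show ?thesis using onesided_between by blast
next
  case outside: False
  show ?thesis
  \<comment> \<open>\<open>if s then c else d\<close> is the end of the interval that is met first
    when moving in direction \<open>s\<close>; the exchanged expression is the end met last.\<close>
  proof (cases "sless s a (if s then c else d)")
    case True
    from onesided_toward[OF True] show ?thesis
      by (intro disjI2) (erule onesided_mono, auto simp: sless_def split: if_splits)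
  next
    case nearer: False
    show ?thesis
    proof (cases "sless s a (if s then d else c)")
      case True
      from onesided_toward[OF True] show ?thesis
        by (intro disjI1) (erule onesided_mono, use nearer in \<open>auto simp: sless_def split: if_splits\<close>)
    next
      case False
      then have "onesided s a (\<lambda>x. \<not> (c < x \<and> x < d))"
        by (intro onesided_triv) (auto simp: sless_def split: if_splits)
      then show ?thesis ..
    qed
  qed
qed

lemma onesided_point:
  fixes a :: "'a::unbounded_dense_linorder"
  shows "onesided s a (\<lambda>x. x \<noteq> c)"
proof (cases "sless s a c")
  case True
  from onesided_toward[OF True] show ?thesis by (rule onesided_mono) auto
next
  case False
  then show ?thesis by (intro onesided_triv) auto
qed

lemma onesided_Union:
  fixes a :: "'a::unbounded_dense_linorder"
  assumes "finite F" "\<forall>J\<in>F. (\<exists>c. J = {c}) \<or> (\<exists>c d. J = {c<..<d})"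
  shows "onesided s a (\<lambda>x. x \<in> \<Union>F) \<or> onesided s a (\<lambda>x. x \<notin> \<Union>F)"
  using assms
proof (induction F)
  case empty
  then show ?case using onesided_triv[of s a "\<lambda>x. True"] by simp
next
  case (insert J F)
  have J: "onesided s a (\<lambda>x. x \<in> J) \<or> onesided s a (\<lambda>x. x \<notin> J)"
  proof -
    consider c where "J = {c}" | c d where "J = {c<..<d}" using insert.prems by auto
    then show ?thesis
    proof cases
      case 1
      then show ?thesis using onesided_point[of s a] by auto
    next
      case (2 c d)
      then show ?thesis using onesided_interval[of s a c d] by simp
    qed
  qed
  consider "onesided s a (\<lambda>x. x \<in> J)" | "onesided s a (\<lambda>x. x \<in> \<Union>F)"
    | "onesided s a (\<lambda>x. x \<notin> J)" "onesided s a (\<lambda>x. x \<notin> \<Union>F)"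
    using J insert by auto
  then show ?case
  proof cases
    case 3
    then have "onesided s a (\<lambda>x. x \<notin> J \<and> x \<notin> \<Union>F)" by (rule onesided_conj)
    then show ?thesis by simp
  qed (auto elim: onesided_mono)
qed

section \<open>What the three hypotheses on the structure provide\<close>

locale tame =
  fixes \<M> :: "('a::{unbounded_dense_linorder, linorder_topology}, 'f, 'r) ostruct"
  assumes definably_complete: "definably_complete \<M>"
    and locally_o_minimal: "locally_o_minimal \<M>"
    and property_a: "property_a \<M>"
begin

lemma definable_subsetI:
  assumes "dpred \<M> (\<lambda>v. S (v 0))" shows "definable_subset \<M> {x. S x}"
  unfolding definable_subset_def definable_iff_dpow dpow_def using assms by auto

text \<open>The form in which local o-minimality is used: near \<open>a\<close> the set is a finite
  union of points and intervals, and each of these is decided on a one-sided neighbourhood of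
  \<open>a\<close>.\<close>

lemma germ:
  assumes "dpred \<M> (\<lambda>v. S (v 0))"
  shows "onesided s a S \<or> onesided s a (\<lambda>x. \<not> S x)"
proof -
  obtain l u F where "a \<in> {l<..<u}"
    and F: "finite F" "\<forall>J\<in>F. (\<exists>c. J = {c}) \<or> (\<exists>c d. J = {c<..<d})" "{x. S x} \<inter> {l<..<u} = \<Union>F"
    using locally_o_minimal[unfolded locally_o_minimal_def, rule_format, OF definable_subsetI[OF assms], of a]
    by (elim exE conjE)
  then have lu: "l < a" "a < u" by auto
  have S: "S x \<longleftrightarrow> x \<in> \<Union>F" if "l < x" "x < u" for x
    unfolding F(3)[symmetric] using that by simp
  have near: "onesided s a (\<lambda>x. l < x \<and> x < u)" using lu by (rule onesided_between)
  show ?thesis using onesided_Union[OF F(1,2), of s a]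
  proof
    assume "onesided s a (\<lambda>x. x \<in> \<Union>F)"
    from onesided_conj[OF this near] show ?thesis
      by (intro disjI1) (erule onesided_mono, use S in blast)
  next
    assume "onesided s a (\<lambda>x. x \<notin> \<Union>F)"
    from onesided_conj[OF this near] show ?thesis
      by (intro disjI2) (erule onesided_mono, use S in blast)
  qed
qed

lemma no_interval_germ:
  assumes "dpred \<M> (\<lambda>v. S (v 0))" "\<not> has_interval S"
  shows "onesided s a (\<lambda>x. \<not> S x)"
  using germ[OF assms(1)] onesided_has_interval assms(2) by blast

text \<open>One germ inside the interval decides: if it lies outside \<open>P\<close>, it lies in
  \<open>Q\<close>.\<close>

lemma has_interval_disj:
  assumes "dpred \<M> (\<lambda>v. P (v 0))" "has_interval (\<lambda>x. P x \<or> Q x)"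
  shows "has_interval P \<or> has_interval Q"
proof -
  obtain l u where "l < u" and lu: "\<And>x. l < x \<Longrightarrow> x < u \<Longrightarrow> P x \<or> Q x"
    using assms(2) unfolding has_interval_def by blast
  obtain a where a: "l < a" "a < u" using dense[OF \<open>l < u\<close>] by blast
  have near: "onesided True a (\<lambda>x. l < x \<and> x < u)" using a by (rule onesided_between)
  show ?thesis using germ[OF assms(1), of True a]
  proof
    assume "onesided True a (\<lambda>x. \<not> P x)"
    from onesided_has_interval[OF onesided_conj[OF this near]] show ?thesis
      by (intro disjI2) (erule has_interval_mono, use lu in blast)
  qed (auto dest: onesided_has_interval)
qed

text \<open>The supremum in \<open>M\<close> if \<open>s\<close> is true, the infimum if it is
  false, in a first-order form.\<close>

definition extremum :: "bool \<Rightarrow> ('a \<Rightarrow> bool) \<Rightarrow> 'a \<Rightarrow> bool" where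
  "extremum s S b \<longleftrightarrow> (\<forall>y. S y \<longrightarrow> \<not> sless s b y) \<and> (\<forall>z. sless s z b \<longrightarrow> (\<exists>y. S y \<and> sless s z y))"

text \<open>A member and a bound exclude the two infinite values that definable completeness
  allows.\<close>

lemma extremum_exists:
  assumes "dpred \<M> (\<lambda>v. S (v 0))" "S y0" "\<And>y. S y \<Longrightarrow> \<not> sless s c y"
  shows "\<exists>b. extremum s S b"
proof (cases s)
  case True
  obtain t where t: "isLub UNIV (Fin ` {x. S x}) t"
    using definably_complete definable_subsetI[OF assms(1)] unfolding definably_complete_def by blast
  have ub: "Fin y \<le> t" if "S y" for y
    using t that by (auto simp: isLub_def leastP_def isUb_def setle_def setge_def)
  have least: "t \<le> w" if "\<And>y. S y \<Longrightarrow> Fin y \<le> w" for w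
    using t that by (auto simp: isLub_def leastP_def isUb_def setle_def setge_def)
  have "t \<le> Fin c" using assms(3) True by (intro least) (auto simp: sless_def not_less)
  then obtain b where b: "t = Fin b" using ub[OF assms(2)] by (cases t) auto
  have "\<exists>y. S y \<and> z < y" if "z < b" for z
  proof (rule ccontr)
    assume "\<nexists>y. S y \<and> z < y"
    then have "t \<le> Fin z" by (intro least) (auto simp: not_less)
    with that b show False by simp
  qed
  then show ?thesis using ub b True unfolding extremum_def sless_def by (intro exI[of _ b]) (auto simp: not_less)
next
  case False
  obtain t where t: "isGlb UNIV (Fin ` {x. S x}) t"
    using definably_complete definable_subsetI[OF assms(1)] unfolding definably_complete_def by blast
  have lb: "t \<le> Fin y" if "S y" for y
    using t that by (auto simp: isGlb_def greatestP_def isLb_def setle_def setge_def)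
  have greatest: "w \<le> t" if "\<And>y. S y \<Longrightarrow> w \<le> Fin y" for w
    using t that by (auto simp: isGlb_def greatestP_def isLb_def setle_def setge_def)
  have "Fin c \<le> t" using assms(3) False by (intro greatest) (auto simp: sless_def not_less)
  then obtain b where b: "t = Fin b" using lb[OF assms(2)] by (cases t) auto
  have "\<exists>y. S y \<and> y < z" if "b < z" for z
  proof (rule ccontr)
    assume "\<nexists>y. S y \<and> y < z"
    then have "Fin z \<le> t" by (intro greatest) (auto simp: not_less)
    with that b show False by simp
  qed
  then show ?thesis using lb b False unfolding extremum_def sless_def by (intro exI[of _ b]) (auto simp: not_less)
qed

lemma extremum_unique: "extremum s S a \<Longrightarrow> extremum s S b \<Longrightarrow> a = b"
  unfolding extremum_def using sless_cases[of s a b] by metis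

text \<open>This replaces definable choice: an extremum of a fibre is unique, hence a definable
  function of the base point.\<close>

lemma extremum_function:
  assumes S: "dpred \<M> (\<lambda>v. S (v 0) (v 1))" and P: "dpred \<M> (\<lambda>v. P (v 0))"
    and ex: "\<And>x. P x \<Longrightarrow> \<exists>y. S x y" and bd: "\<And>x. P x \<Longrightarrow> \<exists>c. \<forall>y. S x y \<longrightarrow> \<not> sless s c y"
  shows "\<exists>f. dfun \<M> f \<and> (\<forall>x. P x \<longrightarrow> extremum s (S x) (f x))"
proof -
  \<comment> \<open>Off \<open>P\<close> the value is a constant, which keeps the graph of the total
    function definable.\<close>
  define f where "f x = (if P x then SOME b. extremum s (S x) b else undefined)" for x
  have S1: "dpred \<M> (\<lambda>v. S (t v) (u v))" if "dterm \<M> t" "dterm \<M> u" for t u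
    using S that by (rule dpred_rel2)
  have f: "extremum s (S x) (f x)" if "P x" for x
  proof -
    have "\<exists>b. extremum s (S x) b"
      using ex[OF that] bd[OF that] extremum_exists[OF S1[OF dterm_const dterm_var]] by blast
    then show ?thesis using that unfolding f_def by (simp add: someI_ex)
  qed
  have eq: "(\<lambda>v. v 1 = f (v 0)) = (\<lambda>v. (P (v 0) \<and> extremum s (S (v 0)) (v 1)) \<or> (\<not> P (v 0) \<and> v 1 = undefined))"
  proof
    fix v
    show "v 1 = f (v 0) \<longleftrightarrow> (P (v 0) \<and> extremum s (S (v 0)) (v 1)) \<or> (\<not> P (v 0) \<and> v 1 = undefined)"
    proof (cases "P (v 0)")
      case True
      then show ?thesis using f[OF True] extremum_unique by metis
    qed (simp add: f_def)
  qed
  have "dpred \<M> (\<lambda>v. (P (v 0) \<and> extremum s (S (v 0)) (v 1)) \<or> (\<not> P (v 0) \<and> v 1 = undefined))"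
    unfolding extremum_def by (intro dpred_intros P S1 dpred_sless)
  then have "dfun \<M> f" unfolding dfun_def eq .
  with f show ?thesis by blast
qed

text \<open>The form in which property (a) is used: points isolated by boxes make the set discrete,
  hence also its projection to coordinate \<open>j\<close>, whereas no point of an interval is
  isolated.\<close>

lemma isolated_no_interval:
  assumes X: "definable \<M> N X" and j: "j < N"
    and iso: "\<And>x. x \<in> X \<Longrightarrow> \<exists>l u. (\<forall>i<N. l i < x i \<and> x i < u i) \<and>
        (\<forall>y\<in>X. (\<forall>i<N. l i < y i \<and> y i < u i) \<longrightarrow> y = x)"
  shows "\<not> has_interval (\<lambda>t. \<exists>x\<in>X. x j = t)"
proof
  assume fat: "has_interval (\<lambda>t. \<exists>x\<in>X. x j = t)"
  have XN: "X \<subseteq> cart_power N" using X unfolding definable_iff_dpow by blast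
  obtain z where "z \<in> X" using has_interval_ex[OF fat] by blast
  have "discrete_topology X = subtopology (power_top N) X"
    unfolding discrete_topology_unique
  proof (intro conjI ballI)
    show "topspace (subtopology (power_top N) X) = X" using XN by auto
    fix x assume x: "x \<in> X"
    then obtain l u where lu: "\<forall>i<N. l i < x i \<and> x i < u i"
      "\<forall>y\<in>X. (\<forall>i<N. l i < y i \<and> y i < u i) \<longrightarrow> y = x" using iso by blast
    define B where "B = PiE {..<N} (\<lambda>i. {l i<..<u i})"
    have B: "openin (power_top N) B" unfolding B_def by (rule openin_PiE_gen[THEN iffD2]) auto
    have mem: "y \<in> B \<longleftrightarrow> (\<forall>i<N. l i < y i \<and> y i < u i)" if "y \<in> X" for y
      using that XN by (auto simp: B_def PiE_iff)
    have "{x} = B \<inter> X"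
    proof (intro equalityI subsetI)
      fix y assume "y \<in> B \<inter> X"
      then have "y \<in> X" "\<forall>i<N. l i < y i \<and> y i < u i" using mem by auto
      with lu(2) show "y \<in> {x}" by simp
    qed (use x mem[OF x] lu(1) in simp)
    with B show "openin (subtopology (power_top N) X) {x}"
      unfolding openin_subtopology by (intro exI[of _ B] conjI)
  qed
  then have disc: "discrete_set N X" unfolding discrete_set_def by simp
  define \<pi> where "\<pi> = (\<lambda>x::nat \<Rightarrow> 'a. \<lambda>k\<in>{..<1::nat}. x j)"
  have "\<pi> \<in> coord_projections N 1"
    unfolding coord_projections_def \<pi>_def using j
    by (intro CollectI exI[of _ "\<lambda>_. j"]) (auto simp: strict_mono_on_def)
  then have "discrete_set 1 (\<pi> ` X)"
    using property_a X disc \<open>z \<in> X\<close> unfolding property_a_def by blast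
  then have eq: "discrete_topology (\<pi> ` X) = subtopology (power_top 1) (\<pi> ` X)"
    unfolding discrete_set_def by simp
  obtain l u where "l < u" and lu: "\<And>t. l < t \<Longrightarrow> t < u \<Longrightarrow> \<exists>x\<in>X. x j = t"
    using fat unfolding has_interval_def by blast
  obtain t where t: "l < t" "t < u" using dense[OF \<open>l < u\<close>] by blast
  have mem: "(\<lambda>k\<in>{..<1}. r) \<in> \<pi> ` X" if "l < r" "r < u" for r
    using lu[OF that] unfolding \<pi>_def by auto
  have "openin (subtopology (power_top 1) (\<pi> ` X)) {\<lambda>k\<in>{..<1}. t}"
    unfolding eq[symmetric] using mem[OF t] by simp
  then obtain T where T: "openin (power_top 1) T" "{\<lambda>k\<in>{..<1}. t} = T \<inter> \<pi> ` X"
    unfolding openin_subtopology by blast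
  then have "(\<lambda>k\<in>{..<1}. t) \<in> T" by blast
  from bspec[OF T(1)[unfolded openin_product_topology_alt] this] obtain U where U: "\<forall>i\<in>{..<1::nat}. openin euclidean (U i)" "(\<lambda>k\<in>{..<1}. t) \<in> PiE {..<1} U" "PiE {..<1} U \<subseteq> T"
    by (elim exE conjE)
  have "open (U 0)" "t \<in> U 0" using U by auto
  \<comment> \<open>A right half-neighbourhood of \<open>t\<close> already yields a second point
    \<open>r\<close> of the image in the open set.\<close>
  then obtain b where b: "t < b" "{t..<b} \<subseteq> U 0" using open_right[of "U 0" t u] t by blast
  obtain r where r: "t < r" "r < min b u" using dense[of t "min b u"] b t by auto
  have "(\<lambda>k\<in>{..<1}. r) \<in> PiE {..<1} U" using b r by (auto simp: PiE_iff)
  then have "(\<lambda>k\<in>{..<1}. r) \<in> T" using U(3) by blast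
  moreover have "(\<lambda>k\<in>{..<1}. r) \<in> \<pi> ` X" using mem[of r] t r by auto
  ultimately have "(\<lambda>k\<in>{..<1::nat}. r) = (\<lambda>k\<in>{..<1}. t)" using T(2) by blast
  then have "r = t" by (metis lessThan_iff less_one restrict_apply')
  with r show False by simp
qed

section \<open>Definable functions of one variable\<close>

definition side_cont :: "bool \<Rightarrow> ('a \<Rightarrow> 'a) \<Rightarrow> 'a \<Rightarrow> bool" where
  "side_cont s f x \<longleftrightarrow> (\<forall>y1 y2. y1 < f x \<and> f x < y2 \<longrightarrow> onesided s x (\<lambda>z. y1 < f z \<and> f z < y2))"

lemma dpred_side_cont: "dfun \<M> f \<Longrightarrow> dpred \<M> (\<lambda>v. side_cont s f (v 0))"
  unfolding side_cont_def onesided_def by (intro dpred_intros dpred_sless dterm_app[of _ f])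

lemma side_cont_sless:
  assumes "side_cont s f x" "sless t e (f x)"
  shows "onesided s x (\<lambda>z. sless t e (f z))"
proof (cases t)
  case True
  obtain y where "f x < y" using gt_ex by blast
  then have "onesided s x (\<lambda>z. e < f z \<and> f z < y)"
    using assms True by (simp add: side_cont_def sless_def)
  then show ?thesis by (rule onesided_mono) (use True in \<open>simp add: sless_def\<close>)
next
  case False
  obtain y where "y < f x" using lt_ex by blast
  then have "onesided s x (\<lambda>z. y < f z \<and> f z < e)"
    using assms False by (simp add: side_cont_def sless_def)
  then show ?thesis by (rule onesided_mono) (use False in \<open>simp add: sless_def\<close>)
qed

lemma definable2I:
  assumes "dpred \<M> (\<lambda>v. R (v 0) (v 1))"
  shows "definable \<M> 2 {x \<in> cart_power 2. R (x 0) (x 1)}"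
proof -
  have "(\<lambda>v. restrict v {..<2} \<in> {x \<in> cart_power 2. R (x 0) (x 1)}) = (\<lambda>v::nat \<Rightarrow> 'a. R (v 0) (v 1))"
    by (auto simp: fun_eq_iff)
  then show ?thesis using assms unfolding definable_iff_dpow dpow_def by auto
qed

text \<open>Otherwise the graph of \<open>f\<close> over some interval would be discrete, against property (a).\<close>

lemma side_continuous:
  assumes f: "dfun \<M> f" and P: "has_interval P"
  shows "\<exists>s. has_interval (\<lambda>x. P x \<and> side_cont s f x)"
proof (rule ccontr)
  assume none: "\<nexists>s. has_interval (\<lambda>x. P x \<and> side_cont s f x)"
  obtain l u where "l < u" and lu: "\<And>x. l < x \<Longrightarrow> x < u \<Longrightarrow> P x"
    using P unfolding has_interval_def by blast
  define C where "C s x \<longleftrightarrow> (l < x \<and> x < u) \<and> side_cont s f x" for s x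
  define N where "N x \<longleftrightarrow> (l < x \<and> x < u) \<and> \<not> side_cont True f x \<and> \<not> side_cont False f x" for x
  have dC: "dpred \<M> (\<lambda>v. C s (v 0))" for s
    unfolding C_def by (intro dpred_intros dpred_side_cont f)
  have dN: "dpred \<M> (\<lambda>v. N (v 0))"
    unfolding N_def by (intro dpred_intros dpred_side_cont f)
  have noC: "\<not> has_interval (C s)" for s
    using none has_interval_mono[of "C s" "\<lambda>x. P x \<and> side_cont s f x"] lu unfolding C_def by blast
  \<comment> \<open>The interval is covered by \<open>C True\<close>, \<open>C False\<close> and
    \<open>N\<close>; as the first two contain no interval, \<open>N\<close> does.\<close>
  have "has_interval (\<lambda>x. C True x \<or> C False x \<or> N x)"
    unfolding has_interval_def C_def N_def using \<open>l < u\<close> by blast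
  from has_interval_disj[OF dC this] noC have "has_interval (\<lambda>x. C False x \<or> N x)" by blast
  from has_interval_disj[OF dC this] noC have N: "has_interval N" by blast
  let ?X = "{x \<in> cart_power 2. N (x 0) \<and> x 1 = f (x 0)}"
  have "dpred \<M> (\<lambda>v. N (v 0) \<and> v 1 = f (v 0))"
    using dN by (intro dpred_intros dterm_app[OF f])
  then have X: "definable \<M> 2 ?X" by (rule definable2I[where R = "\<lambda>a b. N a \<and> b = f a"])
  \<comment> \<open>By the dichotomy for germs, discontinuity on one side means more than leaving a
    horizontal strip at points arbitrarily near: on that side the graph avoids the strip
    altogether.\<close>
  have away: "\<exists>y1 y2. y1 < f x \<and> f x < y2 \<and> onesided s x (\<lambda>z. \<not> (y1 < f z \<and> f z < y2))" if "N x" for x s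
  proof -
    have "\<not> side_cont s f x" using that unfolding N_def by (cases s) auto
    then obtain y1 y2 where y: "y1 < f x" "f x < y2" "\<not> onesided s x (\<lambda>z. y1 < f z \<and> f z < y2)"
      unfolding side_cont_def by blast
    have "dpred \<M> (\<lambda>v. y1 < f (v 0) \<and> f (v 0) < y2)"
      by (intro dpred_intros dterm_app[OF f])
    from germ[OF this, of s x] y show ?thesis by blast
  qed
  have nX: "\<not> has_interval (\<lambda>t. \<exists>x\<in>?X. x 0 = t)"
  proof (rule isolated_no_interval[OF X])
    fix x assume x: "x \<in> ?X"
    then have N: "N (x 0)" and x1: "x 1 = f (x 0)" by auto
    obtain y1 y2 where y: "y1 < f (x 0)" "f (x 0) < y2" "onesided True (x 0) (\<lambda>z. \<not> (y1 < f z \<and> f z < y2))"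
      using away[OF N] by blast
    obtain w1 w2 where w: "w1 < f (x 0)" "f (x 0) < w2" "onesided False (x 0) (\<lambda>z. \<not> (w1 < f z \<and> f z < w2))"
      using away[OF N] by blast
    obtain e where e: "x 0 < e" "\<And>z. x 0 < z \<Longrightarrow> z < e \<Longrightarrow> \<not> (y1 < f z \<and> f z < y2)"
      using y(3) unfolding onesided_def sless_def by auto
    obtain d where d: "d < x 0" "\<And>z. z < x 0 \<Longrightarrow> d < z \<Longrightarrow> \<not> (w1 < f z \<and> f z < w2)"
      using w(3) unfolding onesided_def sless_def by auto
    \<comment> \<open>The box that isolates \<open>x\<close> in the graph: horizontally it joins the
      two one-sided neighbourhoods, vertically it is the intersection of the two strips.\<close>
    define L where "L i = (if i = 0 then d else max y1 w1)" for i :: nat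
    define U where "U i = (if i = 0 then e else min y2 w2)" for i :: nat
    have "\<forall>i<2. L i < x i \<and> x i < U i"
      using d(1) e(1) y(1,2) w(1,2) x1 by (auto simp: L_def U_def less_2_cases_iff)
    moreover have "z = x" if z: "z \<in> ?X" and b: "\<forall>i<2. L i < z i \<and> z i < U i" for z
    proof -
      have z1: "z 1 = f (z 0)" using z by auto
      have "d < z 0 \<and> z 0 < e" using b[rule_format, of 0] by (simp add: L_def U_def)
      moreover have "max y1 w1 < z 1 \<and> z 1 < min y2 w2" using b[rule_format, of 1] by (simp add: L_def U_def)
      ultimately have z0: "z 0 = x 0" using e(2)[of "z 0"] d(2)[of "z 0"] z1 by (cases "z 0" "x 0" rule: linorder_cases) auto
      have "z \<in> cart_power 2" "x \<in> cart_power 2" using z x by simp_all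
      then show ?thesis
      proof (rule PiE_ext)
        fix i assume "i \<in> {..<2::nat}"
        then have "i = 0 \<or> i = 1" by auto
        then show "z i = x i" using z0 z1 x1 by metis
      qed
    qed
    ultimately show "\<exists>l u. (\<forall>i<2. l i < x i \<and> x i < u i) \<and> (\<forall>y\<in>?X. (\<forall>i<2. l i < y i \<and> y i < u i) \<longrightarrow> y = x)"
      by (intro exI[of _ L] exI[of _ U]) simp
  qed simp
  have img: "\<exists>x\<in>?X. x 0 = t" if "N t" for t
    using that by (intro bexI[of _ "\<lambda>i\<in>{..<2}. if i = 0 then t else f t"]) auto
  from has_interval_mono[OF N img] nX show False by contradiction
qed

section \<open>Uniformity over a one-dimensional base\<close>

lemma onesided_sless:
  fixes x :: 'a
  assumes "sless s x e" shows "onesided t x (\<lambda>z. sless s z e)"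
proof (cases s)
  case True
  obtain y where "y < x" using lt_ex by blast
  with True assms have "onesided t x (\<lambda>z. y < z \<and> z < e)" by (intro onesided_between) (auto simp: sless_def)
  then show ?thesis by (rule onesided_mono) (use True in \<open>simp add: sless_def\<close>)
next
  case False
  obtain y where "x < y" using gt_ex by blast
  with False assms have "onesided t x (\<lambda>z. e < z \<and> z < y)" by (intro onesided_between) (auto simp: sless_def)
  then show ?thesis by (rule onesided_mono) (use False in \<open>simp add: sless_def\<close>)
qed

text \<open>Let \<open>f x\<close> be the extremum in direction \<open>s\<close> of the admissible
  steps. By one-sided continuity at some \<open>x0\<close>, a value \<open>e1\<close> between
  \<open>x0\<close> and \<open>f x0\<close> stays before \<open>f x\<close> for \<open>x\<close> on
  one side of \<open>x0\<close>, and \<open>down\<close> makes \<open>e1\<close> admissible for all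
  these \<open>x\<close>.\<close>

lemma uniform_step:
  assumes T: "dpred \<M> (\<lambda>v. T (v 0) (v 1))" and P: "has_interval P"
    and ex: "\<And>x. P x \<Longrightarrow> \<exists>e. sless s x e \<and> T x e"
    and down: "\<And>x d e. T x e \<Longrightarrow> sless s x d \<Longrightarrow> sless s d e \<Longrightarrow> T x d"
  shows "\<exists>e. has_interval (\<lambda>x. P x \<and> sless s x e \<and> T x e)"
proof -
  obtain l u where "l < u" and lu: "\<And>x. l < x \<Longrightarrow> x < u \<Longrightarrow> P x"
    using P unfolding has_interval_def by blast
  \<comment> \<open>The far end of the interval in direction \<open>s\<close>; cutting the steps off
    there bounds them, so that their extremum exists.\<close>
  define c where "c = (if s then u else l)"
  define J where "J x \<longleftrightarrow> l < x \<and> x < u" for x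
  define S where "S x e \<longleftrightarrow> T x e \<and> sless s x e \<and> sless s e c" for x e
  have Jc: "sless s x c" if "J x" for x using that by (auto simp: J_def c_def sless_def)
  have Sex: "\<exists>e. S x e" if J: "J x" for x
  proof -
    obtain e where e: "sless s x e" "T x e" using ex lu J unfolding J_def by blast
    obtain d where d: "sless s x d" "sless s d c" using sless_dense[OF Jc[OF J]] by blast
    show ?thesis
    proof (cases "sless s d e")
      case True
      then show ?thesis using down[OF e(2) d(1)] d by (auto simp: S_def)
    next
      case False
      then have "sless s e c" using d sless_cases[of s d e] sless_trans by metis
      then show ?thesis using e by (auto simp: S_def)
    qed
  qed
  have dS: "dpred \<M> (\<lambda>v. S (v 0) (v 1))"
    unfolding S_def by (intro dpred_intros dpred_sless T)
  have dJ: "dpred \<M> (\<lambda>v. J (v 0))" unfolding J_def by (intro dpred_intros)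
  have "\<exists>c. \<forall>e. S x e \<longrightarrow> \<not> sless s c e" for x
    using sless_trans[of s _ c] sless_irrefl unfolding S_def by blast
  then obtain f where f: "dfun \<M> f" and fext: "\<And>x. J x \<Longrightarrow> extremum s (S x) (f x)"
    using extremum_function[OF dS dJ Sex] by blast
  have "has_interval J" unfolding has_interval_def J_def using \<open>l < u\<close> by blast
  then obtain s' where "has_interval (\<lambda>x. J x \<and> side_cont s' f x)" using side_continuous[OF f] by blast
  then obtain l' u' where "l' < u'" and l'u': "\<And>x. l' < x \<Longrightarrow> x < u' \<Longrightarrow> J x \<and> side_cont s' f x"
    unfolding has_interval_def by blast
  obtain x0 where x0: "l' < x0" "x0 < u'" using dense[OF \<open>l' < u'\<close>] by blast
  have J0: "J x0" and sc: "side_cont s' f x0" using l'u' x0 by auto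
  obtain e where e: "S x0 e" using Sex[OF J0] by blast
  have "\<not> sless s (f x0) e" using fext[OF J0] e unfolding extremum_def by blast
  then have "sless s x0 (f x0)" using e sless_cases[of s e "f x0"] sless_trans unfolding S_def by metis
  then obtain e1 where e1: "sless s x0 e1" "sless s e1 (f x0)" using sless_dense by blast
  have "onesided s' x0 (\<lambda>x. (l' < x \<and> x < u') \<and> sless s x e1 \<and> sless s e1 (f x))"
    by (intro onesided_conj onesided_between x0 onesided_sless e1 side_cont_sless[OF sc])
  then have "has_interval (\<lambda>x. P x \<and> sless s x e1 \<and> T x e1)"
  proof (rule has_interval_mono[OF onesided_has_interval])
    fix x assume x: "(l' < x \<and> x < u') \<and> sless s x e1 \<and> sless s e1 (f x)"
    then have J: "J x" using l'u' by blast
    then obtain e where "S x e" "sless s e1 e" using fext[OF J] x unfolding extremum_def by blast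
    then have "T x e1" using down x unfolding S_def by blast
    then show "P x \<and> sless s x e1 \<and> T x e1" using x J lu unfolding J_def by blast
  qed
  then show ?thesis by blast
qed

text \<open>If \<open>f\<close> and \<open>g\<close> are continuous from the same side, this is clear. If \<open>f\<close> is continuous only
  from the side \<open>s\<close> and \<open>g\<close> only from the other one, then a counterexample forces \<open>g\<close> to drop to
  \<open>f\<close> at each point when moving in direction \<open>s\<close>; hence \<open>g\<close> is strictly monotone and its image
  contains no interval, although by continuity it accumulates at each of its points.\<close>

lemma separate_functions:
  assumes f: "dfun \<M> f" and g: "dfun \<M> g" and P: "has_interval (\<lambda>x. P x \<and> f x < g x)"
  shows "\<exists>p q. p < q \<and> has_interval (\<lambda>x. P x \<and> f x < p \<and> q < g x)"
proof (rule ccontr)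
  assume none: "\<not> ?thesis"
  obtain s1 where s1: "has_interval (\<lambda>x. (P x \<and> f x < g x) \<and> side_cont s1 f x)"
    using side_continuous[OF f P] by blast
  obtain s2 where "has_interval (\<lambda>x. ((P x \<and> f x < g x) \<and> side_cont s1 f x) \<and> side_cont s2 g x)"
    using side_continuous[OF g s1] by blast
  then obtain l u where "l < u" and lu: "\<And>x. l < x \<Longrightarrow> x < u \<Longrightarrow> ((P x \<and> f x < g x) \<and> side_cont s1 f x) \<and> side_cont s2 g x"
    unfolding has_interval_def by blast
  \<comment> \<open>Otherwise \<open>g\<close> stays at or above \<open>q\<close> on this side, and
    since \<open>f\<close> is close to \<open>f x\<close> there, the constants \<open>p < q'\<close>
    separate the functions; \<open>q'\<close> turns the weak inequality into a strict one.\<close>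
  have drop: "onesided s1 x (\<lambda>z. g z < q)" if x: "l < x" "x < u" and q: "f x < q" for x q
  proof (rule ccontr)
    assume n: "\<not> onesided s1 x (\<lambda>z. g z < q)"
    have "dpred \<M> (\<lambda>v. g (v 0) < q)" by (intro dpred_intros dterm_app[OF g])
    from germ[OF this, of s1 x] n have ge: "onesided s1 x (\<lambda>z. \<not> g z < q)" by blast
    obtain q' where q': "f x < q'" "q' < q" using dense[OF q] by blast
    obtain p where p: "f x < p" "p < q'" using dense[OF q'(1)] by blast
    have "onesided s1 x (\<lambda>z. f z < p)"
      using side_cont_sless[of s1 f x False p] lu[OF x] p(1) by (simp add: sless_def)
    then have "onesided s1 x (\<lambda>z. \<not> g z < q \<and> f z < p \<and> l < z \<and> z < u)"
      using ge x by (intro onesided_conj onesided_between)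
    then have "has_interval (\<lambda>z. P z \<and> f z < p \<and> q' < g z)"
      by (rule has_interval_mono[OF onesided_has_interval]) (use lu q' in auto)
    with p(2) none show False by blast
  qed
  \<comment> \<open>If both functions were continuous from the same side, \<open>g\<close> would
    remain above \<open>q\<close> by continuity and fall below it by \<open>drop\<close>.\<close>
  have "s2 = (\<not> s1)"
  proof (rule ccontr)
    assume "s2 \<noteq> (\<not> s1)"
    then have [simp]: "s2 = s1" by blast
    obtain x where x: "l < x" "x < u" using dense[OF \<open>l < u\<close>] by blast
    obtain q where q: "f x < q" "q < g x" using dense[of "f x" "g x"] lu[OF x] by blast
    have "onesided s1 x (\<lambda>z. q < g z)"
      using side_cont_sless[of s1 g x True q] lu[OF x] q(2) by (simp add: sless_def)
    from onesided_ex[OF onesided_conj[OF this drop[OF x q(1)]]] show False by auto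
  qed
  \<comment> \<open>\<open>drop\<close> with \<open>q = g x\<close> gives such an \<open>e\<close>
    at each point; an \<open>e\<close> valid on a whole interval makes \<open>g\<close> strictly
    monotone there.\<close>
  define T where "T x e \<longleftrightarrow> (\<forall>z. sless s1 x z \<and> sless s1 z e \<longrightarrow> g z < g x)" for x e
  have "\<exists>e. has_interval (\<lambda>x. (l < x \<and> x < u) \<and> sless s1 x e \<and> T x e)"
  proof (rule uniform_step)
    show "dpred \<M> (\<lambda>v. T (v 0) (v 1))"
      unfolding T_def by (intro dpred_intros dpred_sless dterm_app[OF g])
    show "has_interval (\<lambda>x. l < x \<and> x < u)" unfolding has_interval_def using \<open>l < u\<close> by blast
    show "\<exists>e. sless s1 x e \<and> T x e" if "l < x \<and> x < u" for x
      using drop[of x "g x"] lu[of x] that unfolding T_def onesided_def by blast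
    show "T x d" if "T x e" "sless s1 x d" "sless s1 d e" for x d e
      using that sless_trans unfolding T_def by blast
  qed
  then obtain e l' u' where "l' < u'" and l'u': "\<And>x. l' < x \<Longrightarrow> x < u' \<Longrightarrow> (l < x \<and> x < u) \<and> sless s1 x e \<and> T x e"
    unfolding has_interval_def by blast
  have mono: "g z < g x" if "l' < x" "x < u'" "l' < z" "z < u'" "sless s1 x z" for x z
    using l'u' that unfolding T_def by blast
  define D where "D y \<longleftrightarrow> (\<exists>x. (l' < x \<and> x < u') \<and> y = g x)" for y
  have dD: "dpred \<M> (\<lambda>v. D (v 0))" unfolding D_def by (intro dpred_intros dterm_app[OF g])
  \<comment> \<open>By monotonicity a value \<open>w\<close> just below \<open>g x\<close> is taken
    only at a \<open>z\<close> beyond \<open>x\<close> in direction \<open>s1\<close>. But between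
    \<open>x\<close> and \<open>z\<close> the function has already dropped below \<open>q\<close>,
    and it cannot climb back to \<open>w\<close>.\<close>
  have gap: "\<exists>q. q < y \<and> (\<forall>w. q < w \<and> w < y \<longrightarrow> \<not> D w)" if Dy: "D y" for y
  proof -
    obtain x where x: "l' < x" "x < u'" "y = g x" using Dy unfolding D_def by blast
    obtain q where q: "f x < q" "q < g x" using dense[of "f x" "g x"] lu l'u' x by blast
    have "\<not> D w" if w: "q < w" "w < y" for w
    proof
      assume "D w"
      then obtain z where z: "l' < z" "z < u'" "w = g z" unfolding D_def by blast
      have "sless s1 x z" using sless_cases[of s1 x z] mono[of z x] z x w by force
      have lx: "l < x" "x < u" using l'u' x by blast+
      have "onesided s1 x (\<lambda>z'. g z' < q \<and> sless s1 x z' \<and> sless s1 z' z)"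
        using drop[OF lx q(1)] onesided_toward[OF \<open>sless s1 x z\<close>] by (rule onesided_conj)
      then obtain z' where z': "g z' < q" "sless s1 x z'" "sless s1 z' z" using onesided_ex by blast
      then have "l' < z'" "z' < u'" using x z by (auto simp: sless_def split: if_splits)
      then have "g z < g z'" using mono z z' by blast
      then show False using z' w z by auto
    qed
    with q x show ?thesis by blast
  qed
  obtain x0 where x0: "l' < x0" "x0 < u'" using dense[OF \<open>l' < u'\<close>] by blast
  have lx0: "l < x0" "x0 < u" using l'u' x0 by blast+
  \<comment> \<open>Just above \<open>g x0\<close> the image either contains an interval, against
    \<open>gap\<close>, or is empty, against continuity of \<open>g\<close> from the side
    \<open>s2\<close>, on which its values are larger than \<open>g x0\<close>.\<close>
  show False using germ[OF dD, of True "g x0"]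
  proof
    assume "onesided True (g x0) D"
    from onesided_has_interval[OF this] obtain a b where "a < b" and ab: "\<And>y. a < y \<Longrightarrow> y < b \<Longrightarrow> D y"
      unfolding has_interval_def by blast
    obtain y where y: "a < y" "y < b" using dense[OF \<open>a < b\<close>] by blast
    obtain q where q: "q < y" "\<forall>w. q < w \<and> w < y \<longrightarrow> \<not> D w" using gap ab y by blast
    obtain w where w: "max a q < w" "w < y" using dense[of "max a q" y] y q by auto
    then have "a < w" "q < w" "w < b" using y by auto
    then show False using ab q(2) w(2) by blast
  next
    assume "onesided True (g x0) (\<lambda>y. \<not> D y)"
    then obtain e where e: "g x0 < e" "\<And>y. g x0 < y \<Longrightarrow> y < e \<Longrightarrow> \<not> D y"
      unfolding onesided_def sless_def by auto
    have "side_cont s2 g x0" using lu[OF lx0] by blast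
    from side_cont_sless[OF this, of False e] e(1) have "onesided s2 x0 (\<lambda>z. g z < e)" by (simp add: sless_def)
    then have "onesided s2 x0 (\<lambda>z. g z < e \<and> l' < z \<and> z < u')"
      using x0 by (intro onesided_conj onesided_between)
    then obtain z where z: "sless s2 x0 z" "g z < e" "l' < z" "z < u'" using onesided_ex by blast
    have "g x0 < g z" using mono[OF z(3,4) x0] z(1) \<open>s2 = (\<not> s1)\<close> sless_not by blast
    then show False using e(2)[of "g z"] z unfolding D_def by blast
  qed
qed

text \<open>Fibres are compared with a fixed point \<open>c\<close>. The extremum towards
  \<open>c\<close> of the part of the fibre on one side of \<open>c\<close> is a definable function,
  and one-sided continuity bounds it by a constant on an interval. Such bounds allow extrema of
  fibres to be taken below.\<close>

lemma bounded_fiber: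
  assumes S: "dpred \<M> (\<lambda>v. S (v 0) (v 1))" and ex: "has_interval (\<lambda>x. \<exists>y. S x y)"
  shows "\<exists>l u. has_interval (\<lambda>x. \<exists>y. l < y \<and> y < u \<and> S x y)"
proof -
  define c :: 'a where "c = undefined"
  note dS = dpred_rel2[OF S]
  have dside: "dpred \<M> (\<lambda>v. \<exists>y. sless s c y \<and> S (v 0) y)" for s
    by (intro dpred_intros dpred_sless dS)
  have side: "\<exists>l u. has_interval (\<lambda>x. \<exists>y. l < y \<and> y < u \<and> S x y)"
    if P: "has_interval (\<lambda>x. \<exists>y. sless s c y \<and> S x y)" for s
  proof -
    define Q where "Q x \<longleftrightarrow> (\<exists>y. sless s c y \<and> S x y)" for x
    have "\<exists>f. dfun \<M> f \<and> (\<forall>x. Q x \<longrightarrow> extremum (\<not> s) (\<lambda>y. sless s c y \<and> S x y) (f x))"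
    proof (rule extremum_function)
      show "dpred \<M> (\<lambda>v. sless s c (v 1) \<and> S (v 0) (v 1))"
        by (intro dpred_intros dpred_sless dS)
      show "dpred \<M> (\<lambda>v. Q (v 0))" unfolding Q_def by (rule dside)
      show "\<exists>c'. \<forall>y. sless s c y \<and> S x y \<longrightarrow> \<not> sless (\<not> s) c' y" for x
        using sless_trans[of s c _ c] sless_irrefl unfolding sless_not by blast
    qed (simp add: Q_def)
    then obtain f where f: "dfun \<M> f" and fe: "\<And>x. Q x \<Longrightarrow> extremum (\<not> s) (\<lambda>y. sless s c y \<and> S x y) (f x)"
      by blast
    have "has_interval Q" using P unfolding Q_def .
    then obtain t where "has_interval (\<lambda>x. Q x \<and> side_cont t f x)" using side_continuous[OF f] by blast
    then obtain l u where "l < u" and lu: "\<And>x. l < x \<Longrightarrow> x < u \<Longrightarrow> Q x \<and> side_cont t f x"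
      unfolding has_interval_def by blast
    obtain x0 where x0: "l < x0" "x0 < u" using dense[OF \<open>l < u\<close>] by blast
    obtain p where "sless s (f x0) p" using sless_unbounded by blast
    then have "sless (\<not> s) p (f x0)" by (simp add: sless_not)
    from side_cont_sless[OF conjunct2[OF lu[OF x0]] this]
    have "onesided t x0 (\<lambda>x. sless (\<not> s) p (f x) \<and> l < x \<and> x < u)"
      using x0 by (intro onesided_conj onesided_between)
    then have "has_interval (\<lambda>x. \<exists>y. (if s then c else p) < y \<and> y < (if s then p else c) \<and> S x y)"
    proof (rule has_interval_mono[OF onesided_has_interval])
      fix x assume x: "sless (\<not> s) p (f x) \<and> l < x \<and> x < u"
      then have "Q x" using lu by blast
      then obtain y where "sless s c y" "S x y" "sless (\<not> s) p y"
        using fe[of x] x unfolding extremum_def by blast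
      then show "\<exists>y. (if s then c else p) < y \<and> y < (if s then p else c) \<and> S x y"
        by (intro exI[of _ y]) (auto simp: sless_def split: if_splits)
    qed
    then show ?thesis by blast
  qed
  have "has_interval (\<lambda>x. (\<exists>y. sless True c y \<and> S x y) \<or> (\<exists>y. sless False c y \<and> S x y) \<or> S x c)"
    using ex by (rule has_interval_mono) (metis sless_cases sless_def)
  from has_interval_disj[OF dside this]
  have "has_interval (\<lambda>x. \<exists>y. sless True c y \<and> S x y) \<or> has_interval (\<lambda>x. (\<exists>y. sless False c y \<and> S x y) \<or> S x c)" .
  moreover have "has_interval (\<lambda>x. \<exists>y. sless False c y \<and> S x y) \<or> has_interval (\<lambda>x. S x c)"
    if "has_interval (\<lambda>x. (\<exists>y. sless False c y \<and> S x y) \<or> S x c)"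
    using has_interval_disj[OF dside that] .
  moreover have "\<exists>l u. has_interval (\<lambda>x. \<exists>y. l < y \<and> y < u \<and> S x y)" if "has_interval (\<lambda>x. S x c)"
  proof -
    obtain l u where "l < c" "c < u" using lt_ex gt_ex by meson
    then show ?thesis using has_interval_mono[OF that, of "\<lambda>x. \<exists>y. l < y \<and> y < u \<and> S x y"] by blast
  qed
  ultimately show ?thesis using side by blast
qed

text \<open>Within fixed bounds, the leftmost interval of a fibre has ends \<open>a x < b x\<close>
  that are definable functions of \<open>x\<close>; constants separating these two functions span a
  common interval.\<close>

lemma uniform_interval:
  assumes P: "dpred \<M> (\<lambda>v. P (v 0) (v 1))" and fib: "has_interval (\<lambda>x. has_interval (P x))"
  shows "\<exists>p q. p < q \<and> has_interval (\<lambda>x. \<forall>y. p < y \<and> y < q \<longrightarrow> P x y)"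
proof -
  note dP = dpred_rel2[OF P]
  \<comment> \<open>The interior of the fibre. The infimum is taken over it because an isolated
    point of the fibre could otherwise be the infimum, with no interval to its right.\<close>
  define U where "U x y \<longleftrightarrow> (\<exists>p q. p < y \<and> y < q \<and> (\<forall>z. p < z \<and> z < q \<longrightarrow> P x z))" for x y
  have U: "dpred \<M> (\<lambda>v. U (v 0) (v 1))" unfolding U_def by (intro dpred_intros dP)
  note dU = dpred_rel2[OF U]
  have Uex: "\<exists>y. U x y" if h: "has_interval (P x)" for x
  proof -
    obtain p q where pq: "p < q" "\<forall>z. p < z \<and> z < q \<longrightarrow> P x z" using h unfolding has_interval_def by blast
    obtain y where "p < y" "y < q" using dense[OF pq(1)] by blast
    with pq(2) show ?thesis unfolding U_def by blast
  qed
  from fib have "has_interval (\<lambda>x. \<exists>y. U x y)" by (rule has_interval_mono) (rule Uex)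
  from bounded_fiber[OF U this] obtain l u where "has_interval (\<lambda>x. \<exists>y. l < y \<and> y < u \<and> U x y)" by blast
  then obtain l' u' where "l' < u'" and l'u': "\<And>x. l' < x \<Longrightarrow> x < u' \<Longrightarrow> \<exists>y. l < y \<and> y < u \<and> U x y"
    unfolding has_interval_def by blast
  define J where "J x \<longleftrightarrow> l' < x \<and> x < u'" for x
  have dJ: "dpred \<M> (\<lambda>v. J (v 0))" unfolding J_def by (intro dpred_intros)
  define S where "S x y \<longleftrightarrow> l < y \<and> y < u \<and> U x y" for x y
  have S: "dpred \<M> (\<lambda>v. S (v 0) (v 1))" unfolding S_def by (intro dpred_intros dU)
  have "\<exists>f. dfun \<M> f \<and> (\<forall>x. J x \<longrightarrow> extremum False (S x) (f x))"
    by (rule extremum_function[OF S dJ]) (auto simp: J_def S_def sless_def l'u' intro: exI[of _ l])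
  then obtain a where a: "dfun \<M> a" and ae: "\<And>x. J x \<Longrightarrow> extremum False (S x) (a x)" by blast
  \<comment> \<open>If the germ to the right of the infimum were outside \<open>S x\<close>, the
    infimum would have to belong to \<open>S x\<close>, which is open.\<close>
  have Sright: "onesided True (a x) (S x)" if J: "J x" for x
  proof (rule ccontr)
    have low: "\<And>y. S x y \<Longrightarrow> a x \<le> y" and app: "\<And>z. a x < z \<Longrightarrow> \<exists>y. S x y \<and> y < z"
      using ae[OF J] by (auto simp: extremum_def sless_def not_less)
    assume n: "\<not> onesided True (a x) (S x)"
    have "dpred \<M> (\<lambda>v. S x (v 0))" by (intro dpred_rel2[OF S] dterm_const dterm_var)
    from germ[OF this] n have "onesided True (a x) (\<lambda>y. \<not> S x y)" by blast
    then obtain e where e: "a x < e" "\<And>y. a x < y \<Longrightarrow> y < e \<Longrightarrow> \<not> S x y"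
      unfolding onesided_def sless_def by auto
    obtain y where y: "S x y" "y < e" using app[OF e(1)] by blast
    then have "y = a x" using low e(2)[of y] by force
    with y obtain p q where pq: "l < a x" "a x < u" "p < a x" "a x < q" "\<And>z. p < z \<Longrightarrow> z < q \<Longrightarrow> P x z"
      unfolding S_def U_def by auto
    obtain w where w: "a x < w" "w < min q (min u e)" using dense[of "a x" "min q (min u e)"] pq e(1) by auto
    then have "p < w" "w < q" "l < w" "w < u" using pq by auto
    then have "S x w" using pq(5) unfolding S_def U_def by blast
    with w e show False by auto
  qed
  define V where "V x y \<longleftrightarrow> a x < y \<and> y < u \<and> (\<forall>z. a x < z \<and> z < y \<longrightarrow> P x z)" for x y
  have V: "dpred \<M> (\<lambda>v. V (v 0) (v 1))"
    unfolding V_def by (intro dpred_intros dP dterm_app[OF a])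
  have SP: "S x y \<Longrightarrow> P x y" for x y unfolding S_def U_def by blast
  have Vex: "\<exists>y. V x y" if J: "J x" for x
  proof -
    obtain e where e: "a x < e" "\<And>y. a x < y \<Longrightarrow> y < e \<Longrightarrow> S x y"
      using Sright[OF J] unfolding onesided_def sless_def by auto
    obtain y where y: "a x < y" "y < e" using dense[OF e(1)] by blast
    then have "S x y" using e by blast
    then have "V x y" unfolding V_def using y e SP unfolding S_def by auto
    then show ?thesis by blast
  qed
  have "\<exists>f. dfun \<M> f \<and> (\<forall>x. J x \<longrightarrow> extremum True (V x) (f x))"
    by (rule extremum_function[OF V dJ Vex]) (auto simp: V_def sless_def intro: exI[of _ u])
  then obtain b where b: "dfun \<M> b" and be: "\<And>x. J x \<Longrightarrow> extremum True (V x) (b x)" by blast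
  have ab: "a x < b x" if "J x" for x
    using Vex[OF that] be[OF that] by (auto simp: extremum_def sless_def V_def not_less intro: less_le_trans)
  have Pab: "P x z" if "J x" "a x < z" "z < b x" for x z
    using be[OF that(1)] that by (auto simp: extremum_def sless_def V_def)
  have "has_interval (\<lambda>x. J x \<and> a x < b x)"
    unfolding has_interval_def using \<open>l' < u'\<close> ab unfolding J_def by blast
  from separate_functions[OF a b this] obtain p q where "p < q" "has_interval (\<lambda>x. J x \<and> a x < p \<and> q < b x)"
    by blast
  moreover from this(2) have "has_interval (\<lambda>x. \<forall>y. p < y \<and> y < q \<longrightarrow> P x y)"
    by (rule has_interval_mono) (use Pab in force)
  ultimately show ?thesis by blast
qed

end

section \<open>Boxes in several variables\<close>

lemma cart_power_upd: "x \<in> cart_power n \<Longrightarrow> x(n := y) \<in> cart_power (Suc n)"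
  by (auto simp: PiE_iff extensional_def)

lemma cart_power_drop: "x \<in> cart_power (Suc n) \<Longrightarrow> x(n := undefined) \<in> cart_power n"
  by (auto simp: PiE_iff extensional_def)

lemma restrict_in_cart_power: "restrict f {..<n} \<in> cart_power n"
  by auto

lemmas simple_term_intros = simple_term_if simple_term_var simple_term_const

lemma dpred_vec1:
  assumes "dpred \<M> (\<lambda>v. P (restrict v {..<n}) (v n))"
    and "\<And>v. e v \<in> cart_power n" "\<And>i. simple_term (\<lambda>v. e v i)" "simple_term t"
  shows "dpred \<M> (\<lambda>v. P (e v) (t v))"
proof -
  have "dpred \<M> (\<lambda>v. P (restrict (\<lambda>i. if i < n then e v i else t v) {..<n}) (if n < n then e v n else t v))"
    by (rule dpred_subst[OF assms(1)]) (intro simple_term_if assms)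
  moreover have "restrict (\<lambda>i. if i < n then e v i else t v) {..<n} = e v" for v
    using assms(2)[of v] by (auto simp: fun_eq_iff PiE_def extensional_def)
  ultimately show ?thesis by simp
qed

lemma dpred_vec2:
  assumes "dpred \<M> (\<lambda>v. R (restrict v {..<m}) (\<lambda>i\<in>{..<n}. v (i + m)))"
    and "\<And>v. e v \<in> cart_power m" "\<And>i. simple_term (\<lambda>v. e v i)"
    and "\<And>v. f v \<in> cart_power n" "\<And>i. simple_term (\<lambda>v. f v i)"
  shows "dpred \<M> (\<lambda>v. R (e v) (f v))"
proof -
  let ?g = "\<lambda>v i. if i < m then e v i else f v (i - m)"
  have "dpred \<M> (\<lambda>v. R (restrict (?g v) {..<m}) (\<lambda>i\<in>{..<n}. ?g v (i + m)))"
    by (rule dpred_subst[OF assms(1)]) (intro simple_term_if assms)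
  moreover have "restrict (?g v) {..<m} = e v" "(\<lambda>i\<in>{..<n}. ?g v (i + m)) = f v" for v
    using assms(2)[of v] assms(4)[of v] by (auto simp: fun_eq_iff PiE_def extensional_def)
  ultimately show ?thesis by simp
qed

lemma dpred_all_less: "(\<And>i. i < n \<Longrightarrow> dpred \<M> (P i)) \<Longrightarrow> dpred \<M> (\<lambda>v. \<forall>i<n::nat. P i v)"
proof (induction n)
  case 0
  then show ?case using dpred_const[of \<M> True] by simp
next
  case (Suc n)
  have "dpred \<M> (\<lambda>v. (\<forall>i<n. P i v) \<and> P n v)"
    by (rule dpred_conj) (use Suc in simp_all)
  moreover have "(\<lambda>v. \<forall>i<Suc n. P i v) = (\<lambda>v. (\<forall>i<n. P i v) \<and> P n v)"
    by (auto simp: fun_eq_iff less_Suc_eq)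
  ultimately show ?case by simp
qed

text \<open>Nonempty interior in the product topology, expressed through the corners of a box so
  that it is first-order; the equivalence is \<open>interior_of_power_top\<close>.\<close>

definition fat :: "nat \<Rightarrow> ((nat \<Rightarrow> 'a::ord) \<Rightarrow> bool) \<Rightarrow> bool" where
  "fat n P \<longleftrightarrow> (\<exists>l u. (\<forall>i<n. l i < u i) \<and> (\<forall>x\<in>cart_power n. (\<forall>i<n. l i < x i \<and> x i < u i) \<longrightarrow> P x))"

lemma fat_mono:
  "fat n P \<Longrightarrow> (\<And>x. x \<in> cart_power n \<Longrightarrow> P x \<Longrightarrow> Q x) \<Longrightarrow> fat n Q"
  unfolding fat_def by (elim exE conjE) (intro exI conjI ballI impI, assumption, blast)

lemma fat_ex:
  fixes P :: "(nat \<Rightarrow> 'a::unbounded_dense_linorder) \<Rightarrow> bool"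
  assumes "fat n P" shows "\<exists>x\<in>cart_power n. P x"
proof -
  obtain l u where lu: "\<forall>i<n. l i < u i" "\<forall>x\<in>cart_power n. (\<forall>i<n. l i < x i \<and> x i < u i) \<longrightarrow> P x"
    using assms unfolding fat_def by (elim exE conjE)
  have "\<forall>i. \<exists>y. i < n \<longrightarrow> l i < y \<and> y < u i" using lu(1) dense by meson
  then obtain x where x: "\<forall>i. i < n \<longrightarrow> l i < x i \<and> x i < u i" by metis
  have "restrict x {..<n} \<in> cart_power n" "P (restrict x {..<n})"
    using lu(2)[rule_format, of "restrict x {..<n}"] x by auto
  then show ?thesis by blast
qed

lemma fat_0: "fat 0 P \<longleftrightarrow> P (\<lambda>_. undefined)"
  unfolding fat_def by simp

lemma fat_Suc: "fat (Suc n) P \<longleftrightarrow> (\<exists>p q. p < q \<and> fat n (\<lambda>x. \<forall>y. p < y \<and> y < q \<longrightarrow> P (x(n := y))))"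
  (is "?l \<longleftrightarrow> ?r")
proof
  assume ?l
  then obtain l u where lu: "\<forall>i<Suc n. l i < u i" "\<forall>x\<in>cart_power (Suc n). (\<forall>i<Suc n. l i < x i \<and> x i < u i) \<longrightarrow> P x"
    unfolding fat_def by (elim exE conjE)
  have "P (x(n := y))" if "x \<in> cart_power n" "\<forall>i<n. l i < x i \<and> x i < u i" "l n < y \<and> y < u n" for x y
    by (rule lu(2)[rule_format, OF cart_power_upd[OF that(1)]]) (use that in \<open>auto simp: less_Suc_eq\<close>)
  then have "l n < u n \<and> fat n (\<lambda>x. \<forall>y. l n < y \<and> y < u n \<longrightarrow> P (x(n := y)))"
    using lu(1) unfolding fat_def by (intro conjI exI[of _ l] exI[of _ u]) auto
  then show ?r by blast
next
  assume ?r
  then obtain p q l u where pq: "p < q" and lu: "\<forall>i<n. l i < u i"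
    "\<forall>x\<in>cart_power n. (\<forall>i<n. l i < x i \<and> x i < u i) \<longrightarrow> (\<forall>y. p < y \<and> y < q \<longrightarrow> P (x(n := y)))"
    unfolding fat_def by (elim exE conjE)
  have Px: "P x" if x: "x \<in> cart_power (Suc n)" "\<forall>i<Suc n. (l(n := p)) i < x i \<and> x i < (u(n := q)) i" for x
  proof -
    have "l i < (x(n := undefined)) i \<and> (x(n := undefined)) i < u i" if "i < n" for i
      using x(2)[rule_format, of i] that by simp
    then have "\<forall>i<n. l i < (x(n := undefined)) i \<and> (x(n := undefined)) i < u i" by blast
    moreover have "p < x n \<and> x n < q" using x(2)[rule_format, of n] by simp
    ultimately have "P ((x(n := undefined))(n := x n))"
      using lu(2)[rule_format, OF cart_power_drop[OF x(1)]] by blast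
    then show ?thesis by simp
  qed
  have less: "\<forall>i<Suc n. (l(n := p)) i < (u(n := q)) i" using lu(1) pq by auto
  show ?l unfolding fat_def
    by (rule exI[of _ "l(n := p)"], rule exI[of _ "u(n := q)"], intro conjI ballI impI)
      (rule less, erule (1) Px)
qed

lemma dpred_fat:
  fixes \<M> :: "('a::ord, 'f, 'r) ostruct"
  assumes "dpred \<M> (\<lambda>v. P (\<lambda>i. v (i + n)) (restrict v {..<n}))"
  shows "dpred \<M> (\<lambda>v. fat n (P v))"
proof -
  have eq: "fat n Q \<longleftrightarrow> (\<exists>l\<in>cart_power n. \<exists>u\<in>cart_power n. (\<forall>i<n. l i < u i) \<and>
      (\<forall>x\<in>cart_power n. (\<forall>i<n. l i < x i) \<and> (\<forall>i<n. x i < u i) \<longrightarrow> Q x))"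
    (is "_ \<longleftrightarrow> ?r") for Q :: "(nat \<Rightarrow> 'a) \<Rightarrow> bool"
  proof
    assume "fat n Q"
    then obtain l u where "\<forall>i<n. l i < u i" "\<forall>x\<in>cart_power n. (\<forall>i<n. l i < x i \<and> x i < u i) \<longrightarrow> Q x"
      unfolding fat_def by (elim exE conjE)
    then show ?r by (intro bexI[of _ "restrict l {..<n}"] bexI[of _ "restrict u {..<n}"]) auto
  next
    assume ?r
    then obtain l u where "\<forall>i<n. l i < u i" "\<forall>x\<in>cart_power n. (\<forall>i<n. l i < x i) \<and> (\<forall>i<n. x i < u i) \<longrightarrow> Q x"
      by (elim bexE conjE)
    then show "fat n Q" unfolding fat_def by (intro exI[of _ l] exI[of _ u]) auto
  qed
  have less: "dpred \<M> (\<lambda>v. \<forall>i<n. restrict (\<lambda>i. v (f i)) {..<n} i < restrict (\<lambda>i. v (g i)) {..<n} i)" for f g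
    by (intro dpred_all_less) (simp add: dpred_less_var)
  \<comment> \<open>Under the quantifiers for two corners and a point there are three blocks of
    \<open>n\<close> bound variables, so the outer valuation is shifted by
    \<open>n + n + n\<close>.\<close>
  have "dpred \<M> (\<lambda>v. P (\<lambda>i. (\<lambda>i. if i < n then v i else v (i + n + n)) (i + n)) (restrict (\<lambda>i. if i < n then v i else v (i + n + n)) {..<n}))"
    by (rule dpred_subst[OF assms]) (intro simple_term_intros)
  moreover have "restrict (\<lambda>i. if i < n then v i else v (i + n + n)) {..<n} = restrict v {..<n}" for v :: "nat \<Rightarrow> 'a"
    by auto
  ultimately have "dpred \<M> (\<lambda>v. P (\<lambda>i. v (i + n + n + n)) (restrict v {..<n}))"
    by simp
  then show ?thesis
    unfolding eq
    by (intro dpred_bex_power dpred_conj dpred_ball_power dpred_imp less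
          less[of "\<lambda>i. i", simplified] less[of _ "\<lambda>i. i", simplified])
qed

section \<open>Uniformity over boxes and finite covers\<close>

context tame begin

lemma dpred_has_interval:
  assumes "dpred \<M> (\<lambda>v. P (\<lambda>i. v (Suc (Suc (Suc i)))) (v 0))"
  shows "dpred \<M> (\<lambda>v. has_interval (P v))"
  unfolding has_interval_def using assms by (intro dpred_intros) auto

text \<open>In the induction step, a box in the last two
  coordinates is made uniform one corner at a time.\<close>

lemma uniform_fiber:
  assumes "dpred \<M> (\<lambda>v. P (restrict v {..<n}) (v n))" "fat n (\<lambda>x. has_interval (P x))"
  shows "\<exists>p q. p < q \<and> fat n (\<lambda>x. \<forall>y. p < y \<and> y < q \<longrightarrow> P x y)"
  using assms
proof (induction n arbitrary: P)
  case 0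
  from 0(2) show ?case unfolding fat_0 has_interval_def .
next
  case (Suc n)
  note dP = dpred_vec1[OF Suc.prems(1)]
  note simps = fun_upd_apply restrict_apply
  obtain a b where ab: "a < b" "fat n (\<lambda>x. \<forall>s. a < s \<and> s < b \<longrightarrow> has_interval (P (x(n := s))))"
    using Suc.prems(2) unfolding fat_Suc by (elim exE conjE)
  define B where "B x s t p q \<longleftrightarrow> (\<forall>s' y. s < s' \<and> s' < t \<and> p < y \<and> y < q \<longrightarrow> P (x(n := s')) y)" for x s t p q
  define E where "E x s \<longleftrightarrow> (\<exists>t. s < t \<and> (\<exists>p q. p < q \<and> B x s t p q))" for x s
  \<comment> \<open>In the plane over \<open>x\<close> the one-dimensional principle yields a box.
    Every abscissa \<open>s\<close> inside it can serve as left end, with the right end kept, so the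
    possible left ends contain an interval.\<close>
  have "fat n (\<lambda>x. has_interval (E x))"
  proof (rule fat_mono[OF ab(2)])
    fix x :: "nat \<Rightarrow> 'a"
    assume x: "x \<in> cart_power n" and fib: "\<forall>s. a < s \<and> s < b \<longrightarrow> has_interval (P (x(n := s)))"
    have "dpred \<M> (\<lambda>v. P (x(n := v 0)) (v 1))"
      by (intro dP cart_power_upd x; (unfold simps)?; intro simple_term_intros)
    moreover have "has_interval (\<lambda>s. has_interval (P (x(n := s))))"
      unfolding has_interval_def[of "\<lambda>s. has_interval (P (x(n := s)))"] using ab(1) fib by blast
    ultimately have "\<exists>p q. p < q \<and> has_interval (\<lambda>s. \<forall>y. p < y \<and> y < q \<longrightarrow> P (x(n := s)) y)"
      by (rule uniform_interval)
    then obtain p q where pq: "p < q" "has_interval (\<lambda>s. \<forall>y. p < y \<and> y < q \<longrightarrow> P (x(n := s)) y)"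
      by (elim exE conjE)
    then obtain c d where cd: "c < d" "\<forall>s. c < s \<and> s < d \<longrightarrow> (\<forall>y. p < y \<and> y < q \<longrightarrow> P (x(n := s)) y)"
      unfolding has_interval_def by (elim exE conjE)
    have "E x s" if s: "c < s \<and> s < d" for s
    proof -
      have "B x s d p q" unfolding B_def using cd(2) s by auto
      then show ?thesis unfolding E_def using s pq(1) by blast
    qed
    then show "has_interval (E x)" unfolding has_interval_def using cd(1) by blast
  qed
  moreover have "dpred \<M> (\<lambda>v. E (restrict v {..<n}) (v n))"
    unfolding E_def B_def
    by (intro dpred_intros dP cart_power_upd restrict_in_cart_power; (unfold simps)?; intro simple_term_intros)
  ultimately have "\<exists>c d. c < d \<and> fat n (\<lambda>x. \<forall>s. c < s \<and> s < d \<longrightarrow> E x s)"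
    by (rule Suc.IH[rotated])
  then obtain c d where cd: "c < d" "fat n (\<lambda>x. \<forall>s. c < s \<and> s < d \<longrightarrow> E x s)"
    by (elim exE conjE)
  obtain s where s: "c < s" "s < d" using dense[OF cd(1)] by (elim exE conjE)
  \<comment> \<open>With the left end \<open>s\<close> now common to a box of points
    \<open>x\<close>, the right end is treated in the same way: shrinking \<open>t\<close> keeps the
    box inside \<open>P\<close>.\<close>
  define R where "R x t \<longleftrightarrow> s < t \<and> (\<exists>p q. p < q \<and> B x s t p q)" for x t
  have "fat n (\<lambda>x. has_interval (R x))"
  proof (rule fat_mono[OF cd(2)])
    fix x assume "\<forall>s. c < s \<and> s < d \<longrightarrow> E x s"
    then have "E x s" using s by blast
    then obtain t p q where t: "s < t" "p < q" "B x s t p q" unfolding E_def by (elim exE conjE)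
    have "R x t'" if "s < t' \<and> t' < t" for t'
    proof -
      have "B x s t' p q" using t(3) that unfolding B_def by auto
      then show ?thesis unfolding R_def using that t(2) by blast
    qed
    then show "has_interval (R x)" unfolding has_interval_def using t(1) by blast
  qed
  moreover have "dpred \<M> (\<lambda>v. R (restrict v {..<n}) (v n))"
    unfolding R_def B_def
    by (intro dpred_intros dP cart_power_upd restrict_in_cart_power; (unfold simps)?; intro simple_term_intros)
  ultimately have "\<exists>c' d'. c' < d' \<and> fat n (\<lambda>x. \<forall>t. c' < t \<and> t < d' \<longrightarrow> R x t)"
    by (rule Suc.IH[rotated])
  then obtain c' d' where cd': "c' < d'" "fat n (\<lambda>x. \<forall>t. c' < t \<and> t < d' \<longrightarrow> R x t)"
    by (elim exE conjE)
  obtain t where t: "c' < t" "t < d'" using dense[OF cd'(1)] by (elim exE conjE)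
  have "fat n (\<lambda>x. R x t)"
    by (rule fat_mono[OF cd'(2)]) (use t in simp)
  then obtain x where "R x t" using fat_ex by blast
  then have "s < t" unfolding R_def by simp
  \<comment> \<open>Once the whole side from \<open>s\<close> to \<open>t\<close> is common, only
    \<open>p\<close> and \<open>q\<close> are left to choose, which is again a fibre problem over
    \<open>M^n\<close>.\<close>
  define Q where "Q x y \<longleftrightarrow> (\<forall>s'. s < s' \<and> s' < t \<longrightarrow> P (x(n := s')) y)" for x y
  have "fat n (\<lambda>x. has_interval (Q x))"
    by (rule fat_mono[OF \<open>fat n (\<lambda>x. R x t)\<close>]) (unfold R_def B_def Q_def has_interval_def, blast)
  moreover have "dpred \<M> (\<lambda>v. Q (restrict v {..<n}) (v n))"
    unfolding Q_def
    by (intro dpred_intros dP cart_power_upd restrict_in_cart_power; (unfold simps)?; intro simple_term_intros)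
  ultimately have "\<exists>p q. p < q \<and> fat n (\<lambda>x. \<forall>y. p < y \<and> y < q \<longrightarrow> Q x y)"
    by (rule Suc.IH[rotated])
  then obtain p q where pq: "p < q" "fat n (\<lambda>x. \<forall>y. p < y \<and> y < q \<longrightarrow> Q x y)"
    by (elim exE conjE)
  have "fat n (\<lambda>x. \<forall>s'. s < s' \<and> s' < t \<longrightarrow> (\<forall>y. p < y \<and> y < q \<longrightarrow> P (x(n := s')) y))"
    by (rule fat_mono[OF pq(2)]) (simp add: Q_def)
  with \<open>s < t\<close> have "fat (Suc n) (\<lambda>x. \<forall>y. p < y \<and> y < q \<longrightarrow> P x y)"
    unfolding fat_Suc by (intro exI conjI)
  with pq(1) show ?case by (intro exI conjI)
qed

lemma dpow_fiber:
  assumes "dpow \<M> (Suc n) P"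
  shows "dpred \<M> (\<lambda>v. P ((restrict v {..<n})(n := v n)))"
  by (intro dpred_vec[OF assms] cart_power_upd restrict_in_cart_power; (unfold fun_upd_apply restrict_apply)?; intro simple_term_intros)

lemma dpow_has_interval:
  assumes "dpow \<M> (Suc n) P"
  shows "dpow \<M> n (\<lambda>x. has_interval (\<lambda>y. P (x(n := y))))"
  unfolding dpow_def
  by (intro dpred_has_interval dpred_vec[OF assms] cart_power_upd restrict_in_cart_power; (unfold fun_upd_apply restrict_apply)?; intro simple_term_intros)

text \<open>The Kuratowski--Ulam principle as it is applied from here on: the interval in the
  hypothesis may vary with \<open>x\<close>.\<close>

lemma fat_SucI:
  assumes "dpow \<M> (Suc n) P" "fat n (\<lambda>x. has_interval (\<lambda>y. P (x(n := y))))"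
  shows "fat (Suc n) P"
  using uniform_fiber[of "\<lambda>x y. P (x(n := y))", OF dpow_fiber[OF assms(1)] assms(2)] unfolding fat_Suc .

text \<open>Over each point of a box one of the two fibres contains an interval. The induction
  hypothesis makes the choice uniform, and \<open>fat_SucI\<close> returns to \<open>Suc n\<close>
  coordinates.\<close>

lemma fat_disj:
  assumes "dpow \<M> n P" "dpow \<M> n Q" "fat n (\<lambda>x. P x \<or> Q x)"
  shows "fat n P \<or> fat n Q"
  using assms
proof (induction n arbitrary: P Q)
  case 0
  from 0(3) show ?case unfolding fat_0 .
next
  case (Suc n)
  obtain p q where pq: "p < q" "fat n (\<lambda>x. \<forall>y. p < y \<and> y < q \<longrightarrow> P (x(n := y)) \<or> Q (x(n := y)))"
    using Suc.prems(3) unfolding fat_Suc by (elim exE conjE)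
  have "fat n (\<lambda>x. has_interval (\<lambda>y. P (x(n := y))) \<or> has_interval (\<lambda>y. Q (x(n := y))))"
  proof (rule fat_mono[OF pq(2)])
    fix x :: "nat \<Rightarrow> 'a"
    assume x: "x \<in> cart_power n" and h: "\<forall>y. p < y \<and> y < q \<longrightarrow> P (x(n := y)) \<or> Q (x(n := y))"
    have "dpred \<M> (\<lambda>v. P (x(n := v 0)))"
      by (intro dpred_vec[OF Suc.prems(1)] cart_power_upd x; (unfold fun_upd_apply)?; intro simple_term_intros)
    moreover have "has_interval (\<lambda>y. P (x(n := y)) \<or> Q (x(n := y)))"
      unfolding has_interval_def using pq(1) h by (intro exI conjI)
    ultimately show "has_interval (\<lambda>y. P (x(n := y))) \<or> has_interval (\<lambda>y. Q (x(n := y)))"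
      by (rule has_interval_disj)
  qed
  from Suc.IH[OF dpow_has_interval[OF Suc.prems(1)] dpow_has_interval[OF Suc.prems(2)] this]
  show ?case using fat_SucI[OF Suc.prems(1)] fat_SucI[OF Suc.prems(2)] by (elim disjE) simp_all
qed

lemma dpow_Bex:
  assumes "finite K" "\<And>k. k \<in> K \<Longrightarrow> dpow \<M> n (P k)"
  shows "dpow \<M> n (\<lambda>x. \<exists>k\<in>K. P k x)"
  using assms
proof (induction K)
  case empty
  then show ?case unfolding dpow_def using dpred_const[of \<M> False] by simp
next
  case (insert j K)
  then have "dpow \<M> n (P j)" "dpow \<M> n (\<lambda>x. \<exists>k\<in>K. P k x)" by simp_all
  then show ?case unfolding dpow_def by (simp add: dpred_disj)
qed

lemma fat_Bex:
  assumes "finite K" "\<And>k. k \<in> K \<Longrightarrow> dpow \<M> n (P k)" "fat n (\<lambda>x. \<exists>k\<in>K. P k x)"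
  shows "\<exists>k\<in>K. fat n (P k)"
  using assms
proof (induction K)
  case empty
  then show ?case using fat_ex by force
next
  case (insert k K)
  have "dpow \<M> n (\<lambda>x. \<exists>k\<in>K. P k x)"
    using insert.hyps(1) insert.prems(1) by (intro dpow_Bex) simp_all
  moreover have "fat n (\<lambda>x. P k x \<or> (\<exists>k\<in>K. P k x))" using insert.prems(2) by simp
  ultimately have "fat n (P k) \<or> fat n (\<lambda>x. \<exists>k\<in>K. P k x)"
    using insert.prems(1) by (intro fat_disj) simp_all
  then show ?case using insert by auto
qed

text \<open>The boxes in the fibres may vary with \<open>u\<close>; peeling off the last of the
  \<open>d\<close> fibre coordinates reduces the claim to \<open>fat_SucI\<close>.\<close>

lemma fat_fat:
  assumes "dpred \<M> (\<lambda>v. R (restrict v {..<e}) (\<lambda>i\<in>{..<d}. v (i + e)))" "fat e (\<lambda>u. fat d (R u))"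
  shows "fat (e + d) (\<lambda>z. R (restrict z {..<e}) (\<lambda>i\<in>{..<d}. z (i + e)))"
  using assms
proof (induction d arbitrary: R)
  case 0
  have [simp]: "restrict f {} = (\<lambda>_. undefined)" for f :: "nat \<Rightarrow> 'a"
    by (auto simp: fun_eq_iff)
  have "fat e (\<lambda>z. R (restrict z {..<e}) (\<lambda>i\<in>{..<0}. z (i + e)))"
    by (rule fat_mono[OF 0(2)]) (simp add: fat_0 cart_power_restrict)
  then show ?case by (simp only: add_0_right)
next
  case (Suc d)
  note dR = dpred_vec2[OF Suc.prems(1)]
  define S where "S u w \<longleftrightarrow> has_interval (\<lambda>y. R u (w(d := y)))" for u w
  have dS: "dpred \<M> (\<lambda>v. S (restrict v {..<e}) (\<lambda>i\<in>{..<d}. v (i + e)))"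
    unfolding S_def
    by (intro dpred_has_interval dR cart_power_upd restrict_in_cart_power; (unfold fun_upd_apply restrict_apply)?; intro simple_term_intros)
  have "fat e (\<lambda>u. fat d (S u))"
  proof (rule fat_mono[OF Suc.prems(2)])
    fix u assume "fat (Suc d) (R u)"
    then obtain p q where pq: "p < q" "fat d (\<lambda>w. \<forall>y. p < y \<and> y < q \<longrightarrow> R u (w(d := y)))"
      unfolding fat_Suc by (elim exE conjE)
    show "fat d (S u)"
      by (rule fat_mono[OF pq(2)]) (unfold S_def has_interval_def, intro exI conjI, rule pq(1))
  qed
  from Suc.IH[OF dS this] have *: "fat (e + d) (\<lambda>z. S (restrict z {..<e}) (\<lambda>i\<in>{..<d}. z (i + e)))" .
  have eq: "(\<lambda>i\<in>{..<Suc d}. (z(e + d := y)) (i + e)) = (\<lambda>i\<in>{..<d}. z (i + e))(d := y)"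
    "restrict (z(e + d := y)) {..<e} = restrict z {..<e}" for z :: "nat \<Rightarrow> 'a" and y
    by (auto simp: fun_eq_iff restrict_def)
  have "fat (Suc (e + d)) (\<lambda>z. R (restrict z {..<e}) (\<lambda>i\<in>{..<Suc d}. z (i + e)))"
  proof (rule fat_SucI)
    show "dpow \<M> (Suc (e + d)) (\<lambda>z. R (restrict z {..<e}) (\<lambda>i\<in>{..<Suc d}. z (i + e)))"
      unfolding dpow_def
      by (intro dR restrict_in_cart_power; (unfold restrict_apply)?; intro simple_term_intros)
    show "fat (e + d) (\<lambda>x. has_interval (\<lambda>y. R (restrict (x(e + d := y)) {..<e}) (\<lambda>i\<in>{..<Suc d}. (x(e + d := y)) (i + e))))"
      unfolding eq using * unfolding S_def .
  qed
  then show ?case by (simp only: add_Suc_right)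
qed

end

section \<open>Projections with interior\<close>

definition proj_fat :: "nat \<Rightarrow> ((nat \<Rightarrow> 'a::ord) \<Rightarrow> bool) \<Rightarrow> nat \<Rightarrow> (nat \<Rightarrow> nat) \<Rightarrow> bool" where
  "proj_fat n P d \<iota> \<longleftrightarrow> fat d (\<lambda>u. \<exists>x\<in>cart_power n. P x \<and> (\<forall>k<d. x (\<iota> k) = u k))"

text \<open>Arbitrary index maps are allowed instead of increasing ones, which makes it easy to
  append or exchange coordinates. Injectivity is automatic by \<open>proj_fat_inj\<close> and the
  order is immaterial by \<open>proj_fat_perm\<close>.\<close>

definition dim_ge :: "nat \<Rightarrow> ((nat \<Rightarrow> 'a::ord) \<Rightarrow> bool) \<Rightarrow> nat \<Rightarrow> bool" where
  "dim_ge n P d \<longleftrightarrow> (\<exists>\<iota>. (\<forall>k<d. \<iota> k < n) \<and> proj_fat n P d \<iota>)"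

lemma dim_geI: "(\<And>k. k < d \<Longrightarrow> \<iota> k < n) \<Longrightarrow> proj_fat n P d \<iota> \<Longrightarrow> dim_ge n P d"
  unfolding dim_ge_def by blast

lemma dim_geE:
  assumes "dim_ge n P d"
  obtains \<iota> where "\<forall>k<d. \<iota> k < n" "proj_fat n P d \<iota>"
  using assms unfolding dim_ge_def by (elim exE conjE)

lemma proj_fat_mono:
  assumes "proj_fat n P d \<iota>" "\<And>x. x \<in> cart_power n \<Longrightarrow> P x \<Longrightarrow> Q x"
  shows "proj_fat n Q d \<iota>"
  unfolding proj_fat_def by (rule fat_mono[OF assms(1)[unfolded proj_fat_def]]) (use assms(2) in blast)

lemma dim_ge_mono:
  assumes "dim_ge n P d" "\<And>x. x \<in> cart_power n \<Longrightarrow> P x \<Longrightarrow> Q x"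
  shows "dim_ge n Q d"
  using assms(1) by (rule dim_geE) (rule dim_geI, blast, erule proj_fat_mono, erule (1) assms(2))

lemma dim_ge_nonempty:
  fixes P :: "(nat \<Rightarrow> 'a::unbounded_dense_linorder) \<Rightarrow> bool"
  assumes "dim_ge n P d" shows "\<exists>x\<in>cart_power n. P x"
proof -
  obtain \<iota> where "proj_fat n P d \<iota>" using assms by (rule dim_geE)
  from fat_ex[OF this[unfolded proj_fat_def]] show ?thesis by blast
qed

lemma dim_ge_0: "x \<in> cart_power n \<Longrightarrow> P x \<Longrightarrow> dim_ge n P 0"
  unfolding dim_ge_def proj_fat_def fat_0 by auto

text \<open>A box is not contained in a diagonal; this forces index maps to be injective.\<close>

lemma fat_neq:
  fixes P :: "(nat \<Rightarrow> 'a::unbounded_dense_linorder) \<Rightarrow> bool"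
  assumes "fat d P" "i < d" "j < d" "i \<noteq> j"
  shows "\<exists>u. P u \<and> u i \<noteq> u j"
proof -
  obtain l u where lu: "\<forall>i<d. l i < u i" "\<forall>x\<in>cart_power d. (\<forall>i<d. l i < x i \<and> x i < u i) \<longrightarrow> P x"
    using assms(1) unfolding fat_def by (elim exE conjE)
  have "\<forall>i. \<exists>y. i < d \<longrightarrow> l i < y \<and> y < u i" using lu(1) dense by meson
  then obtain x where x: "\<forall>i. i < d \<longrightarrow> l i < x i \<and> x i < u i" by metis
  have "x i < u i" using x assms(2) by blast
  then obtain y where y: "x i < y" "y < u i" using dense by blast
  have 1: "P (restrict x {..<d})" using lu(2)[rule_format, of "restrict x {..<d}"] x by auto
  have "l i < y" using x assms(2) y by (meson less_trans)
  then have "P (restrict (x(i := y)) {..<d})"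
    using x y by (intro lu(2)[rule_format] restrict_in_cart_power) auto
  then show ?thesis
    using 1 y(1) assms(2-4)
    by (cases "x i = x j") (auto intro: exI[of _ "restrict (x(i := y)) {..<d}"] exI[of _ "restrict x {..<d}"])
qed

lemma proj_fat_inj:
  fixes P :: "(nat \<Rightarrow> 'a::unbounded_dense_linorder) \<Rightarrow> bool"
  assumes "proj_fat n P d \<iota>" shows "inj_on \<iota> {..<d}"
proof (rule inj_onI, rule ccontr)
  fix i j assume ij: "i \<in> {..<d}" "j \<in> {..<d}" "\<iota> i = \<iota> j" "i \<noteq> j"
  have "\<exists>u. (\<exists>x\<in>cart_power n. P x \<and> (\<forall>k<d. x (\<iota> k) = u k)) \<and> u i \<noteq> u j"
    using ij by (intro fat_neq[OF assms[unfolded proj_fat_def]]) auto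
  then obtain u x :: "nat \<Rightarrow> 'a" where "\<forall>k<d. x (\<iota> k) = u k" "u i \<noteq> u j" by blast
  then show False using ij by (metis lessThan_iff)
qed

lemma dim_ge_le:
  fixes P :: "(nat \<Rightarrow> 'a::unbounded_dense_linorder) \<Rightarrow> bool"
  assumes "dim_ge n P d" shows "d \<le> n"
proof -
  obtain \<iota> where \<iota>: "\<forall>k<d. \<iota> k < n" "proj_fat n P d \<iota>" using assms by (rule dim_geE)
  then have "card {..<d} \<le> card {..<n}" by (intro card_inj_on_le[OF proj_fat_inj]) auto
  then show ?thesis by simp
qed

lemma fat_perm:
  assumes "bij_betw \<sigma> {..<d} {..<d}" "fat d P"
  shows "fat d (\<lambda>w. \<exists>u. P u \<and> (\<forall>k<d. w k = u (\<sigma> k)))"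
proof -
  obtain l u where lu: "\<forall>i<d. l i < u i" "\<forall>x\<in>cart_power d. (\<forall>i<d. l i < x i \<and> x i < u i) \<longrightarrow> P x"
    using assms(2) unfolding fat_def by (elim exE conjE)
  define \<tau> where "\<tau> = inv_into {..<d} \<sigma>"
  have \<tau>: "\<tau> k < d" "\<sigma> (\<tau> k) = k" "\<tau> (\<sigma> k) = k" "\<sigma> k < d" if "k < d" for k
    using assms(1) that bij_betw_inv_into_left[OF assms(1)] bij_betw_inv_into_right[OF assms(1)]
      bij_betwE[OF bij_betw_inv_into[OF assms(1)]] bij_betwE[OF assms(1)]
    unfolding \<tau>_def by auto
  have "\<exists>u. P u \<and> (\<forall>k<d. w k = u (\<sigma> k))"
    if w: "w \<in> cart_power d" "\<forall>i<d. l (\<sigma> i) < w i \<and> w i < u (\<sigma> i)" for w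
  proof (intro exI conjI)
    have "l j < w (\<tau> j) \<and> w (\<tau> j) < u j" if "j < d" for j
      using w(2)[rule_format, of "\<tau> j"] \<tau>[OF that] by simp
    then show "P (\<lambda>j\<in>{..<d}. w (\<tau> j))" by (intro lu(2)[rule_format] restrict_in_cart_power) auto
    show "\<forall>k<d. w k = (\<lambda>j\<in>{..<d}. w (\<tau> j)) (\<sigma> k)" using \<tau> by simp
  qed
  moreover have "\<forall>i<d. l (\<sigma> i) < u (\<sigma> i)" using lu(1) \<tau> by blast
  ultimately show ?thesis unfolding fat_def[of d "\<lambda>w. \<exists>u. P u \<and> (\<forall>k<d. w k = u (\<sigma> k))"]
    by (intro exI[of _ "\<lambda>i. l (\<sigma> i)"] exI[of _ "\<lambda>i. u (\<sigma> i)"]) simp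
qed

lemma proj_fat_perm:
  assumes "bij_betw \<sigma> {..<d} {..<d}" "proj_fat n P d \<iota>"
  shows "proj_fat n P d (\<lambda>k. \<iota> (\<sigma> k))"
  unfolding proj_fat_def
proof (rule fat_mono[OF fat_perm[OF assms(1) assms(2)[unfolded proj_fat_def]]])
  fix w :: "nat \<Rightarrow> 'a"
  assume "\<exists>u. (\<exists>x\<in>cart_power n. P x \<and> (\<forall>k<d. x (\<iota> k) = u k)) \<and> (\<forall>k<d. w k = u (\<sigma> k))"
  then obtain u x where "x \<in> cart_power n" "P x" "\<forall>k<d. x (\<iota> k) = u k" "\<forall>k<d. w k = u (\<sigma> k)"
    by (elim exE bexE conjE)
  moreover have "\<sigma> k < d" if "k < d" for k using bij_betwE[OF assms(1)] that by auto
  ultimately show "\<exists>x\<in>cart_power n. P x \<and> (\<forall>k<d. x (\<iota> (\<sigma> k)) = w k)"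
    by (intro bexI[of _ x]) auto
qed

text \<open>The second alternative is the case of a projection that uses coordinate
  \<open>n\<close>: moved to the end, this coordinate becomes a fibre over the other
  \<open>d\<close>.\<close>

lemma dim_ge_last:
  fixes P :: "(nat \<Rightarrow> 'a::unbounded_dense_linorder) \<Rightarrow> bool"
  assumes "dim_ge (Suc n) P k"
  shows "dim_ge n (\<lambda>x. \<exists>y. P (x(n := y))) k \<or>
    (\<exists>d \<iota>. k = Suc d \<and> (\<forall>i<d. \<iota> i < n) \<and>
      fat d (\<lambda>u. has_interval (\<lambda>t. \<exists>x\<in>cart_power n. P (x(n := t)) \<and> (\<forall>i<d. x (\<iota> i) = u i))))"
proof -
  obtain \<iota> where \<iota>: "\<forall>j<k. \<iota> j < Suc n" "proj_fat (Suc n) P k \<iota>" using assms by (rule dim_geE)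
  show ?thesis
  proof (cases "\<exists>j<k. \<iota> j = n")
    case False
    then have less: "\<iota> j < n" if "j < k" for j using \<iota>(1) that less_Suc_eq by auto
    have "proj_fat n (\<lambda>x. \<exists>y. P (x(n := y))) k \<iota>"
      unfolding proj_fat_def
    proof (rule fat_mono[OF \<iota>(2)[unfolded proj_fat_def]])
      fix u :: "nat \<Rightarrow> 'a"
      assume "\<exists>x\<in>cart_power (Suc n). P x \<and> (\<forall>j<k. x (\<iota> j) = u j)"
      then obtain x where x: "x \<in> cart_power (Suc n)" "P x" "\<forall>j<k. x (\<iota> j) = u j"
        by (elim bexE conjE)
      have "P ((x(n := undefined))(n := x n))" using x(2) by simp
      moreover have "\<forall>j<k. (x(n := undefined)) (\<iota> j) = u j" using x(3) less by auto
      ultimately show "\<exists>x\<in>cart_power n. (\<exists>y. P (x(n := y))) \<and> (\<forall>j<k. x (\<iota> j) = u j)"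
        using cart_power_drop[OF x(1)] by blast
    qed
    with less show ?thesis by (intro disjI1 dim_geI)
  next
    case True
    then obtain j0 where j0: "j0 < k" "\<iota> j0 = n" by blast
    then obtain d where k: "k = Suc d" by (cases k) auto
    \<comment> \<open>The transposition that brings the place \<open>j0\<close> of coordinate
      \<open>n\<close> to the last place \<open>d\<close>.\<close>
    define \<sigma> where "\<sigma> i = (if i = j0 then d else if i = d then j0 else i)" for i
    have "bij_betw \<sigma> {..<k} {..<k}"
      by (rule bij_betw_byWitness[where f' = \<sigma>]) (use j0 k in \<open>auto simp: \<sigma>_def\<close>)
    then have pf: "proj_fat (Suc n) P k (\<lambda>i. \<iota> (\<sigma> i))" using \<iota>(2) by (rule proj_fat_perm)
    define \<kappa> where "\<kappa> i = \<iota> (\<sigma> i)" for i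
    have \<kappa>d: "\<kappa> d = n" using j0 by (simp add: \<kappa>_def \<sigma>_def)
    have less: "\<kappa> i < n" if "i < d" for i
    proof -
      have "\<kappa> i \<noteq> \<kappa> d"
        using proj_fat_inj[OF pf] that k unfolding \<kappa>_def inj_on_def by auto
      moreover have "\<sigma> i < k" using that j0 k by (auto simp: \<sigma>_def)
      ultimately show ?thesis using \<iota>(1) \<kappa>d unfolding \<kappa>_def by (metis less_SucE)
    qed
    obtain p q where pq: "p < q" "fat d (\<lambda>u. \<forall>t. p < t \<and> t < q \<longrightarrow>
        (\<exists>x\<in>cart_power (Suc n). P x \<and> (\<forall>i<Suc d. x (\<kappa> i) = (u(d := t)) i)))"
      using pf unfolding proj_fat_def k fat_Suc \<kappa>_def by (elim exE conjE)
    have "fat d (\<lambda>u. has_interval (\<lambda>t. \<exists>x\<in>cart_power n. P (x(n := t)) \<and> (\<forall>i<d. x (\<kappa> i) = u i)))"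
    proof (rule fat_mono[OF pq(2)])
      fix u :: "nat \<Rightarrow> 'a"
      assume h: "\<forall>t. p < t \<and> t < q \<longrightarrow>
        (\<exists>x\<in>cart_power (Suc n). P x \<and> (\<forall>i<Suc d. x (\<kappa> i) = (u(d := t)) i))"
      have "\<exists>x\<in>cart_power n. P (x(n := t)) \<and> (\<forall>i<d. x (\<kappa> i) = u i)" if t: "p < t \<and> t < q" for t
      proof -
        obtain x where x: "x \<in> cart_power (Suc n)" "P x" "\<forall>i<Suc d. x (\<kappa> i) = (u(d := t)) i"
          using h[rule_format, OF t] by (elim bexE conjE)
        have "x n = t" using x(3)[rule_format, of d] \<kappa>d by simp
        then have "P ((x(n := undefined))(n := t))" using x(2) by auto
        moreover have "(x(n := undefined)) (\<kappa> i) = u i" if "i < d" for i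
          using x(3)[rule_format, of i] less[OF that] that by simp
        ultimately show ?thesis using cart_power_drop[OF x(1)] by blast
      qed
      then show "has_interval (\<lambda>t. \<exists>x\<in>cart_power n. P (x(n := t)) \<and> (\<forall>i<d. x (\<kappa> i) = u i))"
        unfolding has_interval_def using pq(1) by (intro exI conjI allI impI)
    qed
    with k less show ?thesis by blast
  qed
qed

lemma dim_ge_drop:
  fixes P :: "(nat \<Rightarrow> 'a::unbounded_dense_linorder) \<Rightarrow> bool"
  assumes "dim_ge (Suc n) P k"
  shows "\<exists>k'. dim_ge n (\<lambda>x. \<exists>y. P (x(n := y))) k' \<and> k \<le> Suc k'"
  using dim_ge_last[OF assms]
proof (elim disjE exE conjE)
  fix d \<iota> assume k: "k = Suc d" and \<iota>: "\<forall>i<d. \<iota> i < n"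
    and f: "fat d (\<lambda>u. has_interval (\<lambda>t. \<exists>x\<in>cart_power n. P (x(n := t)) \<and> (\<forall>i<d. x (\<iota> i) = u i)))"
  have "proj_fat n (\<lambda>x. \<exists>y. P (x(n := y))) d \<iota>"
    unfolding proj_fat_def
    by (rule fat_mono[OF f]) (drule has_interval_ex, blast)
  with \<iota> k show ?thesis by (intro exI[of _ d] conjI dim_geI) auto
qed (intro exI[of _ k], simp)

lemma dim_ge_lift:
  assumes "dim_ge n (\<lambda>x. \<exists>y. P (x(n := y))) k"
  shows "dim_ge (Suc n) P k"
proof -
  obtain \<iota> where \<iota>: "\<forall>j<k. \<iota> j < n" "proj_fat n (\<lambda>x. \<exists>y. P (x(n := y))) k \<iota>" using assms by (rule dim_geE)
  have "proj_fat (Suc n) P k \<iota>"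
    unfolding proj_fat_def
  proof (rule fat_mono[OF \<iota>(2)[unfolded proj_fat_def]])
    fix u :: "nat \<Rightarrow> 'a"
    assume "\<exists>x\<in>cart_power n. (\<exists>y. P (x(n := y))) \<and> (\<forall>j<k. x (\<iota> j) = u j)"
    then obtain x y where x: "x \<in> cart_power n" "P (x(n := y))" "\<forall>j<k. x (\<iota> j) = u j"
      by (elim bexE exE conjE)
    have "\<forall>j<k. (x(n := y)) (\<iota> j) = u j" using x(3) \<iota>(1) by auto
    with x(2) cart_power_upd[OF x(1)] show "\<exists>x\<in>cart_power (Suc n). P x \<and> (\<forall>j<k. x (\<iota> j) = u j)"
      by (intro bexI[of _ "x(n := y)"] conjI)
  qed
  then show ?thesis using \<iota>(1) by (intro dim_geI) auto
qed

section \<open>Gaining and losing a coordinate of a definable set\<close>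

context tame begin

lemma dpow_proj:
  assumes Q: "dpow \<M> n Q" and \<iota>: "\<And>k. k < d \<Longrightarrow> \<iota> k < n"
  shows "dpow \<M> d (\<lambda>u. \<exists>x\<in>cart_power n. Q x \<and> (\<forall>k<d. x (\<iota> k) = u k))"
  unfolding dpow_def
proof (intro dpred_bex_power dpred_conj dpred_all_less)
  show "dpred \<M> (\<lambda>v. Q (restrict v {..<n}))" using Q unfolding dpow_def .
  fix k assume k: "k < d"
  show "dpred \<M> (\<lambda>v. restrict v {..<n} (\<iota> k) = restrict (\<lambda>i. v (i + n)) {..<d} k)"
    using k \<iota>[OF k] by (simp add: dpred_eq_var)
qed

lemma dim_ge_SucI:
  assumes Q: "dpow \<M> n Q" and \<iota>: "\<And>j. j < d \<Longrightarrow> \<iota> j < n" and i: "i < n"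
    and f: "fat d (\<lambda>u. has_interval (\<lambda>t. \<exists>x\<in>cart_power n. Q x \<and> (\<forall>j<d. x (\<iota> j) = u j) \<and> x i = t))"
  shows "dim_ge n Q (Suc d)"
proof (rule dim_geI)
  show less: "(\<iota>(d := i)) k < n" if "k < Suc d" for k using \<iota> i that by (auto simp: less_Suc_eq)
  show "proj_fat n Q (Suc d) (\<iota>(d := i))"
    unfolding proj_fat_def
  proof (rule fat_SucI[OF dpow_proj[OF Q less]])
    show "fat d (\<lambda>u. has_interval (\<lambda>t. \<exists>x\<in>cart_power n. Q x \<and> (\<forall>k<Suc d. x ((\<iota>(d := i)) k) = (u(d := t)) k)))"
    proof (rule fat_mono[OF f], erule has_interval_mono)
      fix u :: "nat \<Rightarrow> 'a" and t
      assume "\<exists>x\<in>cart_power n. Q x \<and> (\<forall>j<d. x (\<iota> j) = u j) \<and> x i = t"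
      then obtain x where "x \<in> cart_power n" "Q x" "\<forall>j<d. x (\<iota> j) = u j" "x i = t"
        by (elim bexE conjE)
      then show "\<exists>x\<in>cart_power n. Q x \<and> (\<forall>k<Suc d. x ((\<iota>(d := i)) k) = (u(d := t)) k)"
        by (intro bexI[of _ x]) (auto simp: less_Suc_eq)
    qed
  qed
qed

lemma dim_ge_has_interval:
  assumes P: "dpow \<M> (Suc n) P" and d: "dim_ge n (\<lambda>x. has_interval (\<lambda>y. P (x(n := y)))) d"
  shows "dim_ge (Suc n) P (Suc d)"
proof -
  obtain \<iota> where \<iota>: "\<forall>j<d. \<iota> j < n" "proj_fat n (\<lambda>x. has_interval (\<lambda>y. P (x(n := y)))) d \<iota>"
    using d by (rule dim_geE)
  show ?thesis
  proof (rule dim_ge_SucI[OF P, of d \<iota> n])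
    show "\<iota> j < Suc n" if "j < d" for j using \<iota>(1) that by (simp add: less_Suc_eq)
    show "fat d (\<lambda>u. has_interval (\<lambda>t. \<exists>x\<in>cart_power (Suc n). P x \<and> (\<forall>j<d. x (\<iota> j) = u j) \<and> x n = t))"
    proof (rule fat_mono[OF \<iota>(2)[unfolded proj_fat_def]])
      fix u :: "nat \<Rightarrow> 'a"
      assume "\<exists>x\<in>cart_power n. has_interval (\<lambda>y. P (x(n := y))) \<and> (\<forall>j<d. x (\<iota> j) = u j)"
      then obtain x where x: "x \<in> cart_power n" "has_interval (\<lambda>y. P (x(n := y)))" "\<forall>j<d. x (\<iota> j) = u j"
        by (elim bexE conjE)
      show "has_interval (\<lambda>t. \<exists>x\<in>cart_power (Suc n). P x \<and> (\<forall>j<d. x (\<iota> j) = u j) \<and> x n = t)"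
      proof (rule has_interval_mono[OF x(2)])
        fix t assume "P (x(n := t))"
        with x(3) \<iota>(1) cart_power_upd[OF x(1)]
        show "\<exists>x\<in>cart_power (Suc n). P x \<and> (\<forall>j<d. x (\<iota> j) = u j) \<and> x n = t"
          by (intro bexI[of _ "x(n := t)"]) auto
      qed
    qed
  qed simp
qed

lemma no_interval_isolated:
  assumes "dpred \<M> (\<lambda>v. S (v 0))" "\<not> has_interval S"
  shows "\<exists>l u. l < a \<and> a < u \<and> (\<forall>t. l < t \<and> t < u \<and> S t \<longrightarrow> t = a)"
proof -
  obtain u where u: "a < u" "\<And>t. a < t \<Longrightarrow> t < u \<Longrightarrow> \<not> S t"
    using no_interval_germ[OF assms, of True a] unfolding onesided_def sless_def by auto
  obtain l where l: "l < a" "\<And>t. l < t \<Longrightarrow> t < a \<Longrightarrow> \<not> S t"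
    using no_interval_germ[OF assms, of False a] unfolding onesided_def sless_def by auto
  have "t = a" if "l < t \<and> t < u \<and> S t" for t
    using that l(2)[of t] u(2)[of t] by (cases t a rule: linorder_cases) auto
  with l(1) u(1) show ?thesis by blast
qed

text \<open>The base has dimension zero, so a counterexample would be a discrete set.\<close>

lemma no_interval_union:
  assumes P: "dpow \<M> (Suc n) P"
    and fib: "\<And>x. x \<in> cart_power n \<Longrightarrow> \<not> has_interval (\<lambda>y. P (x(n := y)))"
    and base: "\<And>i. i < n \<Longrightarrow> \<not> has_interval (\<lambda>t. \<exists>x\<in>cart_power n. (\<exists>y. P (x(n := y))) \<and> x i = t)"
  shows "\<not> has_interval (\<lambda>t. \<exists>x\<in>cart_power n. P (x(n := t)))"
proof
  assume int: "has_interval (\<lambda>t. \<exists>x\<in>cart_power n. P (x(n := t)))"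
  let ?X = "{z \<in> cart_power (Suc n). P z}"
  have "(\<lambda>v. restrict v {..<Suc n} \<in> ?X) = (\<lambda>v::nat \<Rightarrow> 'a. P (restrict v {..<Suc n}))"
    using restrict_in_cart_power[of _ "Suc n"] by (simp add: fun_eq_iff del: PiE_iff restrict_apply)
  then have X: "definable \<M> (Suc n) ?X"
    using P unfolding definable_iff_dpow dpow_def by auto
  have "\<not> has_interval (\<lambda>t. \<exists>x\<in>?X. x n = t)"
  proof (rule isolated_no_interval[OF X])
    fix z assume "z \<in> ?X"
    then have z: "z \<in> cart_power (Suc n)" "P z" by simp_all
    \<comment> \<open>For \<open>i < n\<close> these are the values of coordinate \<open>i\<close>
      on the whole base, for \<open>i = n\<close> the fibre over the base point of \<open>z\<close>
      alone. A box isolating each \<open>z i\<close> in its set fixes the base point, and thereby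
      also the fibre in which the last coordinate is isolated.\<close>
    define B where "B i t \<longleftrightarrow> (if i = n then P ((z(n := undefined))(n := t))
       else \<exists>x\<in>cart_power n. (\<exists>y. P (x(n := y))) \<and> x i = t)" for i t
    have "\<exists>l u. l < z i \<and> z i < u \<and> (\<forall>t. l < t \<and> t < u \<and> B i t \<longrightarrow> t = z i)" if i: "i < Suc n" for i
    proof (rule no_interval_isolated)
      show "\<not> has_interval (B i)"
        unfolding B_def using fib[OF cart_power_drop[OF z(1)]] base[of i] i by (cases "i = n") simp_all
      show "dpred \<M> (\<lambda>v. B i (v 0))"
      proof (cases "i = n")
        case True
        then show ?thesis unfolding B_def
          by (simp only: simp_thms if_True, intro dpred_vec[OF P] cart_power_upd cart_power_drop[OF z(1)]; (unfold fun_upd_apply)?; intro simple_term_intros)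
      next
        case False
        then have "i < n" using i by simp
        have "dpred \<M> (\<lambda>v. \<exists>y. P ((restrict v {..<n})(n := y)))"
          by (intro dpred_ex dpred_vec[OF P] cart_power_upd restrict_in_cart_power;
              (unfold fun_upd_apply restrict_apply)?; intro simple_term_intros)
        moreover have "dpred \<M> (\<lambda>v. restrict v {..<n} i = v (0 + n))"
          using \<open>i < n\<close> by (simp add: dpred_eq_var)
        ultimately have "dpred \<M> (\<lambda>v. \<exists>x\<in>cart_power n. (\<exists>y. P (x(n := y))) \<and> x i = v 0)"
          by (intro dpred_bex_power dpred_conj)
        with False show ?thesis unfolding B_def by simp
      qed
    qed
    then have "\<forall>i. \<exists>l u. i < Suc n \<longrightarrow> l < z i \<and> z i < u \<and> (\<forall>t. l < t \<and> t < u \<and> B i t \<longrightarrow> t = z i)" by blast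
    then obtain l u where lu: "\<And>i. i < Suc n \<Longrightarrow> l i < z i \<and> z i < u i \<and> (\<forall>t. l i < t \<and> t < u i \<and> B i t \<longrightarrow> t = z i)"
      unfolding choice_iff by (elim exE) blast
    have "y = z" if y: "y \<in> ?X" "\<forall>i<Suc n. l i < y i \<and> y i < u i" for y
    proof -
      have yc: "y \<in> cart_power (Suc n)" "P y" using y(1) by simp_all
      have "P ((y(n := undefined))(n := y n))" using yc(2) by simp
      then have Py: "\<exists>t. P ((y(n := undefined))(n := t))" by (rule exI)
      have "\<exists>x\<in>cart_power n. (\<exists>t. P (x(n := t))) \<and> x i = y i" if "i < n" for i
        using that Py by (intro bexI[OF _ cart_power_drop[OF yc(1)]] conjI) simp_all
      then have "B i (y i)" if "i < n" for i
        unfolding B_def using that by simp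
      then have eq: "y i = z i" if "i < n" for i
        using lu[of i] y(2)[rule_format, of i] that by simp
      have "(z(n := undefined))(n := y n) = y"
      proof
        fix i show "((z(n := undefined))(n := y n)) i = y i"
          using eq[of i] z(1) yc(1) by (cases "i < n"; cases "i = n") (auto simp: PiE_iff extensional_def)
      qed
      then have "B n (y n)" unfolding B_def using yc(2) by simp
      then have "y n = z n" using lu[of n] y(2)[rule_format, of n] by simp
      show "y = z"
      proof (rule PiE_ext[OF yc(1) z(1)])
        fix i assume "i \<in> {..<Suc n}"
        then show "y i = z i" using eq[of i] \<open>y n = z n\<close> by (cases "i = n") auto
      qed
    qed
    moreover have "\<forall>i<Suc n. l i < z i \<and> z i < u i" using lu by blast
    ultimately show "\<exists>l u. (\<forall>i<Suc n. l i < z i \<and> z i < u i) \<and> (\<forall>y\<in>?X. (\<forall>i<Suc n. l i < y i \<and> y i < u i) \<longrightarrow> y = z)"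
      by (intro exI[of _ l] exI[of _ u] conjI ballI impI)
  qed simp
  moreover have "has_interval (\<lambda>t. \<exists>x\<in>?X. x n = t)"
  proof (rule has_interval_mono[OF int])
    fix t assume "\<exists>x\<in>cart_power n. P (x(n := t))"
    then obtain x where "x \<in> cart_power n" "P (x(n := t))" by (elim bexE)
    then show "\<exists>x\<in>?X. x n = t" using cart_power_upd by (intro bexI[of _ "x(n := t)"]) simp_all
  qed
  ultimately show False by contradiction
qed

lemma dim_ge_disj:
  assumes "dpow \<M> n P" "dpow \<M> n Q" "dim_ge n (\<lambda>x. P x \<or> Q x) d"
  shows "dim_ge n P d \<or> dim_ge n Q d"
proof -
  obtain \<iota> where \<iota>: "\<forall>k<d. \<iota> k < n" "proj_fat n (\<lambda>x. P x \<or> Q x) d \<iota>" using assms(3) by (rule dim_geE)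
  have "fat d (\<lambda>u. (\<exists>x\<in>cart_power n. P x \<and> (\<forall>k<d. x (\<iota> k) = u k)) \<or> (\<exists>x\<in>cart_power n. Q x \<and> (\<forall>k<d. x (\<iota> k) = u k)))"
    by (rule fat_mono[OF \<iota>(2)[unfolded proj_fat_def]]) blast
  then have "proj_fat n P d \<iota> \<or> proj_fat n Q d \<iota>"
    unfolding proj_fat_def using \<iota>(1) by (intro fat_disj dpow_proj assms) auto
  then show ?thesis using \<iota>(1) dim_geI by blast
qed

text \<open>Suppose the projection uses coordinate \<open>n\<close>. Over each \<open>u\<close> some
  coordinate of the base must run through an interval, since otherwise
  \<open>no_interval_union\<close> applies; that coordinate can replace coordinate \<open>n\<close>.
  \<open>fat_Bex\<close> makes its choice independent of \<open>u\<close>.\<close>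

lemma dim_ge_thin:
  assumes P: "dpow \<M> (Suc n) P"
    and fib: "\<And>x. x \<in> cart_power n \<Longrightarrow> \<not> has_interval (\<lambda>y. P (x(n := y)))"
    and k: "dim_ge (Suc n) P k"
  shows "dim_ge n (\<lambda>x. \<exists>y. P (x(n := y))) k"
  using dim_ge_last[OF k]
proof (elim disjE exE conjE)
  fix d \<iota> assume k: "k = Suc d" and \<iota>: "\<forall>i<d. \<iota> i < n"
    and f: "fat d (\<lambda>u. has_interval (\<lambda>t. \<exists>x\<in>cart_power n. P (x(n := t)) \<and> (\<forall>i<d. x (\<iota> i) = u i)))"
  let ?Q = "\<lambda>x. \<exists>y. P (x(n := y))"
  have Q: "dpow \<M> n ?Q"
    unfolding dpow_def
    by (intro dpred_ex dpred_vec[OF P] cart_power_upd restrict_in_cart_power;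
        (unfold fun_upd_apply restrict_apply)?; intro simple_term_intros)
  define I where "I i u \<longleftrightarrow> has_interval (\<lambda>t. \<exists>x\<in>cart_power n. ?Q x \<and> (\<forall>j<d. x (\<iota> j) = u j) \<and> x i = t)" for i u
  have "fat d (\<lambda>u. \<exists>i\<in>{..<n}. I i u)"
  proof (rule fat_mono[OF f], rule ccontr)
    fix u :: "nat \<Rightarrow> 'a"
    assume int: "has_interval (\<lambda>t. \<exists>x\<in>cart_power n. P (x(n := t)) \<and> (\<forall>i<d. x (\<iota> i) = u i))"
      and none: "\<not> (\<exists>i\<in>{..<n}. I i u)"
    \<comment> \<open>The part of \<open>P\<close> above \<open>u\<close>: the constraint concerns
      base coordinates only, so the last coordinate remains free.\<close>
    let ?P = "\<lambda>z. P z \<and> (\<forall>i<d. z (\<iota> i) = u i)"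
    have upd: "(x(n := t)) (\<iota> i) = x (\<iota> i)" if "i < d" for x :: "nat \<Rightarrow> 'a" and t i
      using \<iota> that by auto
    have upd': "?P (x(n := t)) \<longleftrightarrow> P (x(n := t)) \<and> (\<forall>i<d. x (\<iota> i) = u i)" for x t
      using upd by auto
    have "\<not> has_interval (\<lambda>t. \<exists>x\<in>cart_power n. ?P (x(n := t)))"
    proof (rule no_interval_union)
      have "dpred \<M> (\<lambda>v. restrict v {..<Suc n} (\<iota> i) = u i)" if "i < d" for i
        using \<iota> that dpred_eq[OF dterm_var[of \<M> "\<iota> i"] dterm_const[of \<M> "u i"]] by (simp add: less_Suc_eq)
      then show "dpow \<M> (Suc n) ?P"
        using P unfolding dpow_def by (intro dpred_conj dpred_all_less)
    next
      fix x :: "nat \<Rightarrow> 'a" assume x: "x \<in> cart_power n"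
      show "\<not> has_interval (\<lambda>y. ?P (x(n := y)))"
        using fib[OF x] has_interval_mono[of "\<lambda>y. ?P (x(n := y))" "\<lambda>y. P (x(n := y))"] by blast
    next
      fix i assume "i < n"
      then have "\<not> I i u" using none by blast
      then show "\<not> has_interval (\<lambda>t. \<exists>x\<in>cart_power n. (\<exists>y. ?P (x(n := y))) \<and> x i = t)"
        unfolding I_def upd' by (simp add: conj_assoc)
    qed
    then show False using int unfolding upd' by contradiction
  qed
  moreover have "dpow \<M> d (I i)" if "i \<in> {..<n}" for i
  proof -
    have "dpred \<M> (\<lambda>v. restrict v {..<n} (\<iota> k) = restrict (\<lambda>i. v (Suc (Suc (Suc (i + n))))) {..<d} k)" if "k < d" for k
      using that \<iota> by (simp add: dpred_eq_var)
    have s: "dpred \<M> (\<lambda>v. restrict v {..<n} (\<iota> k) = restrict (\<lambda>i. v (Suc (Suc (Suc i)) + n)) {..<d} k)" if "k < d" for k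
      using that \<iota> by (simp add: dpred_eq_var)
    have "dpred \<M> (\<lambda>v. restrict v {..<n} i = v (0 + n))" using \<open>i \<in> {..<n}\<close> by (simp add: dpred_eq_var)
    then show ?thesis
      unfolding dpow_def I_def
      by (intro dpred_has_interval dpred_bex_power dpred_conj dpred_all_less Q[unfolded dpow_def]) (use s in auto)
  qed
  ultimately obtain i where "i < n" "fat d (I i)"
    using fat_Bex[of "{..<n}" d I] by auto
  then show ?thesis unfolding k I_def using \<iota> by (intro dim_ge_SucI[OF Q, of d \<iota> i]) auto
qed

end

section \<open>Additivity of dimension\<close>

text \<open>Keeping relations curried makes the fibre over \<open>x\<close> simply
  \<open>R x\<close>; this is the corresponding subset of \<open>M^(m+n)\<close>.\<close>

definition pairing :: "nat \<Rightarrow> nat \<Rightarrow> ((nat \<Rightarrow> 'a) \<Rightarrow> (nat \<Rightarrow> 'a) \<Rightarrow> bool) \<Rightarrow> (nat \<Rightarrow> 'a) \<Rightarrow> bool" where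
  "pairing m n R z \<longleftrightarrow> R (restrict z {..<m}) (\<lambda>i\<in>{..<n}. z (i + m))"

definition drel :: "('a::ord, 'f, 'r) ostruct \<Rightarrow> nat \<Rightarrow> nat \<Rightarrow> ((nat \<Rightarrow> 'a) \<Rightarrow> (nat \<Rightarrow> 'a) \<Rightarrow> bool) \<Rightarrow> bool" where
  "drel \<M> m n R \<longleftrightarrow> dpred \<M> (pairing m n R)"

lemma dpow_pairing:
  assumes "drel \<M> m n R" shows "dpow \<M> (m + n) (pairing m n R)"
proof -
  have "pairing m n R (restrict v {..<m + n}) = pairing m n R v" for v
    unfolding pairing_def by (rule arg_cong2[where f = R]) (auto simp: fun_eq_iff)
  then show ?thesis using assms unfolding drel_def dpow_def by simp
qed

lemma dpred_rel_vec:
  assumes "drel \<M> m n R"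
    and "\<And>v. e v \<in> cart_power m" "\<And>i. simple_term (\<lambda>v. e v i)"
    and "\<And>v. f v \<in> cart_power n" "\<And>i. simple_term (\<lambda>v. f v i)"
  shows "dpred \<M> (\<lambda>v. R (e v) (f v))"
  using assms(1) unfolding drel_def pairing_def by (rule dpred_vec2) (rule assms)+

lemma pairing_upd:
  "pairing m (Suc n) R (z(m + n := t)) \<longleftrightarrow> R (restrict z {..<m}) ((\<lambda>i\<in>{..<n}. z (i + m))(n := t))"
  unfolding pairing_def by (rule arg_cong2[where f = R]) (auto simp: fun_eq_iff)

lemma pairing_join:
  assumes "x \<in> cart_power m" "y \<in> cart_power n"
  shows "join m n x y \<in> cart_power (m + n)" "pairing m n R (join m n x y) \<longleftrightarrow> R x y"
proof -
  show "join m n x y \<in> cart_power (m + n)" unfolding join_def by (rule restrict_in_cart_power)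
  show "pairing m n R (join m n x y) \<longleftrightarrow> R x y"
    unfolding pairing_def
    by (rule arg_cong2[where f = R]) (use assms in \<open>auto simp: join_def fun_eq_iff PiE_iff extensional_def\<close>)
qed

context tame begin

text \<open>Induction on the number of fibre coordinates. Where the section in the last coordinate
  contains no interval, that coordinate is dropped without loss (\<open>dim_ge_thin\<close>).
  Elsewhere dropping it costs at most one, but the dimension of the fibre falls by one too
  (\<open>dim_ge_has_interval\<close>).\<close>

lemma dim_upper:
  assumes "drel \<M> m n R" "\<And>x j. x \<in> cart_power m \<Longrightarrow> dim_ge n (R x) j \<Longrightarrow> j \<le> d"
    and "dim_ge (m + n) (pairing m n R) k"
  shows "\<exists>e. dim_ge m (\<lambda>x. \<exists>y\<in>cart_power n. R x y) e \<and> k \<le> e + d"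
  using assms
proof (induction n arbitrary: R d k)
  case 0
  have "dim_ge m (pairing m 0 R) k" using 0(3) by simp
  then have "dim_ge m (\<lambda>x. \<exists>y\<in>cart_power 0. R x y) k"
  proof (rule dim_ge_mono)
    fix x :: "nat \<Rightarrow> 'a" assume "x \<in> cart_power m" "pairing m 0 R x"
    then have "R x (\<lambda>i\<in>{..<0}. x (i + m))" unfolding pairing_def by (simp only: cart_power_restrict)
    then show "\<exists>y\<in>cart_power 0. R x y" by (rule bexI[OF _ restrict_in_cart_power])
  qed
  then show ?case by (intro exI[of _ k]) simp
next
  case (Suc n)
  note dR = dpred_rel_vec[OF Suc.prems(1)]
  define I where "I x y \<longleftrightarrow> has_interval (\<lambda>t. R x (y(n := t)))" for x y
  have dI: "drel \<M> m n I"
    unfolding drel_def pairing_def I_def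
    by (intro dpred_has_interval dR cart_power_upd restrict_in_cart_power;
        (unfold fun_upd_apply restrict_apply)?; intro simple_term_intros)
  \<comment> \<open>Resetting coordinate \<open>n\<close> to \<open>undefined\<close> turns
    \<open>y\<close> into its base point in \<open>M^n\<close>.\<close>
  define R0 where "R0 x y \<longleftrightarrow> R x y \<and> \<not> I x (y(n := undefined))" for x y
  define R1 where "R1 x y \<longleftrightarrow> R x y \<and> I x (y(n := undefined))" for x y
  have dRp: "dpred \<M> (\<lambda>v. R (restrict v {..<m}) (\<lambda>i\<in>{..<Suc n}. v (i + m)))"
    using Suc.prems(1) unfolding drel_def pairing_def .
  have dIp: "dpred \<M> (\<lambda>v. I (restrict v {..<m}) ((\<lambda>i\<in>{..<Suc n}. v (i + m))(n := undefined)))"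
    by (intro dpred_rel_vec[OF dI] cart_power_drop restrict_in_cart_power;
        (unfold fun_upd_apply restrict_apply)?; intro simple_term_intros)
  have d0: "drel \<M> m (Suc n) R0" unfolding drel_def pairing_def R0_def by (intro dpred_intros dRp dIp)
  have d1: "drel \<M> m (Suc n) R1" unfolding drel_def pairing_def R1_def by (intro dpred_intros dRp dIp)
  have un: "(y(n := t))(n := undefined) = y" if "y \<in> cart_power n" for y :: "nat \<Rightarrow> 'a" and t
    using that by (auto simp: fun_eq_iff PiE_iff extensional_def)
  have tail: "(\<lambda>i\<in>{..<n}. z (i + m)) \<in> cart_power n" for z :: "nat \<Rightarrow> 'a" by (rule restrict_in_cart_power)
  have "dim_ge (m + Suc n) (\<lambda>z. pairing m (Suc n) R0 z \<or> pairing m (Suc n) R1 z) k"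
    by (rule dim_ge_mono[OF Suc.prems(3)]) (auto simp: pairing_def R0_def R1_def)
  then have "dim_ge (m + Suc n) (pairing m (Suc n) R0) k \<or> dim_ge (m + Suc n) (pairing m (Suc n) R1) k"
    by (intro dim_ge_disj dpow_pairing d0 d1)
  then show ?case
  proof
    assume k: "dim_ge (m + Suc n) (pairing m (Suc n) R0) k"
    define S where "S x y \<longleftrightarrow> (\<exists>t. R0 x (y(n := t)))" for x y
    have dS: "drel \<M> m n S"
      unfolding drel_def pairing_def S_def
      by (intro dpred_ex dpred_rel_vec[OF d0] cart_power_upd restrict_in_cart_power;
        (unfold fun_upd_apply restrict_apply)?; intro simple_term_intros)
    have "dim_ge (m + n) (\<lambda>z. \<exists>t. pairing m (Suc n) R0 (z(m + n := t))) k"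
    proof (rule dim_ge_thin)
      show "dpow \<M> (Suc (m + n)) (pairing m (Suc n) R0)" using dpow_pairing[OF d0] by simp
      show "dim_ge (Suc (m + n)) (pairing m (Suc n) R0) k" using k by simp
      fix z :: "nat \<Rightarrow> 'a"
      show "\<not> has_interval (\<lambda>t. pairing m (Suc n) R0 (z(m + n := t)))"
      proof
        assume h: "has_interval (\<lambda>t. pairing m (Suc n) R0 (z(m + n := t)))"
        let ?x = "restrict z {..<m}" and ?y = "\<lambda>i\<in>{..<n}. z (i + m)"
        have "I ?x ?y" unfolding I_def
          by (rule has_interval_mono[OF h]) (simp add: pairing_upd R0_def)
        moreover obtain t where "pairing m (Suc n) R0 (z(m + n := t))" using has_interval_ex[OF h] by (elim exE)
        ultimately show False unfolding pairing_upd R0_def un[OF tail] by (elim conjE) contradiction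
      qed
    qed
    then have "dim_ge (m + n) (pairing m n S) k"
      by (rule dim_ge_mono) (simp add: pairing_upd S_def pairing_def[of m n])
    moreover have "j \<le> d" if "x \<in> cart_power m" "dim_ge n (S x) j" for x j
    proof (rule Suc.prems(2)[OF that(1)])
      show "dim_ge (Suc n) (R x) j"
        by (rule dim_ge_mono[OF dim_ge_lift[OF that(2)[unfolded S_def]]]) (simp add: R0_def)
    qed
    ultimately have "\<exists>e. dim_ge m (\<lambda>x. \<exists>y\<in>cart_power n. S x y) e \<and> k \<le> e + d"
      using Suc.IH[OF dS] by blast
    then obtain e where e: "dim_ge m (\<lambda>x. \<exists>y\<in>cart_power n. S x y) e" "k \<le> e + d" by (elim exE conjE)
    have "dim_ge m (\<lambda>x. \<exists>y\<in>cart_power (Suc n). R x y) e"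
    proof (rule dim_ge_mono[OF e(1)])
      fix x assume "\<exists>y\<in>cart_power n. S x y"
      then obtain y t where y: "y \<in> cart_power n" "R x (y(n := t))"
        unfolding S_def R0_def by (elim bexE exE conjE)
      then show "\<exists>y\<in>cart_power (Suc n). R x y" by (intro bexI[OF _ cart_power_upd[OF y(1)]])
    qed
    with e(2) show ?thesis by (intro exI conjI)
  next
    assume k: "dim_ge (m + Suc n) (pairing m (Suc n) R1) k"
    have "dim_ge (Suc (m + n)) (pairing m (Suc n) R1) k" using k by simp
    then obtain k' where k': "dim_ge (m + n) (\<lambda>z. \<exists>t. pairing m (Suc n) R1 (z(m + n := t))) k'" "k \<le> Suc k'"
      using dim_ge_drop by blast
    from k'(1) have "dim_ge (m + n) (pairing m n I) k'"
    proof (rule dim_ge_mono)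
      fix z :: "nat \<Rightarrow> 'a"
      assume "\<exists>t. pairing m (Suc n) R1 (z(m + n := t))"
      then show "pairing m n I z"
        unfolding pairing_upd R1_def un[OF tail] unfolding pairing_def by (elim exE conjE)
    qed
    moreover have lift: "Suc j \<le> d" if "x \<in> cart_power m" "dim_ge n (I x) j" for x j
    proof (rule Suc.prems(2)[OF that(1)], rule dim_ge_has_interval)
      show "dpow \<M> (Suc n) (R x)"
        unfolding dpow_def
        by (intro dR that(1) restrict_in_cart_power; (unfold restrict_apply)?; intro simple_term_intros)
      show "dim_ge n (\<lambda>y. has_interval (\<lambda>t. R x (y(n := t)))) j" using that(2) unfolding I_def .
    qed
    \<comment> \<open>The subtraction is truncated; that \<open>d\<close> is positive follows below
      from a nonempty fibre of \<open>I\<close>.\<close>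
    then have "j \<le> d - 1" if "x \<in> cart_power m" "dim_ge n (I x) j" for x j using that by fastforce
    ultimately have "\<exists>e. dim_ge m (\<lambda>x. \<exists>y\<in>cart_power n. I x y) e \<and> k' \<le> e + (d - 1)"
      using Suc.IH[OF dI] by blast
    then obtain e where e: "dim_ge m (\<lambda>x. \<exists>y\<in>cart_power n. I x y) e" "k' \<le> e + (d - 1)" by (elim exE conjE)
    obtain x y where "x \<in> cart_power m" "y \<in> cart_power n" "I x y" using dim_ge_nonempty[OF e(1)] by (elim bexE)
    then have "1 \<le> d" using lift dim_ge_0[of y n "I x"] by fastforce
    then have "k \<le> e + d" using e(2) k'(2) by simp
    have "dim_ge m (\<lambda>x. \<exists>y\<in>cart_power (Suc n). R x y) e"
    proof (rule dim_ge_mono[OF e(1)])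
      fix x assume "\<exists>y\<in>cart_power n. I x y"
      then obtain y where y: "y \<in> cart_power n" "I x y" by (elim bexE)
      obtain t where "R x (y(n := t))" using has_interval_ex[OF y(2)[unfolded I_def]] by (elim exE)
      then show "\<exists>y\<in>cart_power (Suc n). R x y" using cart_power_upd[OF y(1)] by (intro bexI)
    qed
    with \<open>k \<le> e + d\<close> show ?thesis by (intro exI conjI)
  qed
qed

text \<open>The projection that exhibits dimension \<open>d\<close> of the fibre depends on the base
  point. Only finitely many are possible, so one of them works over a box of projected base points,
  and \<open>fat_fat\<close> joins it to the projection of the base.\<close>

lemma dim_lower:
  assumes R: "drel \<M> m n R" and e: "dim_ge m (\<lambda>x. dim_ge n (R x) d) e"
  shows "dim_ge (m + n) (pairing m n R) (e + d)"
proof -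
  obtain \<iota> where \<iota>: "\<forall>k<e. \<iota> k < m" "proj_fat m (\<lambda>x. dim_ge n (R x) d) e \<iota>" using e by (rule dim_geE)
  \<comment> \<open>Index maps are taken extensional to make their set finite.\<close>
  let ?K = "{..<d} \<rightarrow>\<^sub>E {..<n}"
  define T where "T \<kappa> u w \<longleftrightarrow> (\<exists>x\<in>cart_power m. (\<forall>k<e. x (\<iota> k) = u k) \<and>
     (\<exists>y\<in>cart_power n. R x y \<and> (\<forall>k<d. y (\<kappa> k) = w k)))" for \<kappa> u w
  have dT: "dpred \<M> (\<lambda>v. T \<kappa> (restrict v {..<e}) (\<lambda>i\<in>{..<d}. v (i + e)))" if \<kappa>: "\<kappa> \<in> ?K" for \<kappa>
  proof -
    have 1: "dpred \<M> (\<lambda>v. restrict v {..<m} (\<iota> k) = restrict (\<lambda>i. v (i + m)) {..<e} k)" if "k < e" for k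
      using that \<iota>(1) by (simp add: dpred_eq_var)
    have 2: "dpred \<M> (\<lambda>v. restrict v {..<n} (\<kappa> k) = (\<lambda>i\<in>{..<d}. v (i + e + m + n)) k)" if "k < d" for k
      using that PiE_mem[OF \<kappa>, of k] by (simp add: dpred_eq_var)
    have 3: "dpred \<M> (\<lambda>v. R (restrict (\<lambda>i. v (i + n)) {..<m}) (restrict v {..<n}))"
      by (intro dpred_rel_vec[OF R] restrict_in_cart_power; (unfold restrict_apply)?; intro simple_term_intros)
    show ?thesis unfolding T_def
      by (intro dpred_bex_power dpred_conj dpred_all_less 1 2 3)
  qed
  have "fat e (\<lambda>u. \<exists>\<kappa>\<in>?K. fat d (T \<kappa> u))"
  proof (rule fat_mono[OF \<iota>(2)[unfolded proj_fat_def]])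
    fix u :: "nat \<Rightarrow> 'a"
    assume "\<exists>x\<in>cart_power m. dim_ge n (R x) d \<and> (\<forall>k<e. x (\<iota> k) = u k)"
    then obtain x where x: "x \<in> cart_power m" "dim_ge n (R x) d" "\<forall>k<e. x (\<iota> k) = u k" by (elim bexE conjE)
    obtain \<kappa> where \<kappa>: "\<forall>k<d. \<kappa> k < n" "proj_fat n (R x) d \<kappa>" using x(2) by (rule dim_geE)
    have "fat d (T (restrict \<kappa> {..<d}) u)"
    proof (rule fat_mono[OF \<kappa>(2)[unfolded proj_fat_def]])
      fix w :: "nat \<Rightarrow> 'a"
      assume "\<exists>y\<in>cart_power n. R x y \<and> (\<forall>k<d. y (\<kappa> k) = w k)"
      then show "T (restrict \<kappa> {..<d}) u w" unfolding T_def using x(1,3) by (intro bexI[of _ x]) auto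
    qed
    then show "\<exists>\<kappa>\<in>?K. fat d (T \<kappa> u)" using \<kappa>(1) by (intro bexI[of _ "restrict \<kappa> {..<d}"]) auto
  qed
  then have "\<exists>\<kappa>\<in>?K. fat e (\<lambda>u. fat d (T \<kappa> u))"
  proof (rule fat_Bex[rotated 2])
    show "finite ?K" by (intro finite_PiE) auto
    fix \<kappa> assume "\<kappa> \<in> ?K"
    then have T: "dpred \<M> (\<lambda>v. T \<kappa> (restrict v {..<e}) (\<lambda>i\<in>{..<d}. v (i + e)))" by (rule dT)
    show "dpow \<M> e (\<lambda>u. fat d (T \<kappa> u))"
      unfolding dpow_def
      by (intro dpred_fat dpred_vec2[where R = "T \<kappa>", OF T] restrict_in_cart_power;
          (unfold restrict_apply)?; intro simple_term_intros)
  qed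
  then obtain \<kappa> where \<kappa>: "\<kappa> \<in> ?K" "fat e (\<lambda>u. fat d (T \<kappa> u))" by (elim bexE)
  define \<theta> where "\<theta> k = (if k < e then \<iota> k else m + \<kappa> (k - e))" for k
  have \<kappa>n: "\<kappa> k < n" if "k < d" for k using PiE_mem[OF \<kappa>(1), of k] that by simp
  show ?thesis
  proof (rule dim_geI)
    show "\<theta> k < m + n" if "k < e + d" for k
      using \<iota>(1) \<kappa>n[of "k - e"] that by (auto simp: \<theta>_def intro: trans_less_add1)
    show "proj_fat (m + n) (pairing m n R) (e + d) \<theta>"
      unfolding proj_fat_def
    proof (rule fat_mono[OF fat_fat[OF dT[OF \<kappa>(1)] \<kappa>(2)]])
      fix z :: "nat \<Rightarrow> 'a"
      assume "T \<kappa> (restrict z {..<e}) (\<lambda>i\<in>{..<d}. z (i + e))"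
      then obtain x y where x: "x \<in> cart_power m" "\<forall>k<e. x (\<iota> k) = restrict z {..<e} k"
        and y: "y \<in> cart_power n" "R x y" "\<forall>k<d. y (\<kappa> k) = (\<lambda>i\<in>{..<d}. z (i + e)) k"
        unfolding T_def by (elim bexE conjE)
      have "join m n x y (\<theta> k) = z k" if k: "k < e + d" for k
      proof (cases "k < e")
        case True
        then have "\<iota> k < m" using \<iota>(1) by blast
        then show ?thesis using x(2) True by (simp add: \<theta>_def join_def)
      next
        case False
        then have "k - e < d" using k by simp
        then have "\<kappa> (k - e) < n" by (rule \<kappa>n)
        then show ?thesis using y(3)[rule_format, OF \<open>k - e < d\<close>] False \<open>k - e < d\<close> by (simp add: \<theta>_def join_def)
      qed
      with y(2) show "\<exists>x\<in>cart_power (m + n). pairing m n R x \<and> (\<forall>k<e + d. x (\<theta> k) = z k)"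
        using pairing_join[OF x(1) y(1)] by (intro bexI[of _ "join m n x y"]) auto
    qed
  qed
qed

end

text \<open>This lets one and the same graph be fibred over either factor.\<close>

lemma dim_ge_swap:
  assumes k: "dim_ge (a + b) (pairing a b S) k"
  shows "dim_ge (b + a) (pairing b a (\<lambda>y x. S x y)) k"
proof -
  obtain \<iota> where \<iota>: "\<forall>j<k. \<iota> j < a + b" "proj_fat (a + b) (pairing a b S) k \<iota>" using k by (rule dim_geE)
  define \<rho> where "\<rho> i = (if i < a then i + b else i - a)" for i
  show ?thesis
  proof (rule dim_geI)
    show "\<rho> (\<iota> j) < b + a" if "j < k" for j using \<iota>(1)[rule_format, OF that] by (auto simp: \<rho>_def)
    show "proj_fat (b + a) (pairing b a (\<lambda>y x. S x y)) k (\<lambda>j. \<rho> (\<iota> j))"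
      unfolding proj_fat_def
    proof (rule fat_mono[OF \<iota>(2)[unfolded proj_fat_def]])
      fix u :: "nat \<Rightarrow> 'a"
      assume "\<exists>z\<in>cart_power (a + b). pairing a b S z \<and> (\<forall>j<k. z (\<iota> j) = u j)"
      then obtain z where z: "pairing a b S z" "\<forall>j<k. z (\<iota> j) = u j" by (elim bexE conjE)
      define x y where "x = restrict z {..<a}" and "y = (\<lambda>i\<in>{..<b}. z (i + a))"
      have xy: "x \<in> cart_power a" "y \<in> cart_power b" unfolding x_def y_def by (rule restrict_in_cart_power)+
      have "S x y" using z(1) unfolding pairing_def x_def y_def .
      then have "pairing b a (\<lambda>y x. S x y) (join b a y x)" using pairing_join(2)[OF xy(2,1)] by simp
      moreover have "join b a y x (\<rho> (\<iota> j)) = u j" if "j < k" for j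
        using \<iota>(1)[rule_format, OF that] z(2)[rule_format, OF that]
        by (auto simp: join_def \<rho>_def x_def y_def)
      ultimately show "\<exists>z\<in>cart_power (b + a). pairing b a (\<lambda>y x. S x y) z \<and> (\<forall>j<k. z (\<rho> (\<iota> j)) = u j)"
        using pairing_join(1)[OF xy(2,1)] by (intro bexI[of _ "join b a y x"]) auto
    qed
  qed
qed

section \<open>Comparison with the topological definition of dimension\<close>

lemma interior_of_power_top:
  fixes S :: "(nat \<Rightarrow> 'a::{unbounded_dense_linorder, linorder_topology}) set"
  shows "power_top d interior_of S \<noteq> {} \<longleftrightarrow> fat d (\<lambda>u. u \<in> S)"
proof
  assume "power_top d interior_of S \<noteq> {}"
  then obtain x where "x \<in> power_top d interior_of S" by blast
  then obtain T where T: "openin (power_top d) T" "x \<in> T" "T \<subseteq> S" unfolding interior_of_def by blast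
  from bspec[OF T(1)[unfolded openin_product_topology_alt] T(2)]
  obtain U where U: "\<forall>i\<in>{..<d}. openin euclidean (U i)" "x \<in> PiE {..<d} U" "PiE {..<d} U \<subseteq> T"
    by (elim exE conjE)
  have "\<exists>l u. i < d \<longrightarrow> l < x i \<and> x i < u \<and> {l<..<u} \<subseteq> U i" for i
  proof (cases "i < d")
    case True
    then have o: "open (U i)" "x i \<in> U i" using U by auto
    obtain a b where "a < x i" "x i < b" using lt_ex gt_ex by meson
    obtain u where u: "u > x i" "{x i..<u} \<subseteq> U i" using open_right[OF o \<open>x i < b\<close>] by blast
    obtain l where l: "l < x i" "{l<..x i} \<subseteq> U i" using open_left[OF o \<open>a < x i\<close>] by blast
    have "{l<..<u} \<subseteq> {l<..x i} \<union> {x i..<u}" by auto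
    then show ?thesis using l u by blast
  qed simp
  then obtain l u where lu: "\<And>i. i < d \<Longrightarrow> l i < x i \<and> x i < u i \<and> {l i<..<u i} \<subseteq> U i" by metis
  show "fat d (\<lambda>u. u \<in> S)"
    unfolding fat_def
  proof (rule exI[of _ l], rule exI[of _ u], intro conjI allI ballI impI)
    show "l i < u i" if "i < d" for i using lu[OF that] by auto
    fix y assume y: "y \<in> cart_power d" "\<forall>i<d. l i < y i \<and> y i < u i"
    have "y \<in> PiE {..<d} U"
      using y lu by (intro PiE_I) (auto simp: PiE_iff extensional_def subset_iff)
    then show "y \<in> S" using U(3) T(3) by blast
  qed
next
  assume "fat d (\<lambda>u. u \<in> S)"
  then obtain l u where lu: "\<forall>i<d. l i < u i" "\<forall>x\<in>cart_power d. (\<forall>i<d. l i < x i \<and> x i < u i) \<longrightarrow> x \<in> S"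
    unfolding fat_def by (elim exE conjE)
  let ?B = "PiE {..<d} (\<lambda>i. {l i<..<u i})"
  have "?B \<subseteq> S"
  proof
    fix x assume x: "x \<in> ?B"
    then have "x \<in> cart_power d" by (auto simp: PiE_iff)
    then show "x \<in> S" using x by (intro lu(2)[rule_format]) (auto simp: PiE_iff)
  qed
  moreover have "openin (power_top d) ?B" by (rule openin_PiE_gen[THEN iffD2]) auto
  ultimately have "?B \<subseteq> power_top d interior_of S" by (rule interior_of_maximal)
  moreover have "?B \<noteq> {}" using lu(1) by (auto simp: PiE_eq_empty_iff)
  ultimately show "power_top d interior_of S \<noteq> {}" by blast
qed

lemma dim_ge_iff_projection:
  fixes X :: "(nat \<Rightarrow> 'a::{unbounded_dense_linorder, linorder_topology}) set"
  assumes X: "X \<subseteq> cart_power n"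
  shows "(\<exists>\<pi>\<in>coord_projections n d. power_top d interior_of (\<pi> ` X) \<noteq> {}) \<longleftrightarrow> dim_ge n (\<lambda>x. x \<in> X) d"
proof -
  have img: "u \<in> (\<lambda>x. \<lambda>k\<in>{..<d}. x (\<iota> k)) ` X \<longleftrightarrow> (\<exists>x\<in>cart_power n. x \<in> X \<and> (\<forall>k<d. x (\<iota> k) = u k))"
    if "u \<in> cart_power d" for u and \<iota> :: "nat \<Rightarrow> nat"
  proof -
    have "u = (\<lambda>k\<in>{..<d}. x (\<iota> k)) \<longleftrightarrow> (\<forall>k<d. x (\<iota> k) = u k)" for x
      using that by (auto simp: fun_eq_iff PiE_iff extensional_def)
    then show ?thesis using X by (auto simp: image_iff)
  qed
  have pf: "power_top d interior_of ((\<lambda>x. \<lambda>k\<in>{..<d}. x (\<iota> k)) ` X) \<noteq> {} \<longleftrightarrow> proj_fat n (\<lambda>x. x \<in> X) d \<iota>" for \<iota>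
    unfolding interior_of_power_top proj_fat_def
    by (rule iffI; erule fat_mono) (simp_all only: img)
  show ?thesis
  proof
    assume "\<exists>\<pi>\<in>coord_projections n d. power_top d interior_of (\<pi> ` X) \<noteq> {}"
    then obtain \<iota> where "\<iota> \<in> {..<d} \<rightarrow> {..<n}" "proj_fat n (\<lambda>x. x \<in> X) d \<iota>"
      unfolding coord_projections_def using pf by blast
    then show "dim_ge n (\<lambda>x. x \<in> X) d" by (intro dim_geI[of d \<iota>]) auto
  next
    assume "dim_ge n (\<lambda>x. x \<in> X) d"
    then obtain \<iota> where \<iota>: "\<forall>k<d. \<iota> k < n" "proj_fat n (\<lambda>x. x \<in> X) d \<iota>" by (rule dim_geE)
    have inj: "inj_on \<iota> {..<d}" using \<iota>(2) by (rule proj_fat_inj)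
    have card: "card (\<iota> ` {..<d}) = d" using card_image[OF inj] by simp
    \<comment> \<open>Coordinate projections list their coordinates in increasing order;
      \<open>h\<close> enumerates the range of \<open>\<iota>\<close> in this way and differs from
      \<open>\<iota>\<close> by the permutation \<open>\<sigma>\<close>.\<close>
    obtain h where h: "bij_betw h {..<d} (\<iota> ` {..<d})" "strict_mono_on {..<d} h"
      using ex_bij_betw_strict_mono_card[of "\<iota> ` {..<d}"] unfolding card by blast
    define \<sigma> where "\<sigma> k = inv_into {..<d} \<iota> (h k)" for k
    have "bij_betw \<sigma> {..<d} {..<d}"
      using bij_betw_trans[OF h(1) bij_betw_inv_into[OF inj_on_imp_bij_betw[OF inj]]]
      unfolding \<sigma>_def comp_def .
    from proj_fat_perm[OF this \<iota>(2)] have p: "proj_fat n (\<lambda>x. x \<in> X) d (\<lambda>k. \<iota> (\<sigma> k))" .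
    have hk: "\<iota> (\<sigma> k) = h k" "h k < n" if "k < d" for k
    proof -
      have "h k \<in> \<iota> ` {..<d}" using bij_betwE[OF h(1)] that by blast
      then show "\<iota> (\<sigma> k) = h k" "h k < n" using \<iota>(1) unfolding \<sigma>_def by (auto simp: f_inv_into_f)
    qed
    have "proj_fat n (\<lambda>x. x \<in> X) d h"
      using p unfolding proj_fat_def by (rule fat_mono) (use hk(1) in simp)
    then have "power_top d interior_of ((\<lambda>x. \<lambda>k\<in>{..<d}. x (h k)) ` X) \<noteq> {}" unfolding pf .
    moreover have "(\<lambda>x. \<lambda>k\<in>{..<d}. x (h k)) \<in> coord_projections n d"
      unfolding coord_projections_def using h(2) hk(2) by blast
    ultimately show "\<exists>\<pi>\<in>coord_projections n d. power_top d interior_of (\<pi> ` X) \<noteq> {}" by (rule bexI)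
  qed
qed

text \<open>In positive dimension the last coordinate of the projection takes two values, which
  requires two points. This is applied to the one-point fibres of a graph.\<close>

lemma dim_ge_singleton:
  fixes P :: "(nat \<Rightarrow> 'a::unbounded_dense_linorder) \<Rightarrow> bool"
  assumes "dim_ge n P j" "\<And>x y. P x \<Longrightarrow> P y \<Longrightarrow> x = y"
  shows "j = 0"
proof (rule ccontr)
  assume "j \<noteq> 0"
  then obtain i where i: "j = Suc i" by (cases j) auto
  obtain \<iota> where "proj_fat n P j \<iota>" using assms(1) by (rule dim_geE)
  then obtain p q where pq: "p < q" "fat i (\<lambda>u. \<forall>t. p < t \<and> t < q \<longrightarrow>
      (\<exists>x\<in>cart_power n. P x \<and> (\<forall>k<Suc i. x (\<iota> k) = (u(i := t)) k)))"
    unfolding proj_fat_def i fat_Suc by (elim exE conjE)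
  obtain u where u: "\<forall>t. p < t \<and> t < q \<longrightarrow> (\<exists>x\<in>cart_power n. P x \<and> (\<forall>k<Suc i. x (\<iota> k) = (u(i := t)) k))"
    using fat_ex[OF pq(2)] by (elim bexE)
  obtain s where s: "p < s" "s < q" using dense[OF pq(1)] by (elim exE conjE)
  obtain t where t: "s < t" "t < q" using dense[OF s(2)] by (elim exE conjE)
  have "\<exists>x. P x \<and> x (\<iota> i) = r" if "p < r \<and> r < q" for r
    using u[rule_format, OF that] by (elim bexE conjE) auto
  then obtain x y where "P x" "x (\<iota> i) = s" "P y" "y (\<iota> i) = t" using s t by (meson less_trans)
  then show False using assms(2)[of x y] t(1) by simp
qed

text \<open>Replaces the maximum by an attained lower bound and an upper bound, the two forms that
  \<open>dim_lower\<close> and \<open>dim_upper\<close> work with.\<close>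

lemma set_dim_eq:
  fixes X :: "(nat \<Rightarrow> 'a::{unbounded_dense_linorder, linorder_topology}) set"
  assumes "X \<subseteq> cart_power n" "X \<noteq> {}"
  shows "\<exists>D. set_dim n X = Fin D \<and> dim_ge n (\<lambda>x. x \<in> X) D \<and> (\<forall>k. dim_ge n (\<lambda>x. x \<in> X) k \<longrightarrow> k \<le> D)"
proof -
  let ?A = "{d. dim_ge n (\<lambda>x. x \<in> X) d}"
  have "?A \<subseteq> {..n}" using dim_ge_le by blast
  then have fin: "finite ?A" by (rule finite_subset) simp
  obtain x where "x \<in> X" using assms(2) by blast
  then have "0 \<in> ?A" using assms(1) dim_ge_0[of x n "\<lambda>x. x \<in> X"] by blast
  then have "Max ?A \<in> ?A" using fin by (intro Max_in) auto
  moreover have "k \<le> Max ?A" if "k \<in> ?A" for k using fin that by (rule Max_ge)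
  moreover have "set_dim n X = Fin (Max ?A)"
    unfolding set_dim_def dim_ge_iff_projection[OF assms(1)] using assms(2) by simp
  ultimately show ?thesis by blast
qed

theorem theorem3p14:
  fixes \<M> :: "('a::{unbounded_dense_linorder, linorder_topology}, 'f, 'r) ostruct"
    and m n :: nat
    and X Y :: "(nat \<Rightarrow> 'a) set"
    and \<phi> :: "(nat \<Rightarrow> 'a) \<Rightarrow> nat \<Rightarrow> 'a"
  assumes "definably_complete \<M>"
    and "locally_o_minimal \<M>"
    and "property_a \<M>"
    and "definable \<M> m X"
    and "definable \<M> n Y"
    and "definable_map \<M> m n X Y \<phi>"
    and "\<phi> ` X = Y"
    and "\<forall>y\<in>Y. \<forall>y'\<in>Y. set_dim m {x \<in> X. \<phi> x = y} = set_dim m {x \<in> X. \<phi> x = y'}"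
  shows "\<forall>y\<in>Y. set_dim m X = set_dim n Y + set_dim m {x \<in> X. \<phi> x = y}"
proof
  fix y0 assume y0: "y0 \<in> Y"
  interpret tame \<M> using assms(1-3) by unfold_locales
  have Xm: "X \<subseteq> cart_power m" and Yn: "Y \<subseteq> cart_power n"
    using assms(4,5) unfolding definable_iff_dpow by blast+
  have \<phi>Y: "\<phi> x \<in> Y" if "x \<in> X" for x using assms(7) that by blast
  define G where "G = (\<lambda>x. join m n x (\<phi> x)) ` X"
  have G: "dpow \<M> (m + n) (\<lambda>z. z \<in> G)"
    using assms(6) unfolding definable_map_def definable_iff_dpow G_def by blast
  define R where "R x y \<longleftrightarrow> x \<in> X \<and> \<phi> x = y" for x y
  have RG: "R x y \<longleftrightarrow> join m n x y \<in> G" if x: "x \<in> cart_power m" and y: "y \<in> cart_power n" for x y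
  proof
    assume "join m n x y \<in> G"
    then obtain x' where x': "x' \<in> X" "join m n x y = join m n x' (\<phi> x')" unfolding G_def by blast
    have c: "x' \<in> cart_power m" "\<phi> x' \<in> cart_power n" using x'(1) Xm Yn \<phi>Y by blast+
    \<comment> \<open>Testing for equality with \<open>x\<close> and \<open>y\<close> recovers both
      components, so \<open>join\<close> is injective on points of the two powers.\<close>
    have "pairing m n (\<lambda>a b. a = x \<and> b = y) (join m n x y)" using pairing_join(2)[OF x y] by simp
    then have "x' = x \<and> \<phi> x' = y" unfolding x'(2) pairing_join(2)[OF c] .
    with x'(1) show "R x y" unfolding R_def by blast
  qed (auto simp: R_def G_def)
  \<comment> \<open>The free offsets \<open>a\<close> and \<open>b\<close> give definability of the
    graph in both orders of its variables.\<close>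
  have dR: "dpred \<M> (\<lambda>v. R (\<lambda>i\<in>{..<m}. v (i + a)) (\<lambda>i\<in>{..<n}. v (i + b)))" for a b
  proof -
    have "dpred \<M> (\<lambda>v. join m n (\<lambda>i\<in>{..<m}. v (i + a)) (\<lambda>i\<in>{..<n}. v (i + b)) \<in> G)"
    proof (rule dpred_vec[OF G])
      show "join m n (\<lambda>i\<in>{..<m}. v (i + a)) (\<lambda>i\<in>{..<n}. v (i + b)) \<in> cart_power (m + n)" for v
        by (intro pairing_join(1) restrict_in_cart_power)
      show "simple_term (\<lambda>v. join m n (\<lambda>i\<in>{..<m}. v (i + a)) (\<lambda>i\<in>{..<n}. v (i + b)) k)" for k
        unfolding join_def restrict_apply by (intro simple_term_intros)
    qed
    then show ?thesis unfolding RG[OF restrict_in_cart_power restrict_in_cart_power] .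
  qed
  have R1: "drel \<M> m n R" unfolding drel_def pairing_def using dR[of 0 m] by simp
  have R2: "drel \<M> n m (\<lambda>y x. R x y)" unfolding drel_def pairing_def using dR[of n 0] by simp
  obtain x0 where x0: "x0 \<in> X" "\<phi> x0 = y0" using y0 assms(7) by blast
  obtain D where D: "set_dim m X = Fin D" "dim_ge m (\<lambda>x. x \<in> X) D" "\<And>k. dim_ge m (\<lambda>x. x \<in> X) k \<Longrightarrow> k \<le> D"
    using set_dim_eq[OF Xm] x0(1) by blast
  obtain e where e: "set_dim n Y = Fin e" "dim_ge n (\<lambda>y. y \<in> Y) e" "\<And>k. dim_ge n (\<lambda>y. y \<in> Y) k \<Longrightarrow> k \<le> e"
    using set_dim_eq[OF Yn] y0 by blast
  have fib: "\<exists>d. set_dim m {x \<in> X. \<phi> x = y} = Fin d \<and> dim_ge m (\<lambda>x. R x y) d \<and> (\<forall>k. dim_ge m (\<lambda>x. R x y) k \<longrightarrow> k \<le> d)"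
    if "y \<in> Y" for y
  proof -
    have "{x \<in> X. \<phi> x = y} \<subseteq> cart_power m" "{x \<in> X. \<phi> x = y} \<noteq> {}" using Xm that assms(7) by auto
    from set_dim_eq[OF this] show ?thesis unfolding R_def by simp
  qed
  obtain d where d: "set_dim m {x \<in> X. \<phi> x = y0} = Fin d" using fib[OF y0] by blast
  have fibd: "dim_ge m (\<lambda>x. R x y) d \<and> (\<forall>k. dim_ge m (\<lambda>x. R x y) k \<longrightarrow> k \<le> d)" if y: "y \<in> Y" for y
  proof -
    have "set_dim m {x \<in> X. \<phi> x = y} = Fin d"
      by (rule trans[OF bspec[OF bspec[OF assms(8) y] y0] d])
    with fib[OF y] show ?thesis by auto
  qed
  \<comment> \<open>For \<open>e + d \<le> D\<close> the graph is bounded from below over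
    \<open>Y\<close>, with fibres of dimension \<open>d\<close>, and from above over
    \<open>X\<close>, with one-point fibres.\<close>
  have "dim_ge n (\<lambda>y. dim_ge m (\<lambda>x. R x y) d) e" using e(2) by (rule dim_ge_mono) (use fibd in blast)
  from dim_lower[OF R2 this] have "dim_ge (n + m) (pairing n m (\<lambda>y x. R x y)) (e + d)" .
  from dim_ge_swap[OF this] have "dim_ge (m + n) (pairing m n R) (e + d)" .
  then have "\<exists>k. dim_ge m (\<lambda>x. \<exists>y\<in>cart_power n. R x y) k \<and> e + d \<le> k + 0"
  proof (rule dim_upper[OF R1, rotated])
    fix x j assume "dim_ge n (R x) j"
    then have "j = 0" by (rule dim_ge_singleton) (simp add: R_def)
    then show "j \<le> 0" by simp
  qed
  then obtain k where k: "dim_ge m (\<lambda>x. \<exists>y\<in>cart_power n. R x y) k" "e + d \<le> k" by auto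
  have "dim_ge m (\<lambda>x. x \<in> X) k" by (rule dim_ge_mono[OF k(1)]) (auto simp: R_def)
  then have le: "e + d \<le> D" using D(3) k(2) by fastforce
  \<comment> \<open>For \<open>D \<le> e + d\<close> the roles are exchanged: one-point fibres over
    \<open>X\<close> bound the graph from below, the fibres over \<open>Y\<close> from
    above.\<close>
  have "dim_ge m (\<lambda>x. dim_ge n (R x) 0) D"
  proof (rule dim_ge_mono[OF D(2)])
    fix x assume "x \<in> X"
    then have "\<phi> x \<in> cart_power n" "R x (\<phi> x)" using Yn \<phi>Y unfolding R_def by blast+
    then show "dim_ge n (R x) 0" by (rule dim_ge_0)
  qed
  from dim_lower[OF R1 this] have "dim_ge (m + n) (pairing m n R) D" by simp
  from dim_ge_swap[OF this] have "dim_ge (n + m) (pairing n m (\<lambda>y x. R x y)) D" .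
  then have "\<exists>k. dim_ge n (\<lambda>y. \<exists>x\<in>cart_power m. R x y) k \<and> D \<le> k + d"
  proof (rule dim_upper[OF R2, rotated])
    fix y j assume j: "dim_ge m (\<lambda>x. R x y) j"
    then have "y \<in> Y" using dim_ge_nonempty[OF j] \<phi>Y unfolding R_def by blast
    then show "j \<le> d" using fibd j by blast
  qed
  then obtain k where k: "dim_ge n (\<lambda>y. \<exists>x\<in>cart_power m. R x y) k" "D \<le> k + d" by (elim exE conjE)
  have "dim_ge n (\<lambda>y. y \<in> Y) k" by (rule dim_ge_mono[OF k(1)]) (use \<phi>Y in \<open>auto simp: R_def\<close>)
  then have "D \<le> e + d" using e(3) k(2) by fastforce
  with le show "set_dim m X = set_dim n Y + set_dim m {x \<in> X. \<phi> x = y0}"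
    unfolding D(1) e(1) d by simp
qed

end
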